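(* For every positive integer $r$ and every one of the six models (Independent set, MAX-CUT, anti-ferromagnetic Ising, $q$-Coloring, K-SAT, NAE-K-SAT), there exists a (model dependent) $H(r)$ such that $$\lim_{N\to\infty,\ N\in r^{-1}K\mathbb{Z}_+}N^{-1}H\big(\mathbb{G}(N,r)\big)=H(r)$$ with high probability (in probability).
   Context: Let $K\ge2$, $\chi=\{0,\dots,q-1\}$, $[N]=\{1,\dots,N\}$, and assume $Nr/K$ is an integer. The random $r$-regular hypergraph $\mathbb{G}(N,r)$ is built by the configuration model: each node $i\in[N]$ is given $r$ copies (points), giving $Nr$ points; a uniformly random partition of these $Nr$ points into $Nr/K$ blocks of size $K$ is chosen, and each block is projected to the (directed) hyperedge formed by the nodes owning its $K$ points. For a hypergraph $G=([N],E)$ with node potentials $H_i$ and edge potentials $H_e:\chi^K\to\mathbb{R}\cup\{-\infty\}$, $H(x)=\sum_iH_i(x_i)+\sum_{e\in E}H_e(x_e)$ and $H(G)=\max_{x\in\chi^N}H(x)$. Models: Independent set ($K=2,q=2$, $H_i(1)=1,H_i(0)=0$, $H_e(1,1)=-\infty$, else $0$); MAX-CUT ($K=2,q=2$, $H_i\equiv0$, $H_e(x,y)=\mathbf 1[x\ne y]$); anti-ferromagnetic Ising ($K=2,q=2$, fixed $\beta>0,B\in\mathbb{R}$, $H_i(0)=-B,H_i(1)=B$, $H_e(x,y)=-\beta$ if $x=y$, $\beta$ otherwise); $q$-Coloring ($K=2$, $H_i\equiv0$, $H_e(x,y)=\mathbf 1[x\ne y]$); K-SAT ($q=2$, $H_i\equiv0$,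 independent uniform $a_e\in\{0,1\}^K$ per hyperedge, $H_e(a_e)=0$, $1$ otherwise); NAE-K-SAT (same with $H_e(a_e)=H_e(\mathbf1-a_e)=0$, $1$ otherwise). *)

theory Defs
  imports "HOL-Probability.Probability"
begin

text \<open>A (spin) model: arity K of hyperedges, alphabet size q (spins 0..q-1),
 node potential, and edge potential. The edge potential additionally receives
 the per-hyperedge random sign vector a_e (a list of K booleans); models
 other than K-SAT / NAE-K-SAT ignore it.\<close>

record model =
  mK :: nat
  mq :: nat
  node_pot :: "nat \<Rightarrow> ereal"
  edge_pot :: "bool list \<Rightarrow> nat list \<Rightarrow> ereal"

definition bit :: "bool \<Rightarrow> nat" where "bit b = (if b then 1 else 0)"

definition indep_set_model :: model where
  "indep_set_model = \<lparr> mK = 2, mq = 2,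
     node_pot = (\<lambda>x. if x = 1 then 1 else 0),
     edge_pot = (\<lambda>a xs. if xs ! 0 = 1 \<and> xs ! 1 = 1 then -\<infinity> else 0) \<rparr>"

definition maxcut_model :: model where
  "maxcut_model = \<lparr> mK = 2, mq = 2,
     node_pot = (\<lambda>x. 0),
     edge_pot = (\<lambda>a xs. if xs ! 0 \<noteq> xs ! 1 then 1 else 0) \<rparr>"

definition ising_model :: "real \<Rightarrow> real \<Rightarrow> model" where
  "ising_model \<beta> B = \<lparr> mK = 2, mq = 2,
     node_pot = (\<lambda>x. if x = 0 then ereal (- B) else ereal B),
     edge_pot = (\<lambda>a xs. if xs ! 0 = xs ! 1 then ereal (- \<beta>) else ereal \<beta>) \<rparr>"

definition coloring_model :: "nat \<Rightarrow> model" where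
  "coloring_model q = \<lparr> mK = 2, mq = q,
     node_pot = (\<lambda>x. 0),
     edge_pot = (\<lambda>a xs. if xs ! 0 \<noteq> xs ! 1 then 1 else 0) \<rparr>"

definition ksat_model :: "nat \<Rightarrow> model" where
  "ksat_model K = \<lparr> mK = K, mq = 2,
     node_pot = (\<lambda>x. 0),
     edge_pot = (\<lambda>a xs. if xs = map bit a then 0 else 1) \<rparr>"

definition naeksat_model :: "nat \<Rightarrow> model" where
  "naeksat_model K = \<lparr> mK = K, mq = 2,
     node_pot = (\<lambda>x. 0),
     edge_pot = (\<lambda>a xs. if xs = map bit a \<or> xs = map (\<lambda>b. 1 - bit b) a then 0 else 1) \<rparr>"

definition paper_model :: "model \<Rightarrow> bool" where
  "paper_model M \<longleftrightarrow>
     M = indep_set_model \<or> M = maxcut_model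
   \<or> (\<exists>\<beta> B. \<beta> > 0 \<and> M = ising_model \<beta> B)
   \<or> (\<exists>q\<ge>2. M = coloring_model q)
   \<or> (\<exists>K\<ge>2. M = ksat_model K)
   \<or> (\<exists>K\<ge>2. M = naeksat_model K)"

text \<open>Configuration model: node i \<in> {0..<N} owns the points {i*r..<(i+1)*r};
 the points {0..<N*r} are partitioned into blocks of size K.\<close>
definition config_partitions :: "nat \<Rightarrow> nat \<Rightarrow> nat \<Rightarrow> nat set set set" where
  "config_partitions N r K =
     {P. (\<forall>B\<in>P. B \<subseteq> {..<N*r} \<and> card B = K) \<and> (\<forall>p<N*r. \<exists>!B. B \<in> P \<and> p \<in> B)}"

definition edge_nodes :: "nat \<Rightarrow> nat set \<Rightarrow> nat list" where
  "edge_nodes r B = map (\<lambda>p. p div r) (sorted_list_of_set B)"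

definition random_hypergraph :: "nat \<Rightarrow> nat \<Rightarrow> nat \<Rightarrow> (nat set set \<times> (nat set \<Rightarrow> bool list)) pmf" where
  "random_hypergraph K N r =
     do { P \<leftarrow> pmf_of_set (config_partitions N r K);
          a \<leftarrow> pmf_of_set (PiE P (\<lambda>_. {a. length a = K}));
          return_pmf (P, a) }"

definition H_config :: "model \<Rightarrow> nat \<Rightarrow> nat \<Rightarrow> nat set set \<Rightarrow> (nat set \<Rightarrow> bool list)
     \<Rightarrow> (nat \<Rightarrow> nat) \<Rightarrow> ereal" where
  "H_config M N r P a x =
     (\<Sum>i<N. node_pot M (x i)) + (\<Sum>B\<in>P. edge_pot M (a B) (map x (edge_nodes r B)))"

definition H_graph :: "model \<Rightarrow> nat \<Rightarrow> nat \<Rightarrow> nat set set \<times> (nat set \<Rightarrow> bool list) \<Rightarrow> ereal" where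
  "H_graph M N r G =
     Max (H_config M N r (fst G) (snd G) ` PiE {..<N} (\<lambda>_. {..<mq M}))"

end

theory Submission
  imports Defs "HOL-Real_Asymp.Real_Asymp" "HOL-Library.Ramsey"
begin

text \<open>
  After rescaling, adding a hyperedge to a graph raises the optimum by an amount in [0,1] (for independent
  sets the hard constraint is first replaced by a penalty of 1 per violated edge, which does not change the
  optimum). Hence the optimum is a Lipschitz function of the random partition, its variance is O(N), and only
  the convergence of the mean has to be shown.

  Split the points into two sides of sizes proportional to p and q. A global step adds a block each of whose
  points chooses its side independently with probabilities p and q; a split step chooses one side with these
  probabilities and takes the whole block there. In both cases the points are uniform among the free points of
  their sides. All these steps commute, so that one step can be exchanged for the other one as if it came
  last. At that moment the block raises the optimum by less than 1 - t exactly if it is bad for all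
  assignments within t of the optimum, and for each of the six models this means, up to a factor depending on
  the signs, that all its nodes lie in one class of a partial equivalence relation. By convexity of the K-th
  power a split step is more likely to do so than a global one, up to an error of order 1/m when at least m
  points are free on each side. A Chernoff bound excludes the case of fewer free points. Exchanging all steps
  compares the graph on N1 + N2 nodes with the disjoint union of graphs on N1 and N2 nodes: for N1 and N2
  within a factor 2 of each other, the mean is superadditive up to an error of order N^(3/4), so it converges
  after division by N.
\<close>

section \<open>Averages\<close>

definition average :: "'a set \<Rightarrow> ('a \<Rightarrow> real) \<Rightarrow> real" where
  "average X f = (\<Sum>x\<in>X. f x) / real (card X)"

lemma average_cong: "(\<And>x. x \<in> X \<Longrightarrow> f x = g x) \<Longrightarrow> average X f = average X g"
  by (simp add: average_def cong: sum.cong)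

lemma average_mono: "(\<And>x. x \<in> X \<Longrightarrow> f x \<le> g x) \<Longrightarrow> average X f \<le> average X g"
  unfolding average_def by (intro divide_right_mono sum_mono) auto

lemma average_nonneg: "(\<And>x. x \<in> X \<Longrightarrow> 0 \<le> f x) \<Longrightarrow> 0 \<le> average X f"
  unfolding average_def by (intro divide_nonneg_nonneg sum_nonneg) auto

lemma average_add: "average X (\<lambda>x. f x + g x) = average X f + average X g"
  by (simp add: average_def sum.distrib add_divide_distrib)

lemma average_diff: "average X (\<lambda>x. f x - g x) = average X f - average X g"
  by (simp add: average_def sum_subtractf diff_divide_distrib)

lemma average_cmult: "average X (\<lambda>x. c * f x) = c * average X f"
  by (simp add: average_def sum_distrib_left)

lemma average_sum: "average X (\<lambda>x. \<Sum>y\<in>Y. f x y) = (\<Sum>y\<in>Y. average X (\<lambda>x. f x y))"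
  unfolding average_def sum_divide_distrib[symmetric] by (subst sum.swap) simp

lemma average_const: "finite X \<Longrightarrow> X \<noteq> {} \<Longrightarrow> average X (\<lambda>_. c) = c"
  by (simp add: average_def)

lemma average_commute: "average X (\<lambda>x. average Y (f x)) = average Y (\<lambda>y. average X (\<lambda>x. f x y))"
  unfolding average_def sum_divide_distrib[symmetric] by (subst sum.swap) (simp add: field_simps)

lemma average_Sigma:
  assumes "finite X" "\<And>x. x \<in> X \<Longrightarrow> finite (Y x)" "\<And>x. x \<in> X \<Longrightarrow> card (Y x) = n"
  shows "average (Sigma X Y) f = average X (\<lambda>x. average (Y x) (\<lambda>y. f (x, y)))"
proof -
  have "(\<Sum>x\<in>X. average (Y x) (\<lambda>y. f (x, y))) = (\<Sum>x\<in>X. \<Sum>y\<in>Y x. f (x, y)) / real n"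
    using assms(3) by (simp add: average_def sum_divide_distrib)
  moreover have "card (Sigma X Y) = card X * n" using assms by (simp add: card_SigmaI)
  ultimately show ?thesis using assms by (simp add: average_def sum.Sigma mult.commute)
qed

lemma average_reindex_bij_betw: "bij_betw h X Y \<Longrightarrow> average Y f = average X (\<lambda>x. f (h x))"
  by (simp add: average_def sum.reindex_bij_betw bij_betw_same_card)

lemma average_le:
  assumes "finite X" "0 \<le> c" "\<And>x. x \<in> X \<Longrightarrow> f x \<le> c"
  shows "average X f \<le> c"
  using average_mono[of X f "\<lambda>_. c"] assms by (cases "X = {}") (auto simp: average_const average_def)

lemma abs_average_diff_le:
  assumes "finite X" "0 \<le> c" "\<And>x. x \<in> X \<Longrightarrow> \<bar>f x - g x\<bar> \<le> c"
  shows "\<bar>average X f - average X g\<bar> \<le> c"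
proof -
  have "average X (\<lambda>x. f x - g x) \<le> c" "average X (\<lambda>x. g x - f x) \<le> c"
    using assms by (intro average_le; fastforce simp: abs_le_iff)+
  then show ?thesis by (simp add: average_diff abs_le_iff)
qed

lemma exists_le_average:
  assumes "finite X" "X \<noteq> {}"
  obtains x where "x \<in> X" "f x \<le> average X f"
proof (rule ccontr)
  assume "\<not> thesis"
  then have "average X f < f x" if "x \<in> X" for x
    using that \<open>\<And>x. x \<in> X \<Longrightarrow> f x \<le> average X f \<Longrightarrow> thesis\<close> by force
  then have "(\<Sum>x\<in>X. average X f) < (\<Sum>x\<in>X. f x)" using assms by (intro sum_strict_mono) auto
  then show False using assms by (simp add: average_def)
qed

lemma average_square_deviation:
  assumes "finite X" "X \<noteq> {}"
  shows "average X (\<lambda>x. (f x - c)\<^sup>2) = average X (\<lambda>x. (f x - average X f)\<^sup>2) + (average X f - c)\<^sup>2"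
proof -
  define \<mu> where "\<mu> = average X f"
  have "average X (\<lambda>x. (f x - c)\<^sup>2)
      = average X (\<lambda>x. (f x - \<mu>)\<^sup>2 + (2 * (\<mu> - c) * (f x - \<mu>) + (\<mu> - c)\<^sup>2))"
    by (intro average_cong) (simp add: power2_eq_square algebra_simps)
  also have "\<dots> = average X (\<lambda>x. (f x - \<mu>)\<^sup>2) + (2 * (\<mu> - c) * (average X f - \<mu>) + (\<mu> - c)\<^sup>2)"
    unfolding average_add average_cmult average_diff average_const[OF assms] ..
  finally show ?thesis by (simp add: \<mu>_def)
qed

lemma average_Chebyshev:
  assumes "finite X" "X \<noteq> {}" "0 < t"
  shows "measure_pmf.prob (pmf_of_set X) {x. t \<le> \<bar>f x - c\<bar>} \<le> average X (\<lambda>x. (f x - c)\<^sup>2) / t\<^sup>2"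
proof -
  have "real (card (X \<inter> {x. t \<le> \<bar>f x - c\<bar>})) * t\<^sup>2 = (\<Sum>x\<in>X \<inter> {x. t \<le> \<bar>f x - c\<bar>}. t\<^sup>2)" by simp
  also have "\<dots> \<le> (\<Sum>x\<in>X \<inter> {x. t \<le> \<bar>f x - c\<bar>}. (f x - c)\<^sup>2)"
    using assms(3) by (intro sum_mono) (auto simp: abs_le_square_iff[symmetric])
  also have "\<dots> \<le> (\<Sum>x\<in>X. (f x - c)\<^sup>2)"
    using assms(1) by (intro sum_mono2) auto
  finally have "real (card (X \<inter> {x. t \<le> \<bar>f x - c\<bar>})) / real (card X)
      \<le> (\<Sum>x\<in>X. (f x - c)\<^sup>2) / t\<^sup>2 / real (card X)"
    using assms(3) by (intro divide_right_mono) (simp_all add: pos_le_divide_eq)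
  then show ?thesis using assms by (simp add: measure_pmf_of_set average_def mult.commute)
qed

section \<open>Almost superadditive sequences\<close>

lemma convergent_if_eventually_almost_increasing:
  fixes h :: "nat \<Rightarrow> real"
  assumes bounded: "bounded (range h)"
    and increasing: "\<And>\<epsilon>. 0 < \<epsilon> \<Longrightarrow> \<forall>\<^sub>F n in sequentially. \<forall>\<^sub>F m in sequentially. h n - \<epsilon> \<le> h m"
  shows "convergent h"
proof -
  obtain l \<phi> where \<phi>: "strict_mono (\<phi> :: nat \<Rightarrow> nat)" "(h \<circ> \<phi>) \<longlonglongrightarrow> l"
    using bounded_imp_convergent_subsequence[OF bounded] by blast
  have "\<forall>\<^sub>F n in sequentially. dist (h n) l < \<epsilon>" if "0 < \<epsilon>" for \<epsilon>
  proof -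
    define d where "d = \<epsilon> / 3"
    have d_pos: "0 < d" using that by (simp add: d_def)
    have near: "\<forall>\<^sub>F j in sequentially. dist (h (\<phi> j)) l < d"
      using tendstoD[OF \<phi>(2) d_pos] by simp
    have "\<exists>j. dist (h (\<phi> j)) l < d \<and> (\<forall>\<^sub>F m in sequentially. h (\<phi> j) - d \<le> h m)"
      using eventually_happens[OF eventually_conj[OF near
            eventually_subseq[OF \<phi>(1) increasing[OF d_pos]]]]
      by simp
    then have lower: "\<forall>\<^sub>F m in sequentially. l - 2 * d < h m"
      by (elim exE conjE eventually_mono) (auto simp: dist_real_def)
    have upper: "\<forall>\<^sub>F n in sequentially. h n < l + 2 * d"
      using increasing[OF d_pos]
    proof eventually_elim
      case (elim n)
      then show ?case
        using eventually_happens[OF eventually_conj[OF near eventually_subseq[OF \<phi>(1) elim]]]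
        by (auto simp: dist_real_def)
    qed
    show ?thesis
      using lower upper
      by eventually_elim (use d_pos in \<open>auto simp: d_def dist_real_def abs_less_iff\<close>)
  qed
  then show ?thesis by (intro convergentI[of h l] tendstoI)
qed

lemma powr_add_ge_of_balanced:
  fixes x y \<gamma> :: real
  assumes "0 < x" "0 < y" "x \<le> 2 * y" "y \<le> 2 * x" "\<gamma> \<le> 1"
  shows "(3 / 2) powr (1 - \<gamma>) * (x + y) powr \<gamma> \<le> x powr \<gamma> + y powr \<gamma>"
proof -
  define s where "s = 2 / 3 * (x + y)"
  have part: "z * s powr (\<gamma> - 1) \<le> z powr \<gamma>" if "0 < z" "z \<le> s" for z
  proof -
    have "z * s powr (\<gamma> - 1) \<le> z * z powr (\<gamma> - 1)"
      using that assms(5) by (intro mult_left_mono powr_mono2') auto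
    then show ?thesis using that(1) by (simp add: powr_mult_base)
  qed
  have "(3 / 2) powr (1 - \<gamma>) * (x + y) powr \<gamma> = (x + y) * ((x + y) powr (\<gamma> - 1) / (3 / 2) powr (\<gamma> - 1))"
    using assms(1,2) powr_minus[of "3 / 2" "\<gamma> - 1"] powr_mult_base[of "x + y" "\<gamma> - 1"]
    by (simp add: field_simps)
  also have "\<dots> = x * s powr (\<gamma> - 1) + y * s powr (\<gamma> - 1)"
    using assms(1,2) by (simp add: s_def powr_divide[symmetric] algebra_simps)
  also have "\<dots> \<le> x powr \<gamma> + y powr \<gamma>"
    using assms by (intro add_mono part) (auto simp: s_def)
  finally show ?thesis .
qed

text \<open>The induction splits k into halves; the term with \<open>k powr \<gamma>\<close> absorbs the errors of all splittings.\<close>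

lemma almost_superadditive_multiple_ge:
  fixes g :: "nat \<Rightarrow> real" and C \<gamma> :: real
  assumes C_nonneg: "0 \<le> C" and \<gamma>_less_1: "\<gamma> < 1"
    and super: "\<And>m n. n_min \<le> m \<Longrightarrow> m \<le> n \<Longrightarrow> n \<le> 2 * m \<Longrightarrow> g m + g n \<le> g (m + n) + C * real (m + n) powr \<gamma>"
    and n_min_le_n: "n_min \<le> n" and k_ge_1: "1 \<le> k"
  defines "D \<equiv> C / ((3 / 2) powr (1 - \<gamma>) - 1)"
  shows "real k * g n \<le> g (k * n) + D * real n powr \<gamma> * (real k - real k powr \<gamma>)"
  using k_ge_1
proof (induction k rule: less_induct)
  case (less k)
  define \<theta> :: real where "\<theta> = (3 / 2) powr (1 - \<gamma>)"
  have "1 < \<theta>" using \<gamma>_less_1 by (simp add: \<theta>_def)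
  then have D_identities: "0 \<le> D" "D * \<theta> = D + C"
    using C_nonneg by (simp_all add: D_def field_simps flip: \<theta>_def)
  show ?case
  proof (cases "k = 1")
    case False
    define i j where "i = k div 2" and "j = k - i"
    have halves: "1 \<le> i" "1 \<le> j" "i < k" "j < k" "i \<le> j" "j \<le> 2 * i" "k = i + j"
      using False less.prems by (auto simp: i_def j_def)
    let ?e = "D * real n powr \<gamma>"
    have "real k * g n = real i * g n + real j * g n" using halves by (simp add: algebra_simps)
    also have "\<dots> \<le> g (i * n) + ?e * (real i - real i powr \<gamma>)
        + (g (j * n) + ?e * (real j - real j powr \<gamma>))"
      using halves by (intro add_mono less.IH)
    also have "\<dots> = g (i * n) + g (j * n) + ?e * real k - ?e * (real i powr \<gamma> + real j powr \<gamma>)"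
      by (simp add: halves(7) algebra_simps)
    also have "\<dots> \<le> g (i * n) + g (j * n) + ?e * real k - ?e * (\<theta> * real k powr \<gamma>)"
      using halves \<gamma>_less_1 D_identities(1) powr_add_ge_of_balanced[of "real i" "real j" \<gamma>]
      by (intro diff_mono mult_left_mono) (auto simp: \<theta>_def)
    also have "\<dots> = g (i * n) + g (j * n) - C * real (k * n) powr \<gamma> + ?e * (real k - real k powr \<gamma>)"
    proof -
      have "?e * (\<theta> * real k powr \<gamma>) = (D * \<theta>) * (real n powr \<gamma> * real k powr \<gamma>)" by (simp only: mult_ac)
      then show ?thesis unfolding D_identities(2) by (simp add: powr_mult algebra_simps)
    qed
    also have "\<dots> \<le> g (k * n) + ?e * (real k - real k powr \<gamma>)"
    proof -
      have "n_min \<le> i * n" using n_min_le_n halves(1) by (metis le_trans mult_le_mono1 nat_mult_1)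
      then have "g (i * n) + g (j * n) \<le> g (i * n + j * n) + C * real (i * n + j * n) powr \<gamma>"
        using halves by (intro super) auto
      then show ?thesis by (simp add: halves(7) distrib_right)
    qed
    finally show ?thesis .
  qed simp
qed

lemma almost_superadditive_ratio_ge:
  fixes g :: "nat \<Rightarrow> real" and c C \<gamma> :: real
  assumes C_nonneg: "0 \<le> C" and \<gamma>_less_1: "\<gamma> < 1"
    and lipschitz: "\<And>m n. m \<le> n \<Longrightarrow> \<bar>g n - g m\<bar> \<le> c * real (n - m)" and zero: "g 0 = 0"
    and super: "\<And>m n. n_min \<le> m \<Longrightarrow> m \<le> n \<Longrightarrow> n \<le> 2 * m \<Longrightarrow> g m + g n \<le> g (m + n) + C * real (m + n) powr \<gamma>"
    and n_bounds: "1 \<le> n" "n_min \<le> n" and n_le_m: "n \<le> m"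
  defines "D \<equiv> C / ((3 / 2) powr (1 - \<gamma>) - 1)"
  shows "g n / real n - D * real n powr (\<gamma> - 1) - 2 * c * real n / real m \<le> g m / real m"
proof -
  define h k s where "h = g n / real n" and "k = m div n" and "s = m mod n"
  have division: "1 \<le> k" "m = k * n + s" "s \<le> n"
    using n_bounds n_le_m by (auto simp: k_def s_def Suc_le_eq div_greater_zero_iff less_imp_le)
  have c_nonneg: "0 \<le> c" using lipschitz[of 0 1] by simp
  have "1 < (3 / 2 :: real) powr (1 - \<gamma>)" using \<gamma>_less_1 by simp
  then have D_nonneg: "0 \<le> D" using C_nonneg by (simp add: D_def)
  have g_n: "g n = h * real n" using n_bounds by (simp add: h_def)
  have "\<bar>h\<bar> \<le> c" using lipschitz[of 0 n] zero n_bounds by (simp add: h_def divide_le_eq)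
  then have "h * real s \<le> c * real n" using division(3) c_nonneg by (intro mult_mono) auto
  moreover have "g (k * n) - g m \<le> c * real n"
    using lipschitz[of "k * n" m] division mult_left_mono[of "real s" "real n" c] c_nonneg by simp
  moreover have "real k * g n \<le> g (k * n) + D * real n powr (\<gamma> - 1) * real m"
  proof -
    have "real k * g n \<le> g (k * n) + D * real n powr \<gamma> * (real k - real k powr \<gamma>)"
      unfolding D_def
      by (rule almost_superadditive_multiple_ge[OF C_nonneg \<gamma>_less_1 super n_bounds(2) division(1)])
    also have "\<dots> \<le> g (k * n) + D * real n powr \<gamma> * real k"
      using D_nonneg by (intro add_left_mono mult_left_mono) auto
    also have "\<dots> = g (k * n) + D * real n powr (\<gamma> - 1) * real (k * n)"
      using powr_mult_base[of "real n" "\<gamma> - 1"] by (simp add: mult_ac)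
    also have "\<dots> \<le> g (k * n) + D * real n powr (\<gamma> - 1) * real m"
      using D_nonneg division(2) by (intro add_left_mono mult_left_mono) auto
    finally show ?thesis .
  qed
  ultimately have "(h - D * real n powr (\<gamma> - 1)) * real m - 2 * c * real n \<le> g m"
    by (simp add: division(2) g_n algebra_simps)
  then have "((h - D * real n powr (\<gamma> - 1)) * real m - 2 * c * real n) / real m \<le> g m / real m"
    by (intro divide_right_mono) auto
  then show ?thesis using n_bounds n_le_m by (simp add: h_def diff_divide_distrib)
qed

lemma almost_superadditive_convergent:
  fixes g :: "nat \<Rightarrow> real" and c C \<gamma> :: real
  assumes C_nonneg: "0 \<le> C" and \<gamma>_less_1: "\<gamma> < 1"
    and lipschitz: "\<And>m n. m \<le> n \<Longrightarrow> \<bar>g n - g m\<bar> \<le> c * real (n - m)" and zero: "g 0 = 0"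
    and super: "\<And>m n. n_min \<le> m \<Longrightarrow> m \<le> n \<Longrightarrow> n \<le> 2 * m \<Longrightarrow> g m + g n \<le> g (m + n) + C * real (m + n) powr \<gamma>"
  shows "convergent (\<lambda>n. g n / real n)"
proof (rule convergent_if_eventually_almost_increasing)
  have "0 \<le> c" using lipschitz[of 0 1] by simp
  then have "\<bar>g n / real n\<bar> \<le> c" for n
    using lipschitz[of 0 n] zero by (cases "n = 0") (auto simp: divide_le_eq)
  then show "bounded (range (\<lambda>n. g n / real n))" by (auto simp: bounded_iff)
  define D where "D = C / ((3 / 2) powr (1 - \<gamma>) - 1)"
  fix \<epsilon> :: real assume \<epsilon>_pos: "0 < \<epsilon>"
  have "((\<lambda>n. D * real n powr (\<gamma> - 1)) \<longlongrightarrow> 0) sequentially"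
    using \<gamma>_less_1 by (intro tendsto_mult_right_zero tendsto_neg_powr filterlim_real_sequentially) auto
  then have "\<forall>\<^sub>F n in sequentially. D * real n powr (\<gamma> - 1) < \<epsilon> / 2"
    using \<epsilon>_pos by (intro order_tendstoD) auto
  then show "\<forall>\<^sub>F n in sequentially. \<forall>\<^sub>F m in sequentially. g n / real n - \<epsilon> \<le> g m / real m"
    using eventually_ge_at_top[of "max 1 n_min"]
  proof eventually_elim
    case small: (elim n)
    have "((\<lambda>m. 2 * c * real n / real m) \<longlongrightarrow> 0) sequentially" by real_asymp
    then have "\<forall>\<^sub>F m in sequentially. 2 * c * real n / real m < \<epsilon> / 2"
      using \<epsilon>_pos by (intro order_tendstoD) auto
    then show ?case
      using eventually_ge_at_top[of n]
    proof eventually_elim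
      case (elim m)
      then show ?case
        using almost_superadditive_ratio_ge[OF C_nonneg \<gamma>_less_1 lipschitz zero super,
            where n = n and m = m] small
        unfolding D_def[symmetric] by force
    qed
  qed
qed

section \<open>Subsets of fixed size\<close>

lemma card_nsets: "finite F \<Longrightarrow> card ([F]\<^bsup>k\<^esup>) = card F choose k"
proof -
  assume "finite F"
  then have "[F]\<^bsup>k\<^esup> = {e. e \<subseteq> F \<and> card e = k}" by (auto simp: nsets_def finite_subset)
  then show ?thesis using n_subsets[OF \<open>finite F\<close>, of k] by simp
qed

lemma sum_nsets_nested:
  fixes g :: "'a set \<Rightarrow> 'a set \<Rightarrow> 'b::comm_monoid_add"
  assumes finite_F: "finite F"
  shows "(\<Sum>e\<in>[F]\<^bsup>j\<^esup>. \<Sum>U\<in>[F - e]\<^bsup>k\<^esup>. g e U) = (\<Sum>U\<in>[F]\<^bsup>(j + k)\<^esup>. \<Sum>e\<in>[U]\<^bsup>j\<^esup>. g e (U - e))"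
proof -
  have finite_U: "finite U" if "U \<in> [F]\<^bsup>k\<^esup>" for U k using that by (simp add: nsets_def)
  have "(\<Sum>e\<in>[F]\<^bsup>j\<^esup>. \<Sum>U\<in>[F - e]\<^bsup>k\<^esup>. g e U) = (\<Sum>(e, U)\<in>(SIGMA e:[F]\<^bsup>j\<^esup>. [F - e]\<^bsup>k\<^esup>). g e U)"
    using finite_F by (intro sum.Sigma) (auto intro: finite_imp_finite_nsets)
  also have "\<dots> = (\<Sum>(U, e)\<in>(SIGMA U:[F]\<^bsup>(j + k)\<^esup>. [U]\<^bsup>j\<^esup>). g e (U - e))"
  proof (rule sum.reindex_bij_witness[where i = "\<lambda>(U, e). (e, U - e)" and j = "\<lambda>(e, U). (e \<union> U, e)"])
    fix x assume "x \<in> (SIGMA e:[F]\<^bsup>j\<^esup>. [F - e]\<^bsup>k\<^esup>)"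
    then obtain e U where x_eq: "x = (e, U)" "e \<subseteq> F" "finite e" "card e = j" "U \<subseteq> F - e" "finite U"
        "card U = k"
      by (auto simp: nsets_def)
    then have "card (e \<union> U) = j + k" "e \<union> U - e = U" using card_Un_disjoint[of e U] by auto
    then show "(case case x of (e, U) \<Rightarrow> (e \<union> U, e) of (U, e) \<Rightarrow> (e, U - e)) = x"
      "(case x of (e, U) \<Rightarrow> (e \<union> U, e)) \<in> (SIGMA U:[F]\<^bsup>(j + k)\<^esup>. [U]\<^bsup>j\<^esup>)"
      "(case case x of (e, U) \<Rightarrow> (e \<union> U, e) of (U, e) \<Rightarrow> g e (U - e)) = (case x of (e, U) \<Rightarrow> g e U)"
      using x_eq by (auto simp: nsets_def)
  next
    fix y assume "y \<in> (SIGMA U:[F]\<^bsup>(j + k)\<^esup>. [U]\<^bsup>j\<^esup>)"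
    then show "(case case y of (U, e) \<Rightarrow> (e, U - e) of (e, U) \<Rightarrow> (e \<union> U, e)) = y"
      "(case y of (U, e) \<Rightarrow> (e, U - e)) \<in> (SIGMA e:[F]\<^bsup>j\<^esup>. [F - e]\<^bsup>k\<^esup>)"
      by (auto simp: nsets_def card_Diff_subset)
  qed
  also have "\<dots> = (\<Sum>U\<in>[F]\<^bsup>(j + k)\<^esup>. \<Sum>e\<in>[U]\<^bsup>j\<^esup>. g e (U - e))"
    using finite_F finite_U by (intro sum.Sigma[symmetric]) (auto intro: finite_imp_finite_nsets)
  finally show ?thesis .
qed

lemma average_nsets_complement:
  assumes "finite W" "card W = j + k"
  shows "average ([W]\<^bsup>j\<^esup>) (\<lambda>e. h e (W - e)) = average ([W]\<^bsup>k\<^esup>) (\<lambda>e. h (W - e) e)"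
proof -
  have "bij_betw ((-) W) ([W]\<^bsup>k\<^esup>) ([W]\<^bsup>j\<^esup>)"
    using assms
    by (intro bij_betw_byWitness[where f' = "(-) W"]) (auto simp: nsets_def card_Diff_subset double_diff)
  then have "average ([W]\<^bsup>j\<^esup>) (\<lambda>e. h e (W - e)) = average ([W]\<^bsup>k\<^esup>) (\<lambda>e. h (W - e) (W - (W - e)))"
    by (rule average_reindex_bij_betw)
  also have "\<dots> = average ([W]\<^bsup>k\<^esup>) (\<lambda>e. h (W - e) e)"
    by (intro average_cong) (auto simp: nsets_def double_diff)
  finally show ?thesis .
qed

text \<open>The probability that a random k-subset of an n-set lies in a given c-subset.\<close>

definition choose_ratio :: "nat \<Rightarrow> nat \<Rightarrow> nat \<Rightarrow> real" where
  "choose_ratio c n k = real (c choose k) / real (n choose k)"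

lemma choose_ratio_Suc: "choose_ratio c n (Suc k) = choose_ratio c n k * (real (c - k) / real (n - k))"
proof -
  have absorb: "real (Suc k) * real (m choose Suc k) = real (m - k) * real (m choose k)" for m
    unfolding of_nat_mult[symmetric] by (simp only: binomial_absorption binomial_absorb_comp)
  have "choose_ratio c n (Suc k)
      = (real (Suc k) * real (c choose Suc k)) / (real (Suc k) * real (n choose Suc k))"
    unfolding choose_ratio_def by (rule mult_divide_mult_cancel_left[symmetric]) simp
  then show ?thesis unfolding absorb by (simp add: choose_ratio_def mult.commute)
qed

lemma diff_divide_le_divide_diff:
  assumes "c \<le> n" "k < n"
  shows "real c / real n - real k / real n \<le> real (c - k) / real (n - k)"
    and "real (c - k) / real (n - k) \<le> real c / real n"
proof -
  show "real c / real n - real k / real n \<le> real (c - k) / real (n - k)"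
  proof (cases "k \<le> c")
    case True
    have "(real c - real k) / real n \<le> (real c - real k) / (real n - real k)"
      using True assms by (intro divide_left_mono) auto
    then show ?thesis using True assms by (simp add: of_nat_diff diff_divide_distrib)
  next
    case False
    then show ?thesis by (simp add: diff_divide_distrib[symmetric] divide_nonpos_nonneg)
  qed
  have "real k * real c \<le> real k * real n" using assms by (intro mult_left_mono) auto
  then show "real (c - k) / real (n - k) \<le> real c / real n"
    using assms by (cases "k \<le> c") (auto simp: field_simps of_nat_diff)
qed

lemma choose_ratio_le_power:
  assumes "c \<le> n" "k \<le> n"
  shows "choose_ratio c n k \<le> (real c / real n) ^ k"
  using assms(2)
proof (induction k)
  case (Suc k)
  then show ?case
    using diff_divide_le_divide_diff(2)[OF assms(1), of k]
    unfolding choose_ratio_Suc power_Suc2 by (intro mult_mono) auto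
qed (simp add: choose_ratio_def)

lemma choose_ratio_ge_power:
  assumes c_le_n: "c \<le> n" and k_bounds: "1 \<le> k" "k \<le> n"
  shows "(real c / real n) ^ k - (real k)\<^sup>2 * (real c / real n) / real n \<le> choose_ratio c n k"
  using k_bounds
proof (induction k rule: nat_induct_at_least)
  case base
  then show ?case by (simp add: choose_ratio_def)
next
  case (Suc k)
  define x where "x = real c / real n"
  have x_bounds: "0 \<le> x" "x \<le> 1" using c_le_n Suc.prems by (auto simp: x_def)
  have le_x: "choose_ratio c n k \<le> x"
    using choose_ratio_le_power[OF c_le_n, of k] power_decreasing[of 1 k x] x_bounds Suc
    by (simp flip: x_def)
  have "(real k)\<^sup>2 * x * x \<le> (real k)\<^sup>2 * x"
    using x_bounds mult_left_mono[of x 1 "(real k)\<^sup>2 * x"] by simp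
  moreover have "(real (Suc k))\<^sup>2 * x = (real k)\<^sup>2 * x + 2 * (x * real k) + x"
    by (simp add: power2_eq_square algebra_simps)
  moreover have "0 \<le> x * real k" using x_bounds by simp
  ultimately have "(real k)\<^sup>2 * x * x + x * real k \<le> (real (Suc k))\<^sup>2 * x" using x_bounds(1) by linarith
  then have "x ^ Suc k - (real (Suc k))\<^sup>2 * x / real n
      \<le> (x ^ k - (real k)\<^sup>2 * x / real n) * x - x * (real k / real n)"
    using divide_right_mono[of "(real k)\<^sup>2 * x * x + x * real k" "(real (Suc k))\<^sup>2 * x" "real n"]
    by (simp add: algebra_simps add_divide_distrib)
  also have "\<dots> \<le> choose_ratio c n k * x - choose_ratio c n k * (real k / real n)"
    using Suc le_x x_bounds by (intro diff_mono mult_right_mono) (auto simp: x_def)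
  also have "\<dots> = choose_ratio c n k * (x - real k / real n)" by (simp add: algebra_simps)
  also have "\<dots> \<le> choose_ratio c n (Suc k)"
    unfolding choose_ratio_Suc x_def using diff_divide_le_divide_diff(1)[OF c_le_n, of k] Suc.prems
    by (intro mult_left_mono) (auto simp: choose_ratio_def)
  finally show ?case by (simp only: x_def)
qed

section \<open>Partial equivalence relations\<close>

definition mutually_related :: "('a \<Rightarrow> 'a \<Rightarrow> bool) \<Rightarrow> 'a set \<Rightarrow> bool" where
  "mutually_related R e \<longleftrightarrow> (\<forall>x\<in>e. \<forall>y\<in>e. R x y)"

definition relation_classes :: "('a \<Rightarrow> 'a \<Rightarrow> bool) \<Rightarrow> 'a set \<Rightarrow> 'a set set" where
  "relation_classes R F = {x \<in> F. R x x} // {(x, y). x \<in> F \<and> y \<in> F \<and> R x y}"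

lemma finite_relation_classes: "finite F \<Longrightarrow> finite (relation_classes R F)"
  unfolding relation_classes_def quotient_def by simp

lemma relation_classes_subset: "C \<in> relation_classes R F \<Longrightarrow> C \<subseteq> F"
  by (auto simp: relation_classes_def quotient_def)

lemma relation_classes_disjoint:
  assumes "symp R" "transp R" "C \<in> relation_classes R F" "C' \<in> relation_classes R F" "C \<noteq> C'"
  shows "C \<inter> C' = {}"
proof -
  have "equiv {x \<in> F. R x x} {(x, y). x \<in> F \<and> y \<in> F \<and> R x y}"
    using assms(1,2) by (intro equivI refl_onI symI transI) (auto dest: sympD transpD)
  then show ?thesis using quotient_disj assms(3-5) unfolding relation_classes_def by blast
qed

lemma nsets_mutually_related_eq_UN:
  assumes R_sym_trans: "symp R" "transp R" and k_pos: "0 < k"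
  shows "{e \<in> [F]\<^bsup>k\<^esup>. mutually_related R e} = (\<Union>C\<in>relation_classes R F. [C]\<^bsup>k\<^esup>)"
proof (intro set_eqI iffI)
  fix e assume "e \<in> {e \<in> [F]\<^bsup>k\<^esup>. mutually_related R e}"
  then have e: "e \<subseteq> F" "finite e" "card e = k" "mutually_related R e" by (auto simp: nsets_def)
  then obtain x where "x \<in> e" using k_pos by fastforce
  then have "{y. x \<in> F \<and> y \<in> F \<and> R x y} \<in> relation_classes R F" "e \<subseteq> {y. x \<in> F \<and> y \<in> F \<and> R x y}"
    using e by (auto simp: mutually_related_def relation_classes_def quotient_def)
  then show "e \<in> (\<Union>C\<in>relation_classes R F. [C]\<^bsup>k\<^esup>)" using e(2,3) by (auto simp: nsets_def)
next
  fix e assume "e \<in> (\<Union>C\<in>relation_classes R F. [C]\<^bsup>k\<^esup>)"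
  then obtain x where e: "x \<in> F" "e \<subseteq> F" "finite e" "card e = k" "\<forall>y\<in>e. R x y"
    by (auto simp: relation_classes_def quotient_def nsets_def)
  then have "mutually_related R e"
    using R_sym_trans unfolding mutually_related_def by (blast dest: sympD transpD)
  then show "e \<in> {e \<in> [F]\<^bsup>k\<^esup>. mutually_related R e}" using e by (simp add: nsets_def)
qed

lemma sum_mutually_related:
  fixes f :: "'a set \<Rightarrow> 'b::comm_monoid_add"
  assumes finite_F: "finite F" and R_sym_trans: "symp R" "transp R" and k_pos: "0 < k"
  shows "(\<Sum>e\<in>{e \<in> [F]\<^bsup>k\<^esup>. mutually_related R e}. f e) = (\<Sum>C\<in>relation_classes R F. \<Sum>e\<in>[C]\<^bsup>k\<^esup>. f e)"
  unfolding nsets_mutually_related_eq_UN[OF R_sym_trans k_pos]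
proof (rule sum.UNION_disjoint)
  show "finite (relation_classes R F)" using finite_F by (rule finite_relation_classes)
  show "\<forall>C\<in>relation_classes R F. finite ([C]\<^bsup>k\<^esup>)"
    using finite_F relation_classes_subset finite_subset finite_imp_finite_nsets by metis
  show "\<forall>C\<in>relation_classes R F. \<forall>C'\<in>relation_classes R F. C \<noteq> C' \<longrightarrow> [C]\<^bsup>k\<^esup> \<inter> [C']\<^bsup>k\<^esup> = {}"
  proof (intro ballI impI equals0I)
    fix C C' e assume "C \<in> relation_classes R F" "C' \<in> relation_classes R F" "C \<noteq> C'"
        "e \<in> [C]\<^bsup>k\<^esup> \<inter> [C']\<^bsup>k\<^esup>"
    then have "e \<subseteq> {}" "card e = k"
      using relation_classes_disjoint[OF R_sym_trans, of C F C'] by (auto simp: nsets_def)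
    then show False using k_pos by simp
  qed
qed

lemma sum_card_relation_classes_le:
  assumes finite_F: "finite F" and R_sym_trans: "symp R" "transp R"
  shows "(\<Sum>C\<in>relation_classes R F. card (C \<inter> S)) \<le> card (F \<inter> S)"
proof -
  have "(\<Sum>C\<in>relation_classes R F. card (C \<inter> S)) = card (\<Union>C\<in>relation_classes R F. C \<inter> S)"
  proof (rule card_UN_disjoint[symmetric])
    show "\<forall>C\<in>relation_classes R F. finite (C \<inter> S)"
      using finite_F relation_classes_subset[of _ R F] by (meson finite_Int finite_subset)
    show "\<forall>C\<in>relation_classes R F. \<forall>C'\<in>relation_classes R F. C \<noteq> C' \<longrightarrow> (C \<inter> S) \<inter> (C' \<inter> S) = {}"
      using relation_classes_disjoint[OF R_sym_trans] by blast
  qed (rule finite_relation_classes[OF finite_F])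
  also have "\<dots> \<le> card (F \<inter> S)" using finite_F relation_classes_subset by (intro card_mono) fastforce+
  finally show ?thesis .
qed

section \<open>Marked partitions\<close>

text \<open>The mark of a block plays the role of the sign vector of a clause. Thus a hypergraph together with
  its signs is a set of pairs.\<close>

locale marked_blocks =
  fixes K :: nat and A :: "'m set"
  assumes K_pos: "1 \<le> K" and finite_A: "finite A" and A_nonempty: "A \<noteq> {}"
begin

definition blocks :: "'p set \<Rightarrow> ('p set \<times> 'm) set" where
  "blocks F = [F]\<^bsup>K\<^esup> \<times> A"

definition marked_partitions :: "'p set \<Rightarrow> ('p set \<times> 'm) set set" where
  "marked_partitions F = {Q. Q \<subseteq> blocks F \<and> (\<forall>p\<in>F. \<exists>!b. b \<in> Q \<and> p \<in> fst b)}"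

definition partition_mean :: "'p set \<Rightarrow> (('p set \<times> 'm) set \<Rightarrow> real) \<Rightarrow> real" where
  "partition_mean F \<phi> = average (marked_partitions F) \<phi>"

lemma finite_blocks [simp]: "finite F \<Longrightarrow> finite (blocks F)"
  by (simp add: blocks_def finite_A finite_imp_finite_nsets)

lemma blocks_mono: "F \<subseteq> G \<Longrightarrow> blocks F \<subseteq> blocks G"
  using nsets_mono by (fastforce simp: blocks_def)

lemma blocksD:
  assumes "b \<in> blocks F"
  shows "fst b \<subseteq> F" "finite (fst b)" "card (fst b) = K" "fst b \<noteq> {}" "snd b \<in> A"
  using assms K_pos by (auto simp: blocks_def nsets_def)

lemma blocks_disjoint:
  assumes "F \<inter> G = {}"
  shows "blocks F \<inter> blocks G = {}"
proof (rule equals0I)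
  fix b assume "b \<in> blocks F \<inter> blocks G"
  then have "fst b \<subseteq> F \<inter> G" "fst b \<noteq> {}" using blocksD(1,4) by blast+
  then show False using assms by simp
qed

lemma blocks_nonempty: "finite F \<Longrightarrow> K \<le> card F \<Longrightarrow> blocks F \<noteq> {}"
  using A_nonempty by (simp add: blocks_def nsets_eq_empty_iff)

lemma card_Diff_block: "b \<in> blocks F \<Longrightarrow> card F = K * Suc n \<Longrightarrow> card (F - fst b) = K * n"
  using blocksD[of b F] by (simp add: card_Diff_subset)

lemma finite_marked_partitions [simp]: "finite F \<Longrightarrow> finite (marked_partitions F)"
  by (rule finite_subset[of _ "Pow (blocks F)"]) (auto simp: marked_partitions_def)

lemma marked_partitions_subset: "Q \<in> marked_partitions F \<Longrightarrow> Q \<subseteq> blocks F"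
  by (simp add: marked_partitions_def)

lemma marked_partitions_finite: "Q \<in> marked_partitions F \<Longrightarrow> finite F \<Longrightarrow> finite Q"
  by (rule finite_subset[OF marked_partitions_subset finite_blocks])

lemma marked_partitions_ex1: "Q \<in> marked_partitions F \<Longrightarrow> p \<in> F \<Longrightarrow> \<exists>!b. b \<in> Q \<and> p \<in> fst b"
  by (simp add: marked_partitions_def)

lemma Union_marked_partition:
  assumes "Q \<in> marked_partitions F"
  shows "\<Union>(fst ` Q) = F"
proof
  show "\<Union>(fst ` Q) \<subseteq> F"
    using blocksD(1)[OF subsetD[OF marked_partitions_subset[OF assms]]] by (rule UN_least)
  show "F \<subseteq> \<Union>(fst ` Q)" using marked_partitions_ex1[OF assms] by (intro subsetI UN_iff[THEN iffD2]) blast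
qed

lemma marked_partitions_disjoint:
  assumes Q_partition: "Q \<in> marked_partitions F" and distinct_blocks: "b \<in> Q" "b' \<in> Q" "b \<noteq> b'"
  shows "fst b \<inter> fst b' = {}"
proof (rule equals0I)
  fix p assume p_common: "p \<in> fst b \<inter> fst b'"
  then have "p \<in> F" using Union_marked_partition[OF Q_partition] distinct_blocks(1) by blast
  then show False using marked_partitions_ex1[OF Q_partition, of p] p_common distinct_blocks by auto
qed

lemma card_marked_partition:
  assumes "Q \<in> marked_partitions F" "finite F"
  shows "card F = K * card Q"
proof -
  have b: "finite (fst b)" "card (fst b) = K" if "b \<in> Q" for b
    using blocksD[OF subsetD[OF marked_partitions_subset[OF assms(1)] that]] by simp_all
  have "card (\<Union>(fst ` Q)) = (\<Sum>b\<in>Q. card (fst b))"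
    using marked_partitions_finite[OF assms] marked_partitions_disjoint[OF assms(1)] b
    by (intro card_UN_disjoint) auto
  then show ?thesis using b Union_marked_partition[OF assms(1)] by simp
qed

lemma marked_partitions_empty: "marked_partitions {} = {{}}"
  using K_pos by (auto simp: marked_partitions_def blocks_def nsets_empty_iff)

lemma partition_mean_empty [simp]: "partition_mean {} \<phi> = \<phi> {}"
  by (simp add: partition_mean_def marked_partitions_empty average_def)

lemma marked_partitions_insert:
  assumes b_block: "b \<in> blocks F" and Q_partition: "Q \<in> marked_partitions (F - fst b)"
  shows "insert b Q \<in> marked_partitions F" "b \<notin> Q"
proof -
  have avoids: "fst b' \<subseteq> F - fst b" if "b' \<in> Q" for b'
    using that marked_partitions_subset[OF Q_partition] blocksD(1) by blast
  show "b \<notin> Q" using avoids blocksD(4)[OF b_block] by blast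
  have "\<exists>!b'. b' \<in> insert b Q \<and> p \<in> fst b'" if "p \<in> F" for p
  proof (cases "p \<in> fst b")
    case True
    then show ?thesis using avoids by blast
  next
    case False
    then show ?thesis using marked_partitions_ex1[OF Q_partition, of p] that by auto
  qed
  then show "insert b Q \<in> marked_partitions F"
    using b_block marked_partitions_subset[OF Q_partition] blocks_mono[of "F - fst b" F]
    by (auto simp: marked_partitions_def)
qed

lemma marked_partitions_remove:
  assumes P_partition: "P \<in> marked_partitions F" and b_in_P: "b \<in> P"
  shows "P - {b} \<in> marked_partitions (F - fst b)" "b \<in> blocks F"
proof -
  show "b \<in> blocks F" using assms marked_partitions_subset by blast
  have "b' \<in> blocks (F - fst b)" if "b' \<in> P - {b}" for b'
    using that marked_partitions_disjoint[OF P_partition b_in_P, of b']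
      subsetD[OF marked_partitions_subset[OF P_partition], of b']
    by (auto simp: blocks_def nsets_def mem_Times_iff)
  moreover have "\<exists>!b'. b' \<in> P - {b} \<and> p \<in> fst b'" if "p \<in> F - fst b" for p
    using marked_partitions_ex1[OF P_partition, of p] that by blast
  ultimately show "P - {b} \<in> marked_partitions (F - fst b)" by (auto simp: marked_partitions_def)
qed

lemma marked_partitions_nonempty:
  "finite F \<Longrightarrow> card F = K * n \<Longrightarrow> marked_partitions F \<noteq> {}"
proof (induction n arbitrary: F)
  case 0
  then show ?case by (simp add: marked_partitions_empty)
next
  case (Suc n)
  then obtain b where b_block: "b \<in> blocks F" using blocks_nonempty[of F] by auto
  then have "marked_partitions (F - fst b) \<noteq> {}" using Suc by (intro Suc.IH card_Diff_block) auto
  then show ?case using marked_partitions_insert(1)[OF b_block] by blast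
qed

lemma partition_mean_const: "finite F \<Longrightarrow> card F = K * n \<Longrightarrow> partition_mean F (\<lambda>_. c) = c"
  unfolding partition_mean_def
  by (rule average_const[OF finite_marked_partitions marked_partitions_nonempty])

end

subsection \<open>Relabelling points\<close>

definition relabel :: "('p \<Rightarrow> 'r) \<Rightarrow> ('p set \<times> 'm) set \<Rightarrow> ('r set \<times> 'm) set" where
  "relabel \<pi> Q = map_prod (image \<pi>) id ` Q"

lemma relabel_relabel_cancel:
  assumes "\<And>b p. b \<in> Q \<Longrightarrow> p \<in> fst b \<Longrightarrow> \<sigma> (\<pi> p) = p"
  shows "relabel \<sigma> (relabel \<pi> Q) = Q"
proof -
  have "map_prod (image \<sigma>) id (map_prod (image \<pi>) id b) = b" if "b \<in> Q" for b
    using assms[OF that] by (cases b) (force simp: image_image)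
  then have "relabel \<sigma> (relabel \<pi> Q) = (\<lambda>b. b) ` Q"
    unfolding relabel_def image_image by (intro image_cong refl)
  then show ?thesis by simp
qed

context marked_blocks
begin

lemma relabel_in_marked_partitions:
  assumes inj: "inj_on \<pi> F" and Q_partition: "Q \<in> marked_partitions F"
  shows "relabel \<pi> Q \<in> marked_partitions (\<pi> ` F)"
proof -
  have block_subset: "fst b \<subseteq> F" if "b \<in> Q" for b
    using that marked_partitions_subset[OF Q_partition] blocksD(1) by blast
  have "relabel \<pi> Q \<subseteq> blocks (\<pi> ` F)"
    using marked_partitions_subset[OF Q_partition] inj
    by (fastforce simp: relabel_def blocks_def nsets_def card_image inj_on_subset)
  moreover have "\<exists>!b. b \<in> relabel \<pi> Q \<and> \<pi> p \<in> fst b" if p_in_F: "p \<in> F" for p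
  proof -
    have image_mem: "\<pi> p \<in> \<pi> ` fst b \<longleftrightarrow> p \<in> fst b" if "b \<in> Q" for b
      using block_subset[OF that] p_in_F inj by (simp add: inj_on_image_mem_iff)
    obtain b where b: "b \<in> Q" "p \<in> fst b" "\<And>b'. b' \<in> Q \<Longrightarrow> p \<in> fst b' \<Longrightarrow> b' = b"
      using marked_partitions_ex1[OF Q_partition p_in_F] by blast
    show ?thesis
    proof (rule ex1I[of _ "map_prod (image \<pi>) id b"])
      show "map_prod (image \<pi>) id b \<in> relabel \<pi> Q \<and> \<pi> p \<in> fst (map_prod (image \<pi>) id b)"
        using b(1,2) by (simp add: relabel_def)
      fix c assume "c \<in> relabel \<pi> Q \<and> \<pi> p \<in> fst c"
      then obtain b' where "b' \<in> Q" "c = map_prod (image \<pi>) id b'" "\<pi> p \<in> \<pi> ` fst b'"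
        by (auto simp: relabel_def)
      then show "c = map_prod (image \<pi>) id b" using b(3)[of b'] image_mem by simp
    qed
  qed
  ultimately show ?thesis by (auto simp: marked_partitions_def)
qed

lemma bij_betw_relabel:
  assumes "inj_on \<pi> F"
  shows "bij_betw (relabel \<pi>) (marked_partitions F) (marked_partitions (\<pi> ` F))"
proof (rule bij_betw_byWitness[where f' = "relabel (inv_into F \<pi>)"])
  have inv: "inj_on (inv_into F \<pi>) (\<pi> ` F)" "inv_into F \<pi> ` \<pi> ` F = F"
    using assms by (auto simp: inj_on_inv_into)
  have points_in: "p \<in> F" if "Q \<in> marked_partitions F" "b \<in> Q" "p \<in> fst b" for Q b and p :: 'c and F
    using that Union_marked_partition[OF that(1)] by blast
  show "relabel \<pi> ` marked_partitions F \<subseteq> marked_partitions (\<pi> ` F)"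
    using relabel_in_marked_partitions[OF assms] by blast
  show "relabel (inv_into F \<pi>) ` marked_partitions (\<pi> ` F) \<subseteq> marked_partitions F"
    using relabel_in_marked_partitions[OF inv(1)] unfolding inv(2) by blast
  show "\<forall>Q\<in>marked_partitions F. relabel (inv_into F \<pi>) (relabel \<pi> Q) = Q"
    using assms points_in by (intro ballI relabel_relabel_cancel inv_into_f_f)
  show "\<forall>Q\<in>marked_partitions (\<pi> ` F). relabel \<pi> (relabel (inv_into F \<pi>) Q) = Q"
    using points_in by (intro ballI relabel_relabel_cancel f_inv_into_f)
qed

lemma partition_mean_relabel:
  "inj_on \<pi> F \<Longrightarrow> partition_mean (\<pi> ` F) \<phi> = partition_mean F (\<lambda>Q. \<phi> (relabel \<pi> Q))"
  unfolding partition_mean_def by (rule average_reindex_bij_betw[OF bij_betw_relabel])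

lemma card_marked_partitions_cong:
  assumes "finite F" "finite G" "card F = card G"
  shows "card (marked_partitions F) = card (marked_partitions G)"
proof -
  obtain \<pi> where "bij_betw \<pi> F G" using assms finite_same_card_bij by blast
  then show ?thesis using bij_betw_same_card[OF bij_betw_relabel[of \<pi> F]] by (simp add: bij_betw_def)
qed

subsection \<open>Revealing a partition block by block\<close>

lemma bij_betw_insert_block:
  "bij_betw (\<lambda>(b, Q). (insert b Q, b)) (SIGMA b:blocks F. marked_partitions (F - fst b))
      (SIGMA P:marked_partitions F. P)"
  by (rule bij_betw_byWitness[where f' = "\<lambda>(P, b). (b, P - {b})"])
    (use marked_partitions_insert marked_partitions_remove in \<open>auto, blast+\<close>)

lemma partition_mean_rec:
  assumes F_finite_card: "finite F" "card F = K * Suc n"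
  shows "partition_mean F \<phi> = average (blocks F) (\<lambda>b. partition_mean (F - fst b) (\<lambda>Q. \<phi> (insert b Q)))"
proof -
  have P_finite_card: "finite P" "card P = Suc n" if "P \<in> marked_partitions F" for P
    using marked_partitions_finite[OF that F_finite_card(1)]
      card_marked_partition[OF that F_finite_card(1)] F_finite_card(2) K_pos
    by (simp_all del: mult_Suc_right)
  obtain b0 where b0_block: "b0 \<in> blocks F"
    using blocks_nonempty[OF F_finite_card(1)] F_finite_card(2) by auto
  have card_rest: "card (marked_partitions (F - fst b)) = card (marked_partitions (F - fst b0))"
    if "b \<in> blocks F" for b
    using F_finite_card card_Diff_block[OF that F_finite_card(2)]
      card_Diff_block[OF b0_block F_finite_card(2)]
    by (intro card_marked_partitions_cong) auto
  have "partition_mean F \<phi> = average (marked_partitions F) (\<lambda>P. average P (\<lambda>b. \<phi> P))"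
    unfolding partition_mean_def using P_finite_card
    by (intro average_cong average_const[symmetric]) force+
  also have "\<dots> = average (SIGMA P:marked_partitions F. P) (\<lambda>(P, b). \<phi> P)"
    using F_finite_card P_finite_card by (subst average_Sigma[where n = "Suc n"]) auto
  also have "\<dots> = average (SIGMA b:blocks F. marked_partitions (F - fst b)) (\<lambda>(b, Q). \<phi> (insert b Q))"
    unfolding average_reindex_bij_betw[OF bij_betw_insert_block] by (intro average_cong) auto
  also have "\<dots> = average (blocks F) (\<lambda>b. partition_mean (F - fst b) (\<lambda>Q. \<phi> (insert b Q)))"
    unfolding partition_mean_def using F_finite_card card_rest by (subst average_Sigma) auto
  finally show ?thesis .
qed

end

section \<open>Lipschitz functions of partitions\<close>

definition insert_lipschitz :: "real \<Rightarrow> 'b set \<Rightarrow> ('b set \<Rightarrow> real) \<Rightarrow> bool" where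
  "insert_lipschitz c X \<phi> \<longleftrightarrow> (\<forall>Q b. finite Q \<longrightarrow> Q \<subseteq> X \<longrightarrow> b \<in> X \<longrightarrow> \<bar>\<phi> (insert b Q) - \<phi> Q\<bar> \<le> c)"

lemma insert_lipschitzD:
  "insert_lipschitz c X \<phi> \<Longrightarrow> finite Q \<Longrightarrow> Q \<subseteq> X \<Longrightarrow> b \<in> X \<Longrightarrow> \<bar>\<phi> (insert b Q) - \<phi> Q\<bar> \<le> c"
  by (simp add: insert_lipschitz_def)

lemma insert_lipschitz_subset: "insert_lipschitz c X \<phi> \<Longrightarrow> Y \<subseteq> X \<Longrightarrow> insert_lipschitz c Y \<phi>"
  unfolding insert_lipschitz_def by (meson subset_iff subset_trans)

lemma insert_lipschitz_uminus: "insert_lipschitz c X \<phi> \<Longrightarrow> insert_lipschitz c X (\<lambda>Q. - \<phi> Q)"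
  by (simp add: insert_lipschitz_def abs_minus_commute)

lemma insert_lipschitz_insert:
  assumes "insert_lipschitz c X \<phi>" "b \<in> X"
  shows "insert_lipschitz c X (\<lambda>Q. \<phi> (insert b Q))"
  unfolding insert_lipschitz_def
proof (intro allI impI)
  fix Q b' assume "finite Q" "Q \<subseteq> X" "b' \<in> X"
  then show "\<bar>\<phi> (insert b (insert b' Q)) - \<phi> (insert b Q)\<bar> \<le> c"
    using insert_lipschitzD[OF assms(1), of "insert b Q" b'] assms(2) by (simp add: insert_commute)
qed

lemma insert_lipschitz_Un_diff_le:
  fixes c :: real
  assumes lipschitz: "insert_lipschitz c X \<phi>" and Q_finite_subset: "finite Q" "Q \<subseteq> X"
    and D_finite_subset: "finite D" "D \<subseteq> X"
  shows "\<bar>\<phi> (D \<union> Q) - \<phi> Q\<bar> \<le> c * card D"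
  using D_finite_subset
proof (induction D rule: finite_induct)
  case (insert b D)
  have "\<bar>\<phi> (insert b (D \<union> Q)) - \<phi> (D \<union> Q)\<bar> \<le> c"
    using insert Q_finite_subset by (intro insert_lipschitzD[OF lipschitz]) auto
  then show ?case using insert by (simp add: algebra_simps)
qed simp

lemma insert_lipschitz_diff_le:
  fixes c :: real
  assumes lipschitz: "insert_lipschitz c X \<phi>" and Q_finite_subset: "finite Q" "Q \<subseteq> X"
    and R_finite_subset: "finite R" "R \<subseteq> X"
  shows "\<bar>\<phi> Q - \<phi> R\<bar> \<le> c * card (Q - R) + c * card (R - Q)"
proof -
  have "\<bar>\<phi> ((Q - R) \<union> (Q \<inter> R)) - \<phi> (Q \<inter> R)\<bar> \<le> c * card (Q - R)"
    "\<bar>\<phi> ((R - Q) \<union> (Q \<inter> R)) - \<phi> (Q \<inter> R)\<bar> \<le> c * card (R - Q)"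
    using Q_finite_subset R_finite_subset by (intro insert_lipschitz_Un_diff_le[OF lipschitz]; auto)+
  moreover have "(Q - R) \<union> (Q \<inter> R) = Q" "(R - Q) \<union> (Q \<inter> R) = R" by auto
  ultimately show ?thesis by simp
qed

lemma ex_bij_fixing_Int:
  assumes finite_U_U': "finite U" "finite U'" and card_eq: "card U = card U'"
  obtains \<pi> where "inj_on \<pi> U" "\<pi> ` U = U'" "\<And>x. x \<in> U \<inter> U' \<Longrightarrow> \<pi> x = x"
proof -
  have "card (U - U') = card (U' - U)"
    using finite_U_U' card_eq by (metis Int_commute card_Diff_subset_Int finite_Int)
  then obtain f where f_bij: "bij_betw f (U - U') (U' - U)"
    using finite_U_U' by (meson finite_Diff finite_same_card_bij)
  have "bij_betw (\<lambda>x. if x \<in> U - U' then f x else id x) ((U - U') \<union> (U \<inter> U')) ((U' - U) \<union> (U \<inter> U'))"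
    using f_bij by (intro bij_betw_disjoint_Un) (auto simp: bij_betw_def)
  moreover have "(U - U') \<union> (U \<inter> U') = U" "(U' - U) \<union> (U \<inter> U') = U'" by auto
  ultimately show ?thesis
    using that[of "\<lambda>x. if x \<in> U - U' then f x else id x"] by (auto simp: bij_betw_def)
qed

context marked_blocks
begin

lemma card_touched_blocks_le:
  assumes P_partition: "P \<in> marked_partitions F" and finite_F: "finite F" and D_subset: "D \<subseteq> F"
  shows "card {b \<in> P. fst b \<inter> D \<noteq> {}} \<le> card D"
proof -
  have "{b \<in> P. fst b \<inter> D \<noteq> {}} \<subseteq> (\<lambda>p. THE b. b \<in> P \<and> p \<in> fst b) ` D"
  proof
    fix b assume "b \<in> {b \<in> P. fst b \<inter> D \<noteq> {}}"
    then obtain p where p: "b \<in> P" "p \<in> fst b" "p \<in> D" by blast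
    then have "(THE b. b \<in> P \<and> p \<in> fst b) = b"
      using the1_equality[OF marked_partitions_ex1[OF P_partition, of p]] D_subset by blast
    then show "b \<in> (\<lambda>p. THE b. b \<in> P \<and> p \<in> fst b) ` D" using p(3) by (intro image_eqI[of _ _ p]) simp_all
  qed
  then show ?thesis using finite_subset[OF D_subset finite_F] by (meson surj_card_le)
qed

lemma card_relabel_diff_le:
  assumes P_partition: "P \<in> marked_partitions F" and finite_F: "finite F" and D_subset: "D \<subseteq> F"
    and fixed: "\<And>p. p \<in> F - D \<Longrightarrow> \<pi> p = p"
  shows "card (P - relabel \<pi> P) \<le> card D" "card (relabel \<pi> P - P) \<le> card D"
proof -
  let ?T = "{b \<in> P. fst b \<inter> D \<noteq> {}}" and ?\<pi> = "map_prod (image \<pi>) id"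
  have card_touched: "card ?T \<le> card D" by (rule card_touched_blocks_le[OF P_partition finite_F D_subset])
  have finite_T: "finite ?T" using marked_partitions_finite[OF P_partition finite_F] by simp
  have "?\<pi> b = b" if "b \<in> P - ?T" for b
  proof -
    have "fst b \<subseteq> F - D" using that Union_marked_partition[OF P_partition] by blast
    then have "\<pi> ` fst b = id ` fst b" using fixed by (intro image_cong refl) auto
    then show ?thesis by (simp add: prod_eq_iff)
  qed
  then have "?\<pi> ` (P - ?T) = (\<lambda>b. b) ` (P - ?T)" by (intro image_cong refl)
  moreover have "relabel \<pi> P = ?\<pi> ` (P - ?T) \<union> ?\<pi> ` ?T" unfolding relabel_def by blast
  ultimately have "relabel \<pi> P = (P - ?T) \<union> ?\<pi> ` ?T" by simp
  then have "P - relabel \<pi> P \<subseteq> ?T" "relabel \<pi> P - P \<subseteq> ?\<pi> ` ?T" by blast+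
  then have "card (P - relabel \<pi> P) \<le> card ?T" "card (relabel \<pi> P - P) \<le> card (?\<pi> ` ?T)"
    using finite_T by (intro card_mono; simp)+
  then show "card (P - relabel \<pi> P) \<le> card D" "card (relabel \<pi> P - P) \<le> card D"
    using card_touched card_image_le[OF finite_T, of ?\<pi>] by linarith+
qed

lemma partition_mean_exchange:
  fixes c :: real
  assumes subsets: "finite S" "U \<subseteq> S" "U' \<subseteq> S" and card_eq: "card U = card U'"
    and lipschitz: "insert_lipschitz c (blocks S) \<phi>" and c_nonneg: "0 \<le> c"
  shows "\<bar>partition_mean U \<phi> - partition_mean U' \<phi>\<bar> \<le> 2 * c * card (U - U')"
proof -
  have finite_U_U': "finite U" "finite U'" using subsets finite_subset by auto
  obtain \<pi> where \<pi>: "inj_on \<pi> U" "\<pi> ` U = U'" "\<And>x. x \<in> U \<inter> U' \<Longrightarrow> \<pi> x = x"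
    using ex_bij_fixing_Int[OF finite_U_U' card_eq] by blast
  have "\<bar>\<phi> P - \<phi> (relabel \<pi> P)\<bar> \<le> 2 * c * card (U - U')" if P_partition: "P \<in> marked_partitions U" for P
  proof -
    have relabelled: "relabel \<pi> P \<in> marked_partitions U'"
      using relabel_in_marked_partitions[OF \<pi>(1) P_partition] \<pi>(2) by simp
    have "\<bar>\<phi> P - \<phi> (relabel \<pi> P)\<bar> \<le> c * card (P - relabel \<pi> P) + c * card (relabel \<pi> P - P)"
      using marked_partitions_finite[OF P_partition] marked_partitions_finite[OF relabelled] finite_U_U'
        marked_partitions_subset[OF P_partition] marked_partitions_subset[OF relabelled]
        blocks_mono[OF subsets(2)] blocks_mono[OF subsets(3)]
      by (intro insert_lipschitz_diff_le[OF lipschitz]) auto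
    also have "\<dots> \<le> c * card (U - U') + c * card (U - U')"
      using card_relabel_diff_le[OF P_partition finite_U_U'(1), of "U - U'" \<pi>] \<pi>(3) c_nonneg
      by (intro add_mono mult_left_mono of_nat_mono) auto
    finally show ?thesis by simp
  qed
  then have "\<bar>partition_mean U \<phi> - partition_mean U (\<lambda>P. \<phi> (relabel \<pi> P))\<bar> \<le> 2 * c * card (U - U')"
    unfolding partition_mean_def using finite_U_U' c_nonneg by (intro abs_average_diff_le) auto
  then show ?thesis using partition_mean_relabel[OF \<pi>(1), of \<phi>] \<pi>(2) by simp
qed

lemma ex_subset_partition_mean_le:
  fixes c :: real
  assumes "finite S" "insert_lipschitz c (blocks S) \<phi>" "F \<subseteq> S" "card F = K * (n + d)"
  shows "\<exists>U\<subseteq>F. card U = K * n \<and> partition_mean U \<phi> \<le> partition_mean F \<phi> + c * d"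
  using assms
proof (induction d arbitrary: F)
  case 0
  then show ?case by (intro exI[of _ F]) auto
next
  case (Suc d)
  have F_finite_card: "finite F" "card F = K * Suc (n + d)" using Suc.prems finite_subset by auto
  have "blocks F \<noteq> {}" using F_finite_card by (intro blocks_nonempty) simp_all
  then obtain b where b: "b \<in> blocks F"
      "partition_mean (F - fst b) (\<lambda>Q. \<phi> (insert b Q)) \<le> partition_mean F \<phi>"
    using exists_le_average[of "blocks F"
        "\<lambda>b. partition_mean (F - fst b) (\<lambda>Q. \<phi> (insert b Q))"] F_finite_card
    unfolding partition_mean_rec[OF F_finite_card, of \<phi>] by auto
  let ?F = "F - fst b"
  have rest_finite_card: "finite ?F" "card ?F = K * (n + d)"
    using F_finite_card card_Diff_block[OF b(1)] by auto
  have "\<phi> Q \<le> \<phi> (insert b Q) + c" if "Q \<in> marked_partitions ?F" for Q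
    using insert_lipschitzD[OF Suc.prems(2), of Q b] marked_partitions_finite[OF that rest_finite_card(1)]
      marked_partitions_subset[OF that] blocks_mono[of ?F S] blocks_mono[of F S] Suc.prems(3) b(1)
    by (fastforce simp: abs_le_iff)
  then have "partition_mean ?F \<phi> \<le> partition_mean ?F (\<lambda>Q. \<phi> (insert b Q) + c)"
    unfolding partition_mean_def by (rule average_mono)
  also have "\<dots> = partition_mean ?F (\<lambda>Q. \<phi> (insert b Q)) + c"
    using partition_mean_const[OF rest_finite_card] by (simp add: partition_mean_def average_add)
  finally have "partition_mean ?F \<phi> \<le> partition_mean F \<phi> + c" using b(2) by linarith
  moreover obtain U where "U \<subseteq> ?F" "card U = K * n" "partition_mean U \<phi> \<le> partition_mean ?F \<phi> + c * d"
    using Suc.IH[of ?F] Suc.prems rest_finite_card by blast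
  ultimately show ?case by (intro exI[of _ U]) (auto simp: algebra_simps)
qed

lemma partition_mean_subset_le:
  fixes c :: real
  assumes sizes: "finite S" "U \<subseteq> S" "card U = K * n" "card S = K * (n + d)"
    and lipschitz: "insert_lipschitz c (blocks S) \<phi>" and c_nonneg: "0 \<le> c"
  shows "partition_mean U \<phi> \<le> partition_mean S \<phi> + 3 * c * K * d"
proof -
  obtain U' where U': "U' \<subseteq> S" "card U' = K * n" "partition_mean U' \<phi> \<le> partition_mean S \<phi> + c * d"
    using ex_subset_partition_mean_le[OF sizes(1) lipschitz subset_refl sizes(4)] by blast
  have "card (U - U') \<le> card (S - U')" using sizes by (intro card_mono) auto
  also have "\<dots> = K * d"
    using U' sizes finite_subset[OF U'(1) sizes(1)] by (simp add: card_Diff_subset algebra_simps)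
  finally have "2 * c * card (U - U') \<le> 2 * c * real (K * d)"
    using c_nonneg by (intro mult_left_mono of_nat_mono) auto
  moreover have "\<bar>partition_mean U \<phi> - partition_mean U' \<phi>\<bar> \<le> 2 * c * card (U - U')"
    using sizes U' lipschitz c_nonneg by (intro partition_mean_exchange) auto
  moreover have "c * d \<le> c * real (K * d)" using c_nonneg K_pos by (intro mult_left_mono of_nat_mono) auto
  ultimately show ?thesis using U'(3) by (simp add: algebra_simps)
qed

lemma partition_mean_subset:
  fixes S :: "'p set" and c :: real
  assumes sizes: "finite S" "U \<subseteq> S" "card U = K * n" "card S = K * (n + d)"
    and lipschitz: "insert_lipschitz c (blocks S) \<phi>" and c_nonneg: "0 \<le> c"
  shows "\<bar>partition_mean U \<phi> - partition_mean S \<phi>\<bar> \<le> 3 * c * K * d"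
proof -
  have "partition_mean F (\<lambda>Q. - \<phi> Q) = - partition_mean F \<phi>" for F :: "'p set"
    using average_cmult[of "marked_partitions F" "-1" \<phi>] by (simp add: partition_mean_def)
  then show ?thesis
    using partition_mean_subset_le[OF assms]
      partition_mean_subset_le[OF sizes insert_lipschitz_uminus[OF lipschitz] c_nonneg]
    by (simp add: abs_le_iff)
qed

lemma abs_partition_mean_insert_diff_le:
  fixes c :: real
  assumes F_finite_card: "finite F" "card F = K * Suc n" and lipschitz: "insert_lipschitz c (blocks F) \<phi>"
    and c_nonneg: "0 \<le> c"
    and b: "b \<in> blocks F" "b' \<in> blocks F"
  shows "\<bar>partition_mean (F - fst b) (\<lambda>Q. \<phi> (insert b Q))
      - partition_mean (F - fst b') (\<lambda>Q. \<phi> (insert b' Q))\<bar>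
    \<le> 2 * c * (K + 1)"
proof -
  let ?F = "F - fst b" and ?F' = "F - fst b'"
  have "\<bar>\<phi> (insert b Q) - \<phi> (insert b' Q)\<bar> \<le> 2 * c" if Q_partition: "Q \<in> marked_partitions ?F" for Q
  proof -
    have "finite Q" "Q \<subseteq> blocks F"
      using marked_partitions_finite[OF Q_partition] F_finite_card
        marked_partitions_subset[OF Q_partition] blocks_mono[of ?F F]
      by auto
    then show ?thesis
      using insert_lipschitzD[OF lipschitz, of Q b] insert_lipschitzD[OF lipschitz, of Q b'] b by linarith
  qed
  then have "\<bar>partition_mean ?F (\<lambda>Q. \<phi> (insert b Q)) - partition_mean ?F (\<lambda>Q. \<phi> (insert b' Q))\<bar> \<le> 2 * c"
    unfolding partition_mean_def using F_finite_card c_nonneg by (intro abs_average_diff_le) auto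
  moreover have "\<bar>partition_mean ?F (\<lambda>Q. \<phi> (insert b' Q)) - partition_mean ?F' (\<lambda>Q. \<phi> (insert b' Q))\<bar>
      \<le> 2 * c * card (?F - ?F')"
    using F_finite_card b c_nonneg card_Diff_block[OF _ F_finite_card(2)]
    by (intro partition_mean_exchange[of F] insert_lipschitz_insert[OF lipschitz]) auto
  moreover have "card (?F - ?F') \<le> K"
    using blocksD(2,3)[OF b(2)] card_mono[of "fst b'" "?F - ?F'"] by auto
  then have "2 * c * card (?F - ?F') \<le> 2 * c * K" using c_nonneg by (intro mult_left_mono) auto
  ultimately show ?thesis by (simp add: algebra_simps)
qed

lemma partition_mean_insert_deviation_le:
  fixes c :: real
  assumes F_finite_card: "finite F" "card F = K * Suc n" and lipschitz: "insert_lipschitz c (blocks F) \<phi>"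
    and c_nonneg: "0 \<le> c"
    and b_block: "b \<in> blocks F"
  shows "(partition_mean (F - fst b) (\<lambda>Q. \<phi> (insert b Q)) - partition_mean F \<phi>)\<^sup>2 \<le> (2 * c * (K + 1))\<^sup>2"
proof -
  let ?M = "\<lambda>b. partition_mean (F - fst b) (\<lambda>Q. \<phi> (insert b Q))"
  have "\<bar>average (blocks F) (\<lambda>_. ?M b) - average (blocks F) ?M\<bar> \<le> 2 * c * (K + 1)"
    using F_finite_card c_nonneg abs_partition_mean_insert_diff_le[OF F_finite_card lipschitz c_nonneg b_block]
    by (intro abs_average_diff_le) auto
  moreover have "average (blocks F) (\<lambda>_. ?M b) = ?M b"
    using F_finite_card b_block by (intro average_const) auto
  ultimately have "\<bar>?M b - partition_mean F \<phi>\<bar> \<le> 2 * c * (K + 1)"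
    by (simp add: partition_mean_rec[OF F_finite_card])
  then show ?thesis by (metis abs_le_square_iff abs_of_nonneg abs_ge_zero order_trans)
qed

lemma partition_variance_le:
  fixes c :: real
  assumes "finite F" "card F = K * n" "insert_lipschitz c (blocks F) \<phi>" "0 \<le> c"
  shows "partition_mean F (\<lambda>Q. (\<phi> Q - partition_mean F \<phi>)\<^sup>2) \<le> n * (2 * c * (K + 1))\<^sup>2"
  using assms
proof (induction n arbitrary: F \<phi>)
  case (Suc n)
  note F_finite_card = Suc.prems(1,2)
  define \<mu> where "\<mu> = partition_mean F \<phi>"
  define D where "D = 2 * c * (K + 1)"
  have conditional: "partition_mean (F - fst b) (\<lambda>Q. (\<phi> (insert b Q) - \<mu>)\<^sup>2) \<le> n * D\<^sup>2 + D\<^sup>2"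
    if b_block: "b \<in> blocks F" for b
  proof -
    define M where "M = partition_mean (F - fst b) (\<lambda>Q. \<phi> (insert b Q))"
    have rest_finite_card: "finite (F - fst b)" "card (F - fst b) = K * n"
      using F_finite_card card_Diff_block[OF b_block] by auto
    have "insert_lipschitz c (blocks (F - fst b)) (\<lambda>Q. \<phi> (insert b Q))"
      using insert_lipschitz_subset[OF insert_lipschitz_insert[OF Suc.prems(3) b_block]]
      by (simp add: blocks_mono)
    then have "partition_mean (F - fst b) (\<lambda>Q. (\<phi> (insert b Q) - M)\<^sup>2) \<le> n * D\<^sup>2"
      unfolding M_def D_def by (rule Suc.IH[OF rest_finite_card _ Suc.prems(4)])
    moreover have "partition_mean (F - fst b) (\<lambda>Q. (\<phi> (insert b Q) - \<mu>)\<^sup>2)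
        = partition_mean (F - fst b) (\<lambda>Q. (\<phi> (insert b Q) - M)\<^sup>2) + (M - \<mu>)\<^sup>2"
      unfolding partition_mean_def M_def using rest_finite_card marked_partitions_nonempty
      by (intro average_square_deviation) auto
    ultimately show ?thesis
      using partition_mean_insert_deviation_le[OF Suc.prems b_block] by (simp add: M_def D_def \<mu>_def)
  qed
  have "partition_mean F (\<lambda>Q. (\<phi> Q - \<mu>)\<^sup>2)
      = average (blocks F) (\<lambda>b. partition_mean (F - fst b) (\<lambda>Q. (\<phi> (insert b Q) - \<mu>)\<^sup>2))"
    by (rule partition_mean_rec[OF F_finite_card])
  also have "\<dots> \<le> n * D\<^sup>2 + D\<^sup>2" using F_finite_card conditional by (intro average_le) auto
  finally show ?case unfolding \<mu>_def D_def by (simp add: algebra_simps)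
qed simp

end

section \<open>Global and split steps\<close>

lemma power_convex_combination:
  fixes p q x y :: real
  assumes "0 \<le> p" "0 \<le> q" "p + q = 1" "0 \<le> x" "0 \<le> y"
  shows "(p * x + q * y) ^ k \<le> p * x ^ k + q * y ^ k"
proof -
  have "convex_on {0..} (\<lambda>x::real. x ^ k)"
    using convex_power_odd[of k] convex_on_subset[OF convex_power_even[of k], of "{0..}"]
    by (cases "even k") auto
  then show ?thesis using assms by (auto simp: convex_on_def)
qed

lemma divide_card_remove_le:
  assumes "finite F" "C \<subseteq> F" "a \<in> C \<or> a \<notin> F"
  shows "real (card (C - {a})) / real (card (F - {a})) \<le> real (card C) / real (card F)"
proof (cases "a \<in> C \<and> card F \<noteq> 1")
  case True
  then have "finite C" "a \<in> F" "card C \<le> card F" "card F \<noteq> 0"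
    using assms finite_subset by (auto intro: card_mono)
  then show ?thesis
    using True diff_divide_le_divide_diff(2)[of "card C" "card F" 1] by (simp add: card_Diff_singleton)
next
  case False
  moreover have "card (F - {a}) = 0" if "a \<in> C" "card F = 1"
    using that assms by (subst card_Diff_singleton) auto
  ultimately show ?thesis using assms by (cases "a \<in> C") auto
qed

locale two_sides = marked_blocks K A for K :: nat and A :: "'m set" +
  fixes S1 S2 :: "'p set" and p q :: real
  assumes finite_sides: "finite S1" "finite S2" and disjoint_sides: "S1 \<inter> S2 = {}"
    and p_pos: "0 < p" and q_pos: "0 < q" and p_add_q: "p + q = 1"
begin

lemma finite_subset_sides: "F \<subseteq> S1 \<union> S2 \<Longrightarrow> finite F"
  using finite_sides by (metis finite_UnI finite_subset)

subsection \<open>Drawing points from both sides\<close>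

definition tilt :: "real \<Rightarrow> real \<Rightarrow> 'p set \<Rightarrow> real" where
  "tilt x y F = x ^ card (F \<inter> S1) * y ^ card (F \<inter> S2)"

definition side_weight :: "'p set \<Rightarrow> real" where
  "side_weight F = fact (card (F \<inter> S1)) * fact (card (F \<inter> S2)) / tilt p q F"

text \<open>The probability of ending up with the set U if points of F are drawn one after the other, each from S1
  with probability p and from S2 with probability q, and uniformly among the points left there (mass is lost
  once a side is used up). The quotients of successive draws telescope, so that the order does not matter.\<close>

definition draw_weight :: "'p set \<Rightarrow> 'p set \<Rightarrow> real" where
  "draw_weight F U = fact (card U) * side_weight (F - U) / side_weight F"

lemma tilt_Diff:
  assumes "finite F" "U \<subseteq> F"
  shows "tilt x y F = tilt x y U * tilt x y (F - U)"
proof -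
  have "card (F \<inter> S) = card (U \<inter> S) + card ((F - U) \<inter> S)" for S
    using assms card_Un_disjoint[of "U \<inter> S" "(F - U) \<inter> S"]
    by (auto simp: Int_Un_distrib2[symmetric] finite_subset Un_absorb1)
  then show ?thesis by (simp add: tilt_def power_add)
qed

lemma side_weight_pos: "0 < side_weight F"
  unfolding side_weight_def tilt_def using p_pos q_pos by simp

lemma draw_weight_nonneg: "0 \<le> draw_weight F U"
  unfolding draw_weight_def using side_weight_pos[of F] side_weight_pos[of "F - U"] by simp

lemma draw_weight_empty [simp]: "draw_weight F {} = 1"
  unfolding draw_weight_def using side_weight_pos[of F] by simp

lemma draw_weight_mult:
  assumes "finite U" "e \<subseteq> U"
  shows "draw_weight F e * draw_weight (F - e) (U - e) = draw_weight F U / real (card U choose card e)"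
proof -
  have "finite e" "card e \<le> card U" using assms finite_subset card_mono by auto
  moreover have "F - e - (U - e) = F - U" using assms(2) by auto
  ultimately show ?thesis
    using side_weight_pos[of "F - e"] assms
    by (simp add: draw_weight_def card_Diff_subset binomial_fact[of "card e" "card U"])
qed

lemma draw_weight_nested:
  assumes finite_C: "finite C"
  shows "(\<Sum>e\<in>[C]\<^bsup>j\<^esup>. \<Sum>U\<in>[C - e]\<^bsup>k\<^esup>. draw_weight F e * draw_weight (F - e) U * h e U)
    = (\<Sum>U\<in>[C]\<^bsup>(j + k)\<^esup>. draw_weight F U * average ([U]\<^bsup>j\<^esup>) (\<lambda>e. h e (U - e)))"
  unfolding sum_nsets_nested[OF finite_C]
proof (rule sum.cong[OF refl])
  fix U assume "U \<in> [C]\<^bsup>(j + k)\<^esup>"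
  then have U_finite_card: "finite U" "card U = j + k" by (auto simp: nsets_def)
  have "(\<Sum>e\<in>[U]\<^bsup>j\<^esup>. draw_weight F e * draw_weight (F - e) (U - e) * h e (U - e))
      = (\<Sum>e\<in>[U]\<^bsup>j\<^esup>. draw_weight F U / real (j + k choose j) * h e (U - e))"
    using U_finite_card by (intro sum.cong refl) (simp add: nsets_def draw_weight_mult)
  also have "\<dots> = draw_weight F U * average ([U]\<^bsup>j\<^esup>) (\<lambda>e. h e (U - e))"
    using U_finite_card by (simp add: average_def card_nsets sum_distrib_left sum_divide_distrib)
  finally show "(\<Sum>e\<in>[U]\<^bsup>j\<^esup>. draw_weight F e * draw_weight (F - e) (U - e) * h e (U - e))
      = draw_weight F U * average ([U]\<^bsup>j\<^esup>) (\<lambda>e. h e (U - e))" .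
qed

lemma draw_weight_side1:
  assumes finite_F: "finite F" and e_subset: "e \<subseteq> F \<inter> S1"
  shows "draw_weight F e = p ^ card e / real (card (F \<inter> S1) choose card e)"
proof -
  have sides: "(F - e) \<inter> S1 = F \<inter> S1 - e" "(F - e) \<inter> S2 = F \<inter> S2" using e_subset disjoint_sides by auto
  have "finite e" "card e \<le> card (F \<inter> S1)"
    using finite_F e_subset finite_subset card_mono[of "F \<inter> S1" e] by auto
  moreover have "p ^ card (F \<inter> S1) = p ^ card e * p ^ (card (F \<inter> S1) - card e)"
    using calculation(2) by (simp flip: power_add)
  ultimately show ?thesis
    using e_subset p_pos q_pos unfolding draw_weight_def side_weight_def tilt_def sides
    by (simp add: card_Diff_subset binomial_fact[of "card e"] field_simps)
qed

lemma swap_sides: "two_sides K A S2 S1 q p"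
  using finite_sides disjoint_sides p_pos q_pos p_add_q by unfold_locales auto

lemma draw_weight_side2:
  assumes "finite F" "e \<subseteq> F \<inter> S2"
  shows "draw_weight F e = q ^ card e / real (card (F \<inter> S2) choose card e)"
proof -
  interpret swap: two_sides K A S2 S1 q p by (rule swap_sides)
  have "draw_weight F e = swap.draw_weight F e"
    by (simp add: draw_weight_def swap.draw_weight_def side_weight_def swap.side_weight_def
        tilt_def swap.tilt_def mult.commute)
  then show ?thesis using swap.draw_weight_side1[OF assms] by simp
qed

lemma sum_draw_weight_point:
  assumes F_subset: "F \<subseteq> S1 \<union> S2" and C_subset: "C \<subseteq> F"
  shows "(\<Sum>a\<in>C. draw_weight F {a} * tilt x y {a})
    = p * x * (card (C \<inter> S1) / card (F \<inter> S1)) + q * y * (card (C \<inter> S2) / card (F \<inter> S2))"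
proof -
  have finite_F_C: "finite F" "finite C"
    using finite_subset_sides[OF F_subset] finite_subset[OF C_subset] by auto
  have "(\<Sum>a\<in>C. draw_weight F {a} * tilt x y {a})
      = (\<Sum>a\<in>C \<inter> S1. draw_weight F {a} * tilt x y {a}) + (\<Sum>a\<in>C \<inter> S2. draw_weight F {a} * tilt x y {a})"
    using finite_F_C C_subset F_subset disjoint_sides
    by (subst sum.union_disjoint[symmetric]) (auto intro!: sum.cong)
  also have "(\<Sum>a\<in>C \<inter> S1. draw_weight F {a} * tilt x y {a}) = (\<Sum>a\<in>C \<inter> S1. p / card (F \<inter> S1) * x)"
    using C_subset disjoint_sides finite_F_C
    by (intro sum.cong refl) (auto simp: draw_weight_side1 tilt_def Int_insert_left)
  also have "(\<Sum>a\<in>C \<inter> S2. draw_weight F {a} * tilt x y {a}) = (\<Sum>a\<in>C \<inter> S2. q / card (F \<inter> S2) * y)"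
    using C_subset disjoint_sides finite_F_C
    by (intro sum.cong refl) (auto simp: draw_weight_side2 tilt_def Int_insert_left)
  finally show ?thesis by (simp add: mult_ac)
qed

lemma sum_draw_weight_Suc:
  assumes finite_C: "finite C"
  shows "(\<Sum>U\<in>[C]\<^bsup>(Suc k)\<^esup>. draw_weight F U * tilt x y U)
    = (\<Sum>a\<in>C. draw_weight F {a} * tilt x y {a} * (\<Sum>U\<in>[C - {a}]\<^bsup>k\<^esup>. draw_weight (F - {a}) U * tilt x y U))"
proof -
  have "(\<Sum>U\<in>[C]\<^bsup>(Suc k)\<^esup>. draw_weight F U * tilt x y U)
      = (\<Sum>U\<in>[C]\<^bsup>(1 + k)\<^esup>. draw_weight F U * average ([U]\<^bsup>1\<^esup>) (\<lambda>e. tilt x y e * tilt x y (U - e)))"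
  proof (intro sum.cong refl arg_cong2[where f = "(*)"])
    fix U assume "U \<in> [C]\<^bsup>(1 + k)\<^esup>"
    then have U: "finite U" "U \<noteq> {}" by (auto simp: nsets_def)
    then have "average ([U]\<^bsup>1\<^esup>) (\<lambda>e. tilt x y e * tilt x y (U - e)) = average ([U]\<^bsup>1\<^esup>) (\<lambda>_. tilt x y U)"
      using tilt_Diff by (intro average_cong) (auto simp: nsets_def)
    then show "tilt x y U = average ([U]\<^bsup>1\<^esup>) (\<lambda>e. tilt x y e * tilt x y (U - e))"
      using U by (simp add: average_const nsets_one)
  qed simp
  also have "\<dots> = (\<Sum>e\<in>[C]\<^bsup>1\<^esup>. \<Sum>U\<in>[C - e]\<^bsup>k\<^esup>. draw_weight F e * draw_weight (F - e) U
        * (tilt x y e * tilt x y U))"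
    by (rule draw_weight_nested[OF finite_C, symmetric])
  finally show ?thesis by (simp add: nsets_one sum.reindex sum_distrib_left mult_ac)
qed

lemma sum_draw_weight_le:
  assumes "F \<subseteq> S1 \<union> S2" "C \<subseteq> F" and xy_nonneg: "0 \<le> x" "0 \<le> y"
  shows "(\<Sum>U\<in>[C]\<^bsup>k\<^esup>. draw_weight F U * tilt x y U)
    \<le> (p * x * (card (C \<inter> S1) / card (F \<inter> S1)) + q * y * (card (C \<inter> S2) / card (F \<inter> S2))) ^ k"
  using assms(1,2)
proof (induction k arbitrary: C F)
  case (Suc k)
  define M where "M C F = p * x * (card (C \<inter> S1) / card (F \<inter> S1))
      + q * y * (card (C \<inter> S2) / card (F \<inter> S2))" for C F
  have M_nonneg: "0 \<le> M C F" for C F using p_pos q_pos xy_nonneg by (simp add: M_def)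
  have finite_F_C: "finite F" "finite C" using Suc.prems finite_subset_sides by auto
  have "(\<Sum>U\<in>[C - {a}]\<^bsup>k\<^esup>. draw_weight (F - {a}) U * tilt x y U) \<le> M C F ^ k" if a_in_C: "a \<in> C" for a
  proof -
    have "card ((C - {a}) \<inter> S) / card ((F - {a}) \<inter> S) \<le> card (C \<inter> S) / card (F \<inter> S)" for S
    proof -
      have "(C - {a}) \<inter> S = C \<inter> S - {a}" "(F - {a}) \<inter> S = F \<inter> S - {a}" by auto
      then show ?thesis
        using divide_card_remove_le[of "F \<inter> S" "C \<inter> S" a] finite_F_C Suc.prems(2) a_in_C by auto
    qed
    then have "M (C - {a}) (F - {a}) \<le> M C F"
      unfolding M_def using p_pos q_pos xy_nonneg by (intro add_mono mult_left_mono) auto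
    then have "M (C - {a}) (F - {a}) ^ k \<le> M C F ^ k" using M_nonneg by (intro power_mono)
    moreover have "(\<Sum>U\<in>[C - {a}]\<^bsup>k\<^esup>. draw_weight (F - {a}) U * tilt x y U) \<le> M (C - {a}) (F - {a}) ^ k"
      using Suc.prems unfolding M_def by (intro Suc.IH) auto
    ultimately show ?thesis by linarith
  qed
  then have "(\<Sum>U\<in>[C]\<^bsup>(Suc k)\<^esup>. draw_weight F U * tilt x y U)
      \<le> (\<Sum>a\<in>C. draw_weight F {a} * tilt x y {a} * M C F ^ k)"
    unfolding sum_draw_weight_Suc[OF finite_F_C(2)] using draw_weight_nonneg xy_nonneg
    by (intro sum_mono mult_left_mono) (auto simp: tilt_def)
  also have "\<dots> = M C F ^ Suc k"
    using sum_draw_weight_point[OF Suc.prems, of x y] by (simp add: M_def sum_distrib_right[symmetric])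
  finally show ?case by (simp add: M_def)
qed (simp add: tilt_def)

lemma sum_draw_weight_eq_1:
  assumes "F \<subseteq> S1 \<union> S2" "k \<le> card (F \<inter> S1)" "k \<le> card (F \<inter> S2)"
  shows "(\<Sum>U\<in>[F]\<^bsup>k\<^esup>. draw_weight F U) = 1"
  using assms
proof (induction k arbitrary: F)
  case (Suc k)
  have finite_F: "finite F" using Suc.prems(1) by (rule finite_subset_sides)
  have tilt_1: "tilt 1 1 U = 1" for U by (simp add: tilt_def)
  have "(\<Sum>U\<in>[F - {a}]\<^bsup>k\<^esup>. draw_weight (F - {a}) U) = 1" for a
  proof -
    have "k \<le> card ((F - {a}) \<inter> S)" if "Suc k \<le> card (F \<inter> S)" for S
    proof -
      have "(F - {a}) \<inter> S = F \<inter> S - {a}" by auto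
      then show ?thesis using that finite_F by (simp add: card_Diff_singleton_if) linarith
    qed
    then show ?thesis using Suc.prems by (intro Suc.IH) auto
  qed
  then have "(\<Sum>U\<in>[F]\<^bsup>(Suc k)\<^esup>. draw_weight F U) = (\<Sum>a\<in>F. draw_weight F {a})"
    using sum_draw_weight_Suc[OF finite_F, where F = F and x = 1 and y = 1] by (simp add: tilt_1)
  also have "\<dots> = p + q"
    using sum_draw_weight_point[OF Suc.prems(1) subset_refl, of 1 1] Suc.prems(2,3) by (simp add: tilt_1)
  finally show ?case using p_add_q by simp
qed simp

subsection \<open>Adding random blocks\<close>

definition free :: "('p set \<times> 'm) set \<Rightarrow> 'p set" where
  "free Q = (S1 \<union> S2) - \<Union>(fst ` Q)"

definition step :: "('p set \<Rightarrow> real) \<Rightarrow> (('p set \<times> 'm) set \<Rightarrow> real) \<Rightarrow> ('p set \<times> 'm) set \<Rightarrow> real" where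
  "step v f Q = (\<Sum>e\<in>[free Q]\<^bsup>K\<^esup>. draw_weight (free Q) e * v e * average A (\<lambda>a. f (insert (e, a) Q)))"

definition pair_mean :: "(('p set \<times> 'm) set \<Rightarrow> real) \<Rightarrow> ('p set \<times> 'm) set \<Rightarrow> 'p set \<Rightarrow> 'p set \<Rightarrow> real" where
  "pair_mean f Q e e' = average A (\<lambda>a. average A (\<lambda>a'. f (insert (e, a) (insert (e', a') Q))))"

text \<open>This reweighting yields the split step: the whole block lies in S1 with probability p and in S2 with
  probability q.\<close>

definition split_weight :: "'p set \<Rightarrow> real" where
  "split_weight e = (if e \<subseteq> S1 then 1 / p ^ (K - 1) else 0) + (if e \<subseteq> S2 then 1 / q ^ (K - 1) else 0)"

abbreviation "global_step \<equiv> step (\<lambda>_. 1)"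
abbreviation "split_step \<equiv> step split_weight"

definition partial_partitions :: "nat \<Rightarrow> ('p set \<times> 'm) set set" where
  "partial_partitions n = (\<Union>U\<in>[S1 \<union> S2]\<^bsup>(K * n)\<^esup>. marked_partitions U)"

lemma finite_free [simp]: "finite (free Q)"
  using finite_sides by (simp add: free_def)

lemma free_subset: "free Q \<subseteq> S1 \<union> S2"
  by (auto simp: free_def)

lemma free_empty [simp]: "free {} = S1 \<union> S2"
  by (simp add: free_def)

lemma free_insert: "free (insert b Q) = free Q - fst b"
  by (auto simp: free_def)

lemma split_weight_nonneg: "0 \<le> split_weight e"
  unfolding split_weight_def using p_pos q_pos by simp

lemma step_linear: "step v (\<lambda>Q. a * f Q + c * g Q) Q = a * step v f Q + c * step v g Q"
  by (simp add: step_def average_add average_cmult sum_distrib_left sum.distrib[symmetric] algebra_simps)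

lemma pair_mean_commute: "pair_mean f Q e e' = pair_mean f Q e' e"
  unfolding pair_mean_def by (subst average_commute) (simp add: insert_commute)

lemma step_step:
  "step u (step v f) Q = (\<Sum>W\<in>[free Q]\<^bsup>(K + K)\<^esup>.
    draw_weight (free Q) W * average ([W]\<^bsup>K\<^esup>) (\<lambda>e. u e * v (W - e) * pair_mean f Q e (W - e)))"
proof -
  let ?F = "free Q"
  have inner: "average A (\<lambda>a. step v f (insert (e, a) Q))
      = (\<Sum>e'\<in>[?F - e]\<^bsup>K\<^esup>. draw_weight (?F - e) e' * v e' * pair_mean f Q e e')" for e
    by (simp add: step_def pair_mean_def free_insert average_sum average_cmult insert_commute)
  have "step u (step v f) Q
      = (\<Sum>e\<in>[?F]\<^bsup>K\<^esup>. draw_weight ?F e * u e * average A (\<lambda>a. step v f (insert (e, a) Q)))"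
    by (simp only: step_def[of u])
  also have "\<dots> = (\<Sum>e\<in>[?F]\<^bsup>K\<^esup>. \<Sum>e'\<in>[?F - e]\<^bsup>K\<^esup>.
      draw_weight ?F e * draw_weight (?F - e) e' * (u e * v e' * pair_mean f Q e e'))"
    by (simp add: inner sum_distrib_left mult_ac)
  also have "\<dots> = (\<Sum>W\<in>[?F]\<^bsup>(K + K)\<^esup>.
      draw_weight ?F W * average ([W]\<^bsup>K\<^esup>) (\<lambda>e. u e * v (W - e) * pair_mean f Q e (W - e)))"
    by (rule draw_weight_nested) simp
  finally show ?thesis .
qed

lemma step_commute: "step u (step v f) = step v (step u f)"
proof
  fix Q
  show "step u (step v f) Q = step v (step u f) Q"
    unfolding step_step
  proof (intro sum.cong refl arg_cong2[where f = "(*)"])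
    fix W assume "W \<in> [free Q]\<^bsup>(K + K)\<^esup>"
    then have "finite W" "card W = K + K" by (auto simp: nsets_def)
    from average_nsets_complement[OF this, of "\<lambda>e e'. u e * v e' * pair_mean f Q e e'"]
    show "average ([W]\<^bsup>K\<^esup>) (\<lambda>e. u e * v (W - e) * pair_mean f Q e (W - e))
        = average ([W]\<^bsup>K\<^esup>) (\<lambda>e. v e * u (W - e) * pair_mean f Q e (W - e))"
      by (simp add: pair_mean_commute[of f Q "W - _"] mult.commute)
  qed
qed

lemma step_pow_commute: "(step u ^^ j) (step v f) = step v ((step u ^^ j) f)"
  by (induction j) (simp_all add: step_commute[of u v])

lemma step_pow_linear:
  "(step v ^^ j) (\<lambda>Q. a * f Q + c * g Q) Q = a * (step v ^^ j) f Q + c * (step v ^^ j) g Q"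
proof (induction j arbitrary: Q)
  case (Suc j)
  have "(step v ^^ j) (\<lambda>Q. a * f Q + c * g Q) = (\<lambda>Q. a * (step v ^^ j) f Q + c * (step v ^^ j) g Q)"
    using Suc by blast
  then show ?case by (simp add: step_linear)
qed simp

lemma global_step_pow:
  "(global_step ^^ T) f Q
    = (\<Sum>U\<in>[free Q]\<^bsup>(K * T)\<^esup>. draw_weight (free Q) U * partition_mean U (\<lambda>P. f (P \<union> Q)))"
proof (induction T arbitrary: Q)
  case (Suc T)
  let ?F = "free Q"
  let ?h = "\<lambda>e U. average A (\<lambda>a. partition_mean U (\<lambda>P. f (insert (e, a) P \<union> Q)))"
  have "(global_step ^^ Suc T) f Q
      = (\<Sum>e\<in>[?F]\<^bsup>K\<^esup>. \<Sum>U\<in>[?F - e]\<^bsup>(K * T)\<^esup>. draw_weight ?F e * draw_weight (?F - e) U * ?h e U)"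
    by (simp add: step_def[of _ "(global_step ^^ T) f"] Suc free_insert average_sum average_cmult
        sum_distrib_left mult.assoc)
  also have "\<dots> = (\<Sum>U\<in>[?F]\<^bsup>(K + K * T)\<^esup>. draw_weight ?F U * average ([U]\<^bsup>K\<^esup>) (\<lambda>e. ?h e (U - e)))"
    by (rule draw_weight_nested) simp
  also have "\<dots> = (\<Sum>U\<in>[?F]\<^bsup>(K * Suc T)\<^esup>. draw_weight ?F U * partition_mean U (\<lambda>P. f (P \<union> Q)))"
  proof (intro sum.cong arg_cong2[where f = "(*)"])
    fix U assume "U \<in> [?F]\<^bsup>(K * Suc T)\<^esup>"
    then have U_finite_card: "finite U" "card U = K * Suc T" by (auto simp: nsets_def)
    have "average ([U]\<^bsup>K\<^esup>) (\<lambda>e. ?h e (U - e))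
        = average (blocks U) (\<lambda>b. partition_mean (U - fst b) (\<lambda>P. f (insert b P \<union> Q)))"
      unfolding blocks_def using U_finite_card finite_A
      by (subst average_Sigma) (auto simp: finite_imp_finite_nsets)
    then show "average ([U]\<^bsup>K\<^esup>) (\<lambda>e. ?h e (U - e)) = partition_mean U (\<lambda>P. f (P \<union> Q))"
      using partition_mean_rec[OF U_finite_card] by simp
  qed simp_all
  finally show ?case .
qed simp

lemma sum_draw_weight_split_weight:
  assumes F_subset: "F \<subseteq> S1 \<union> S2" and C_subset: "C \<subseteq> F"
  shows "(\<Sum>e\<in>[C]\<^bsup>K\<^esup>. draw_weight F e * split_weight e * g e)
    = p * (\<Sum>e\<in>[C \<inter> S1]\<^bsup>K\<^esup>. g e) / (card (F \<inter> S1) choose K)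
    + q * (\<Sum>e\<in>[C \<inter> S2]\<^bsup>K\<^esup>. g e) / (card (F \<inter> S2) choose K)"
proof -
  have finite_F_C: "finite F" "finite C"
    using finite_subset_sides[OF F_subset] finite_subset[OF C_subset] by auto
  have side: "(\<Sum>e\<in>[C]\<^bsup>K\<^esup>. draw_weight F e * (if e \<subseteq> S then 1 / w ^ (K - 1) else 0) * g e)
      = w * (\<Sum>e\<in>[C \<inter> S]\<^bsup>K\<^esup>. g e) / (card (F \<inter> S) choose K)"
    if w_weight: "0 < w" "\<And>e. e \<subseteq> F \<inter> S \<Longrightarrow> draw_weight F e
        = w ^ card e / real (card (F \<inter> S) choose card e)" for S w
  proof -
    have "(\<Sum>e\<in>[C]\<^bsup>K\<^esup>. draw_weight F e * (if e \<subseteq> S then 1 / w ^ (K - 1) else 0) * g e)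
        = (\<Sum>e\<in>[C \<inter> S]\<^bsup>K\<^esup>. draw_weight F e * (if e \<subseteq> S then 1 / w ^ (K - 1) else 0) * g e)"
      using finite_F_C by (intro sum.mono_neutral_right) (auto simp: nsets_def finite_imp_finite_nsets)
    also have "\<dots> = (\<Sum>e\<in>[C \<inter> S]\<^bsup>K\<^esup>. w / (card (F \<inter> S) choose K) * g e)"
    proof (intro sum.cong refl)
      fix e assume "e \<in> [C \<inter> S]\<^bsup>K\<^esup>"
      then have e: "e \<subseteq> F \<inter> S" "e \<subseteq> S" "card e = K" using C_subset by (auto simp: nsets_def)
      have "w ^ K = w * w ^ (K - 1)" using K_pos by (simp add: power_eq_if)
      then show "draw_weight F e * (if e \<subseteq> S then 1 / w ^ (K - 1) else 0) * g e
          = w / (card (F \<inter> S) choose K) * g e"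
        using e(2,3) w_weight(1) unfolding w_weight(2)[OF e(1)] by simp
    qed
    finally show ?thesis by (simp add: sum_distrib_left sum_divide_distrib)
  qed
  show ?thesis
    using side[OF p_pos draw_weight_side1[OF finite_F_C(1)]]
      side[OF q_pos draw_weight_side2[OF finite_F_C(1)]]
    by (simp add: split_weight_def distrib_left distrib_right sum.distrib)
qed

lemma average_blocks: "average (blocks F) f = (\<Sum>e\<in>[F]\<^bsup>K\<^esup>. average A (\<lambda>a. f (e, a))) / (card F choose K)"
  if "finite F"
  unfolding blocks_def using that finite_A
  by (subst average_Sigma) (auto simp: finite_imp_finite_nsets average_def[of "[F]\<^bsup>K\<^esup>"] card_nsets)

lemma split_step_average:
  "split_step f Q = p * average (blocks (free Q \<inter> S1)) (\<lambda>b. f (insert b Q))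
    + q * average (blocks (free Q \<inter> S2)) (\<lambda>b. f (insert b Q))"
  unfolding step_def using sum_draw_weight_split_weight[OF free_subset subset_refl] by (simp add: average_blocks)

lemma sum_global_minus_split_eq_0:
  assumes F_subset: "F \<subseteq> S1 \<union> S2" and K_le: "K \<le> card (F \<inter> S1)" "K \<le> card (F \<inter> S2)"
  shows "(\<Sum>e\<in>[F]\<^bsup>K\<^esup>. draw_weight F e * (1 - split_weight e)) = 0"
proof -
  have finite_F: "finite F" using F_subset by (rule finite_subset_sides)
  have "(\<Sum>e\<in>[F]\<^bsup>K\<^esup>. draw_weight F e * split_weight e) = p + q"
    using sum_draw_weight_split_weight[OF F_subset subset_refl, of "\<lambda>_. 1"] finite_F K_le
    by (simp add: card_nsets)
  then show ?thesis
    using sum_draw_weight_eq_1[OF F_subset K_le] p_add_q by (simp add: right_diff_distrib sum_subtractf)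
qed

subsection \<open>Split steps stay within one class more often\<close>

lemma global_minus_split_nsets_le:
  assumes F_subset: "F \<subseteq> S1 \<union> S2" and C_subset: "C \<subseteq> F"
    and m_bounds: "K \<le> m" "m \<le> card (F \<inter> S1)" "m \<le> card (F \<inter> S2)"
  shows "(\<Sum>e\<in>[C]\<^bsup>K\<^esup>. draw_weight F e * (1 - split_weight e))
    \<le> (real K)\<^sup>2 / m * (p * (card (C \<inter> S1) / card (F \<inter> S1)) + q * (card (C \<inter> S2) / card (F \<inter> S2)))"
proof -
  define x y where "x = real (card (C \<inter> S1)) / card (F \<inter> S1)"
    and "y = real (card (C \<inter> S2)) / card (F \<inter> S2)"
  have finite_F_C: "finite F" "finite C"
    using finite_subset_sides[OF F_subset] finite_subset[OF C_subset] by auto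
  have ratio: "(real (card (C \<inter> S)) / card (F \<inter> S)) ^ K
      \<le> choose_ratio (card (C \<inter> S)) (card (F \<inter> S)) K
      + (real K)\<^sup>2 / m * (real (card (C \<inter> S)) / card (F \<inter> S))"
    if m_le_side: "m \<le> card (F \<inter> S)" for S
  proof -
    define w where "w = real (card (C \<inter> S)) / card (F \<inter> S)"
    have "w ^ K - (real K)\<^sup>2 * w / card (F \<inter> S) \<le> choose_ratio (card (C \<inter> S)) (card (F \<inter> S)) K"
      unfolding w_def using C_subset finite_F_C m_le_side m_bounds(1) K_pos
      by (intro choose_ratio_ge_power card_mono) auto
    moreover have "(real K)\<^sup>2 * w / card (F \<inter> S) \<le> (real K)\<^sup>2 * w / m"
      using m_le_side m_bounds(1) K_pos by (intro divide_left_mono) (auto simp: w_def)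
    ultimately show ?thesis by (simp add: w_def[symmetric])
  qed
  have "(\<Sum>e\<in>[C]\<^bsup>K\<^esup>. draw_weight F e) \<le> (p * x + q * y) ^ K"
    using sum_draw_weight_le[OF F_subset C_subset, of 1 1 K] by (simp add: tilt_def x_def y_def)
  also have "\<dots> \<le> p * x ^ K + q * y ^ K"
    using p_pos q_pos p_add_q by (intro power_convex_combination) (auto simp: x_def y_def)
  also have "\<dots> \<le> p * (choose_ratio (card (C \<inter> S1)) (card (F \<inter> S1)) K + (real K)\<^sup>2 / m * x)
      + q * (choose_ratio (card (C \<inter> S2)) (card (F \<inter> S2)) K + (real K)\<^sup>2 / m * y)"
    unfolding x_def y_def using p_pos q_pos m_bounds ratio by (intro add_mono mult_left_mono) auto
  also have "\<dots> = (\<Sum>e\<in>[C]\<^bsup>K\<^esup>. draw_weight F e * split_weight e) + (real K)\<^sup>2 / m * (p * x + q * y)"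
    using sum_draw_weight_split_weight[OF F_subset C_subset, of "\<lambda>_. 1"] finite_F_C
    by (simp add: choose_ratio_def card_nsets algebra_simps add_divide_distrib)
  finally show ?thesis by (simp add: right_diff_distrib sum_subtractf x_def y_def)
qed

lemma global_minus_split_mutually_related_le:
  assumes F_subset: "F \<subseteq> S1 \<union> S2" and m_bounds: "K \<le> m" "m \<le> card (F \<inter> S1)" "m \<le> card (F \<inter> S2)"
    and R_sym_trans: "symp R" "transp R"
  shows "(\<Sum>e\<in>{e \<in> [F]\<^bsup>K\<^esup>. mutually_related R e}. draw_weight F e * (1 - split_weight e)) \<le> (real K)\<^sup>2 / m"
proof -
  have finite_F: "finite F" using F_subset by (rule finite_subset_sides)
  let ?CC = "relation_classes R F"
  have total: "(\<Sum>C\<in>?CC. card (C \<inter> S) / card (F \<inter> S)) \<le> 1" for S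
    using sum_card_relation_classes_le[OF finite_F R_sym_trans, of S]
    by (simp add: sum_divide_distrib[symmetric] divide_le_eq_1 flip: of_nat_sum) linarith
  have "(\<Sum>e\<in>{e \<in> [F]\<^bsup>K\<^esup>. mutually_related R e}. draw_weight F e * (1 - split_weight e))
      \<le> (\<Sum>C\<in>?CC. (real K)\<^sup>2 / m * (p * (card (C \<inter> S1) / card (F \<inter> S1))
          + q * (card (C \<inter> S2) / card (F \<inter> S2))))"
    using K_pos global_minus_split_nsets_le[OF F_subset relation_classes_subset m_bounds]
    by (subst sum_mutually_related[OF finite_F R_sym_trans]) (simp, rule sum_mono)
  also have "\<dots> = (real K)\<^sup>2 / m * (p * (\<Sum>C\<in>?CC. card (C \<inter> S1) / card (F \<inter> S1))
        + q * (\<Sum>C\<in>?CC. card (C \<inter> S2) / card (F \<inter> S2)))"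
    by (simp only: sum_distrib_left[symmetric] sum.distrib)
  also have "\<dots> \<le> (real K)\<^sup>2 / m * (p * 1 + q * 1)"
    using total p_pos q_pos by (intro mult_left_mono add_mono) auto
  finally show ?thesis using p_add_q by simp
qed

subsection \<open>Monotonicity on partial partitions\<close>

lemma partial_partitionsD:
  assumes "Q \<in> partial_partitions n"
  shows "finite Q" "card Q = n" "Q \<subseteq> blocks (S1 \<union> S2)" "card (free Q) + K * n = card (S1 \<union> S2)"
proof -
  obtain U where U: "U \<subseteq> S1 \<union> S2" "finite U" "card U = K * n" and Q_partition: "Q \<in> marked_partitions U"
    using assms by (auto simp: partial_partitions_def nsets_def)
  show "finite Q" using marked_partitions_finite[OF Q_partition U(2)] .
  show "card Q = n" using card_marked_partition[OF Q_partition U(2)] U(3) K_pos by simp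
  show "Q \<subseteq> blocks (S1 \<union> S2)" using marked_partitions_subset[OF Q_partition] blocks_mono[OF U(1)] by blast
  have "free Q = S1 \<union> S2 - U" unfolding free_def Union_marked_partition[OF Q_partition] ..
  then show "card (free Q) + K * n = card (S1 \<union> S2)"
    using U finite_sides card_mono[of "S1 \<union> S2" U] by (simp add: card_Diff_subset)
qed

lemma partial_partitions_empty: "{} \<in> partial_partitions 0"
  by (simp add: partial_partitions_def marked_partitions_empty)

lemma partial_partitions_insert:
  assumes Q_partial: "Q \<in> partial_partitions n" and b_block: "b \<in> blocks (free Q)"
  shows "insert b Q \<in> partial_partitions (Suc n)" "b \<notin> Q"
proof -
  obtain U where U: "U \<subseteq> S1 \<union> S2" "finite U" "card U = K * n" and Q_partition: "Q \<in> marked_partitions U"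
    using Q_partial by (auto simp: partial_partitions_def nsets_def)
  have "free Q = S1 \<union> S2 - U" unfolding free_def Union_marked_partition[OF Q_partition] ..
  then have b_subset: "fst b \<subseteq> S1 \<union> S2 - U" using blocksD(1)[OF b_block] by simp
  then have "b \<in> blocks (U \<union> fst b)" "U \<union> fst b - fst b = U"
    using b_block by (auto simp: blocks_def nsets_def)
  then have "insert b Q \<in> marked_partitions (U \<union> fst b)" "b \<notin> Q"
    using marked_partitions_insert[of b "U \<union> fst b" Q] Q_partition by auto
  moreover have "card (U \<union> fst b) = K * Suc n"
    using U b_subset blocksD(2,3)[OF b_block] by (subst card_Un_disjoint) auto
  then have "U \<union> fst b \<in> [S1 \<union> S2]\<^bsup>(K * Suc n)\<^esup>"
    using U b_subset blocksD(2)[OF b_block] by (simp add: nsets_def del: mult_Suc_right) blast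
  ultimately show "insert b Q \<in> partial_partitions (Suc n)" "b \<notin> Q"
    unfolding partial_partitions_def by blast+
qed

lemma step_mono:
  assumes v_nonneg: "\<And>e. 0 \<le> v e" and Q_partial: "Q \<in> partial_partitions n"
    and f_le_g: "\<And>Q'. Q' \<in> partial_partitions (Suc n) \<Longrightarrow> f Q' \<le> g Q'"
  shows "step v f Q \<le> step v g Q"
  unfolding step_def using v_nonneg draw_weight_nonneg f_le_g partial_partitions_insert(1)[OF Q_partial]
  by (intro sum_mono mult_left_mono average_mono mult_nonneg_nonneg) (auto simp: blocks_def)

lemma step_pow_mono:
  assumes v_nonneg: "\<And>e. 0 \<le> v e"
  shows "Q \<in> partial_partitions n \<Longrightarrow> (\<And>Q'. Q' \<in> partial_partitions (n + j) \<Longrightarrow> f Q' \<le> g Q')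
    \<Longrightarrow> (step v ^^ j) f Q \<le> (step v ^^ j) g Q"
proof (induction j arbitrary: n Q)
  case (Suc j)
  show ?case unfolding funpow.simps o_apply
  proof (rule step_mono[OF v_nonneg Suc.prems(1)])
    fix Q' assume "Q' \<in> partial_partitions (Suc n)"
    then show "(step v ^^ j) f Q' \<le> (step v ^^ j) g Q'" using Suc.prems(2) by (intro Suc.IH) auto
  qed
qed simp

subsection \<open>Exponential moments of the number of free points\<close>

definition scarcity :: "real \<Rightarrow> real \<Rightarrow> ('p set \<times> 'm) set \<Rightarrow> real" where
  "scarcity x y Q = 1 / tilt x y (free Q)"

definition growth :: "real \<Rightarrow> real \<Rightarrow> real" where
  "growth x y = p * x ^ K + q * y ^ K"

definition bounded_growth :: "('p set \<Rightarrow> real) \<Rightarrow> bool" where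
  "bounded_growth v \<longleftrightarrow> (\<forall>e. 0 \<le> v e) \<and>
    (\<forall>x\<ge>1. \<forall>y\<ge>1. \<forall>Q. step v (scarcity x y) Q \<le> growth x y * scarcity x y Q)"

lemma growth_ge_1:
  assumes "1 \<le> x" "1 \<le> y"
  shows "1 \<le> growth x y"
proof -
  have "p * 1 + q * 1 \<le> p * x ^ K + q * y ^ K"
    using assms p_pos q_pos by (intro add_mono mult_left_mono one_le_power) auto
  then show ?thesis using p_add_q by (simp add: growth_def)
qed

lemma scarcity_nonneg: "0 \<le> x \<Longrightarrow> 0 \<le> y \<Longrightarrow> 0 \<le> scarcity x y Q"
  by (simp add: scarcity_def tilt_def)

lemma scarcity_insert:
  assumes "0 < x" "0 < y" "fst b \<subseteq> free Q"
  shows "scarcity x y (insert b Q) = tilt x y (fst b) * scarcity x y Q"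
proof -
  have "tilt x y (fst b) \<noteq> 0" using assms(1,2) by (simp add: tilt_def)
  then show ?thesis
    unfolding scarcity_def free_insert tilt_Diff[OF finite_free assms(3)] by simp
qed

lemma bounded_growth_global: "bounded_growth (\<lambda>_. 1)"
  unfolding bounded_growth_def
proof (intro conjI allI impI)
  fix x y :: real and Q :: "('p set \<times> 'm) set" assume xy_ge_1: "1 \<le> x" "1 \<le> y"
  let ?F = "free Q"
  have ratio: "w * z * (real n / real n) \<le> w * z" if "0 \<le> w" "0 \<le> z" for w z :: real and n
    using that by (cases "n = 0") auto
  have "global_step (scarcity x y) Q = (\<Sum>e\<in>[?F]\<^bsup>K\<^esup>. draw_weight ?F e * tilt x y e) * scarcity x y Q"
    using xy_ge_1 finite_A A_nonempty
    by (auto simp: step_def sum_distrib_right scarcity_insert nsets_def average_const intro!: sum.cong)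
  also have "\<dots> \<le> (p * x * (card (?F \<inter> S1) / card (?F \<inter> S1))
        + q * y * (card (?F \<inter> S2) / card (?F \<inter> S2))) ^ K * scarcity x y Q"
    using xy_ge_1 by (intro mult_right_mono sum_draw_weight_le free_subset scarcity_nonneg) auto
  also have "\<dots> \<le> (p * x + q * y) ^ K * scarcity x y Q"
    using xy_ge_1 p_pos q_pos by (intro mult_right_mono power_mono add_mono ratio scarcity_nonneg) auto
  also have "\<dots> \<le> growth x y * scarcity x y Q"
    unfolding growth_def using xy_ge_1 p_pos q_pos p_add_q
    by (intro mult_right_mono power_convex_combination scarcity_nonneg) auto
  finally show "global_step (scarcity x y) Q \<le> growth x y * scarcity x y Q" .
qed simp

lemma bounded_growth_split: "bounded_growth split_weight"
  unfolding bounded_growth_def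
proof (intro conjI allI impI split_weight_nonneg)
  fix x y :: real and Q :: "('p set \<times> 'm) set" assume xy_ge_1: "1 \<le> x" "1 \<le> y"
  have "average (blocks (free Q \<inter> S)) (\<lambda>b. scarcity x y (insert b Q)) \<le> w ^ K * scarcity x y Q"
    if w_power: "1 \<le> w" "\<And>e. e \<subseteq> S \<Longrightarrow> tilt x y e = w ^ card e" for S w
  proof (rule average_le)
    show "0 \<le> w ^ K * scarcity x y Q"
      using w_power(1) xy_ge_1 by (intro mult_nonneg_nonneg scarcity_nonneg) auto
    fix b assume "b \<in> blocks (free Q \<inter> S)"
    from blocksD[OF this] show "scarcity x y (insert b Q) \<le> w ^ K * scarcity x y Q"
      using xy_ge_1 w_power(2)[of "fst b"] by (simp add: scarcity_insert)
  qed simp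
  moreover have "tilt x y e = x ^ card e" if "e \<subseteq> S1" for e
  proof -
    have "e \<inter> S1 = e" "e \<inter> S2 = {}" using that disjoint_sides by auto
    then show ?thesis by (simp add: tilt_def)
  qed
  moreover have "tilt x y e = y ^ card e" if "e \<subseteq> S2" for e
  proof -
    have "e \<inter> S1 = {}" "e \<inter> S2 = e" using that disjoint_sides by auto
    then show ?thesis by (simp add: tilt_def)
  qed
  ultimately have "split_step (scarcity x y) Q
      \<le> p * (x ^ K * scarcity x y Q) + q * (y ^ K * scarcity x y Q)"
    unfolding split_step_average using xy_ge_1 p_pos q_pos by (intro add_mono mult_left_mono) auto
  then show "split_step (scarcity x y) Q \<le> growth x y * scarcity x y Q"
    by (simp add: growth_def algebra_simps)
qed

lemma step_one_le:
  assumes "bounded_growth v"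
  shows "step v (\<lambda>_. 1) Q \<le> 1"
proof -
  have "step v (scarcity 1 1) Q \<le> growth 1 1 * scarcity 1 1 Q"
    using assms by (simp add: bounded_growth_def)
  then show ?thesis by (simp add: scarcity_def[abs_def] tilt_def growth_def p_add_q)
qed

lemma step_pow_one_le:
  "bounded_growth v \<Longrightarrow> Q \<in> partial_partitions n \<Longrightarrow> (step v ^^ T) (\<lambda>_. 1) Q \<le> 1"
proof (induction T arbitrary: n Q)
  case (Suc T)
  have "step v ((step v ^^ T) (\<lambda>_. 1)) Q \<le> step v (\<lambda>_. 1) Q"
    using Suc by (intro step_mono) (auto simp: bounded_growth_def)
  then show ?case using step_one_le[OF Suc.prems(1), of Q] by simp
qed simp

lemma global_step_pow_le:
  assumes \<beta>_nonneg: "0 \<le> \<beta>"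
    and mean_le: "\<And>U. U \<subseteq> free Q \<Longrightarrow> card U = K * T \<Longrightarrow> partition_mean U (\<lambda>P. f (P \<union> Q)) \<le> \<beta>"
  shows "(global_step ^^ T) f Q \<le> \<beta>"
proof -
  let ?F = "free Q"
  have "(global_step ^^ T) f Q \<le> (\<Sum>U\<in>[?F]\<^bsup>(K * T)\<^esup>. draw_weight ?F U * \<beta>)"
    unfolding global_step_pow using mean_le
    by (intro sum_mono mult_left_mono draw_weight_nonneg) (auto simp: nsets_def)
  also have "\<dots> \<le> 1 * \<beta>"
    unfolding sum_distrib_right[symmetric]
  proof (rule mult_right_mono[OF _ \<beta>_nonneg])
    have side: "w * (real n / real n) \<le> w" if "0 \<le> w" for w :: real and n
      using that by (cases "n = 0") auto
    have "(\<Sum>U\<in>[?F]\<^bsup>(K * T)\<^esup>. draw_weight ?F U)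
        \<le> (p * (card (?F \<inter> S1) / card (?F \<inter> S1)) + q * (card (?F \<inter> S2) / card (?F \<inter> S2))) ^ (K * T)"
      using sum_draw_weight_le[OF free_subset[of Q] subset_refl, of 1 1 "K * T"] by (simp add: tilt_def)
    also have "\<dots> \<le> (p + q) ^ (K * T)" using p_pos q_pos by (intro power_mono add_mono side) auto
    finally show "(\<Sum>U\<in>[?F]\<^bsup>(K * T)\<^esup>. draw_weight ?F U) \<le> 1" using p_add_q by simp
  qed
  finally show ?thesis by simp
qed

end

section \<open>The interpolation inequality\<close>

context marked_blocks
begin

definition split_mean :: "'p set \<Rightarrow> 'p set \<Rightarrow> (('p set \<times> 'm) set \<Rightarrow> real) \<Rightarrow> real" where
  "split_mean F G \<phi> = partition_mean F (\<lambda>P. partition_mean G (\<lambda>R. \<phi> (P \<union> R)))"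

lemma split_mean_commute: "split_mean F G \<phi> = split_mean G F \<phi>"
  unfolding split_mean_def partition_mean_def by (subst average_commute) (simp add: Un_commute)

lemma split_mean_rec:
  assumes "finite F" "card F = K * Suc n"
  shows "split_mean F G \<phi> = average (blocks F) (\<lambda>b. split_mean (F - fst b) G (\<lambda>P. \<phi> (insert b P)))"
  using partition_mean_rec[OF assms, of "\<lambda>P. partition_mean G (\<lambda>R. \<phi> (P \<union> R))"]
  by (simp add: split_mean_def)

lemma split_mean_le:
  assumes "finite F" "finite G" "0 \<le> c"
    and "\<And>P R. P \<in> marked_partitions F \<Longrightarrow> R \<in> marked_partitions G \<Longrightarrow> \<phi> (P \<union> R) \<le> c"
  shows "split_mean F G \<phi> \<le> c"
  unfolding split_mean_def partition_mean_def using assms by (intro average_le) auto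

lemma split_mean_nonneg:
  "(\<And>P R. P \<in> marked_partitions F \<Longrightarrow> R \<in> marked_partitions G \<Longrightarrow> 0 \<le> \<phi> (P \<union> R)) \<Longrightarrow> 0 \<le> split_mean F G \<phi>"
  unfolding split_mean_def partition_mean_def by (intro average_nonneg)

end

locale interpolation = two_sides K A S1 S2 p q
  for K :: nat and A :: "'m set" and S1 S2 :: "'p set" and p q :: real +
  fixes \<Psi> :: "('p set \<times> 'm) set \<Rightarrow> real" and m :: nat and z :: real
  assumes \<Psi>_nonneg: "finite Q \<Longrightarrow> 0 \<le> \<Psi> Q"
    and \<Psi>_empty: "\<Psi> {} = 0"
    and \<Psi>_lipschitz: "insert_lipschitz 1 (blocks (S1 \<union> S2)) \<Psi>"
    and K_le_m: "K \<le> m" and z_ge_1: "1 \<le> z"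
    and split_le_global: "Q \<in> partial_partitions n \<Longrightarrow> m \<le> card (free Q \<inter> S1) \<Longrightarrow> m \<le> card (free Q \<inter> S2)
      \<Longrightarrow> split_step \<Psi> Q \<le> global_step \<Psi> Q + (real K)\<^sup>2 / m"
begin

definition max_blocks :: real where
  "max_blocks = real (card (S1 \<union> S2)) / real K"

text \<open>Dominates the indicator of fewer than m free points on one of the sides, and stays so in the mean if T
  steps are added.\<close>

definition overflow :: "nat \<Rightarrow> ('p set \<times> 'm) set \<Rightarrow> real" where
  "overflow T Q = z ^ m * growth z 1 ^ T * scarcity z 1 Q + z ^ m * growth 1 z ^ T * scarcity 1 z Q"

text \<open>A martingale for the split steps as long as both sides have free points; it is 0 if the free points of
  one of them cannot be partitioned into blocks.\<close>

definition completion_mean :: "('p set \<times> 'm) set \<Rightarrow> real" where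
  "completion_mean Q = split_mean (free Q \<inter> S1) (free Q \<inter> S2) (\<lambda>P. \<Psi> (P \<union> Q))"

lemma overflow_nonneg: "0 \<le> overflow T Q"
  unfolding overflow_def using z_ge_1 growth_ge_1[of z 1] growth_ge_1[of 1 z]
  by (intro add_nonneg_nonneg mult_nonneg_nonneg scarcity_nonneg) auto

lemma overflow_ge_1:
  assumes "\<not> (m \<le> card (free Q \<inter> S1) \<and> m \<le> card (free Q \<inter> S2))"
  shows "1 \<le> overflow 0 Q"
proof -
  have "z ^ c \<le> z ^ m" "0 < z ^ c" if "c < m" for c
    using that z_ge_1 by (auto intro: power_increasing)
  then have "1 \<le> z ^ m * scarcity z 1 Q \<or> 1 \<le> z ^ m * scarcity 1 z Q"
    using assms by (auto simp: scarcity_def tilt_def not_le le_divide_eq)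
  moreover have "0 \<le> z ^ m * scarcity z 1 Q" "0 \<le> z ^ m * scarcity 1 z Q"
    using z_ge_1 by (auto intro!: mult_nonneg_nonneg scarcity_nonneg)
  ultimately show ?thesis by (auto simp: overflow_def)
qed

lemma overflow_Suc_ge: "overflow T Q \<le> overflow (Suc T) Q"
  unfolding overflow_def using z_ge_1 growth_ge_1[of z 1] growth_ge_1[of 1 z]
  by (intro add_mono mult_right_mono mult_left_mono scarcity_nonneg power_increasing) auto

lemma step_overflow:
  assumes growth_v: "bounded_growth v"
  shows "step v (overflow T) Q \<le> overflow (Suc T) Q"
proof -
  have "step v (overflow T) Q
      = z ^ m * growth z 1 ^ T * step v (scarcity z 1) Q
      + z ^ m * growth 1 z ^ T * step v (scarcity 1 z) Q"
    unfolding overflow_def[abs_def] by (rule step_linear)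
  also have "\<dots> \<le> z ^ m * growth z 1 ^ T * (growth z 1 * scarcity z 1 Q)
      + z ^ m * growth 1 z ^ T * (growth 1 z * scarcity 1 z Q)"
    using growth_v z_ge_1 growth_ge_1[of z 1] growth_ge_1[of 1 z]
    by (intro add_mono mult_left_mono mult_nonneg_nonneg) (auto simp: bounded_growth_def)
  also have "\<dots> = overflow (Suc T) Q" by (simp add: overflow_def algebra_simps)
  finally show ?thesis .
qed

lemma step_pow_overflow:
  "bounded_growth v \<Longrightarrow> Q \<in> partial_partitions n \<Longrightarrow> (step v ^^ T) (overflow 0) Q \<le> overflow T Q"
proof (induction T arbitrary: n Q)
  case (Suc T)
  have "step v ((step v ^^ T) (overflow 0)) Q \<le> step v (overflow T) Q"
    using Suc by (intro step_mono) (auto simp: bounded_growth_def)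
  then show ?case using step_overflow[OF Suc.prems(1), of T Q] by simp
qed simp

lemma max_blocks_nonneg: "0 \<le> max_blocks"
  by (simp add: max_blocks_def)

lemma \<Psi>_le_max_blocks:
  assumes "Q \<in> partial_partitions n"
  shows "\<Psi> Q \<le> max_blocks - card (free Q) / K"
proof -
  note Q = partial_partitionsD[OF assms]
  have "real (card (free Q)) + real K * real n = real (card (S1 \<union> S2))"
    using Q(4) by (metis of_nat_add of_nat_mult)
  then have "real n = max_blocks - card (free Q) / K"
    using K_pos by (simp add: max_blocks_def field_simps)
  moreover have "\<bar>\<Psi> (Q \<union> {}) - \<Psi> {}\<bar> \<le> 1 * real (card Q)"
    using Q by (intro insert_lipschitz_Un_diff_le[OF \<Psi>_lipschitz]) auto
  ultimately show ?thesis using Q(2) \<Psi>_empty by simp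
qed

lemma split_le_global_overflow:
  assumes Q_partial: "Q \<in> partial_partitions n"
  shows "split_step \<Psi> Q \<le> global_step \<Psi> Q + ((real K)\<^sup>2 / m + max_blocks * overflow 0 Q)"
proof (cases "m \<le> card (free Q \<inter> S1) \<and> m \<le> card (free Q \<inter> S2)")
  case True
  then show ?thesis
    using split_le_global[OF Q_partial] mult_nonneg_nonneg[OF max_blocks_nonneg overflow_nonneg[of 0 Q]]
    by linarith
next
  case False
  have "split_step \<Psi> Q \<le> split_step (\<lambda>Q. max_blocks * 1 + 0 * 0) Q"
    using \<Psi>_le_max_blocks
    by (intro step_mono[OF split_weight_nonneg Q_partial])
      (smt (verit) divide_nonneg_nonneg of_nat_0_le_iff)
  also have "\<dots> = max_blocks * split_step (\<lambda>_. 1) Q" by (subst step_linear) simp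
  also have "\<dots> \<le> max_blocks * overflow 0 Q"
    using step_one_le[OF bounded_growth_split, of Q] overflow_ge_1[OF False] max_blocks_nonneg
    by (intro mult_left_mono) auto
  finally have "split_step \<Psi> Q \<le> max_blocks * overflow 0 Q" .
  moreover have "0 \<le> global_step \<Psi> Q"
    unfolding step_def using partial_partitionsD(1)[OF Q_partial] draw_weight_nonneg
    by (intro sum_nonneg mult_nonneg_nonneg average_nonneg \<Psi>_nonneg) auto
  moreover have "0 \<le> (real K)\<^sup>2 / m" by simp
  ultimately show ?thesis by linarith
qed

lemma split_pow_le_global_pow:
  "Q \<in> partial_partitions n \<Longrightarrow>
    (split_step ^^ T) \<Psi> Q \<le> (global_step ^^ T) \<Psi> Q + T * ((real K)\<^sup>2 / m + max_blocks * overflow T Q)"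
proof (induction T arbitrary: n Q)
  case (Suc T)
  define err where "err = (real K)\<^sup>2 / m"
  have err_nonneg: "0 \<le> err" by (simp add: err_def)
  have "(split_step ^^ Suc T) \<Psi> Q
      \<le> split_step (\<lambda>Q. 1 * (global_step ^^ T) \<Psi> Q + real T * (err * 1 + max_blocks * overflow T Q)) Q"
    using Suc.IH by (auto simp: err_def intro!: step_mono[OF split_weight_nonneg Suc.prems])
  also have "\<dots> = (global_step ^^ T) (split_step \<Psi>) Q
      + T * (err * split_step (\<lambda>_. 1) Q + max_blocks * split_step (overflow T) Q)"
    unfolding step_linear step_pow_commute by simp
  also have "\<dots> \<le> (global_step ^^ T) (split_step \<Psi>) Q + T * (err * 1 + max_blocks * overflow (Suc T) Q)"
    using err_nonneg max_blocks_nonneg bounded_growth_split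
    by (intro add_left_mono mult_left_mono add_mono step_one_le step_overflow) auto
  also have "(global_step ^^ T) (split_step \<Psi>) Q
      \<le> (global_step ^^ T) (\<lambda>Q. 1 * global_step \<Psi> Q + 1 * (err * 1 + max_blocks * overflow 0 Q)) Q"
    using split_le_global_overflow by (intro step_pow_mono[OF _ Suc.prems]) (auto simp: err_def)
  also have "\<dots> = (global_step ^^ Suc T) \<Psi> Q
      + (err * (global_step ^^ T) (\<lambda>_. 1) Q + max_blocks * (global_step ^^ T) (overflow 0) Q)"
    unfolding step_pow_linear by (simp add: funpow_swap1)
  also have "\<dots> \<le> (global_step ^^ Suc T) \<Psi> Q + (err * 1 + max_blocks * overflow (Suc T) Q)"
    using step_pow_one_le[OF bounded_growth_global Suc.prems, of T] err_nonneg max_blocks_nonneg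
      order_trans[OF step_pow_overflow[OF bounded_growth_global Suc.prems] overflow_Suc_ge[of T Q]]
    by (intro add_left_mono add_mono mult_left_mono) auto
  finally show ?case by (simp add: algebra_simps flip: err_def)
qed simp

lemma card_free_sides: "card (free Q \<inter> S1) + card (free Q \<inter> S2) = card (free Q)"
proof -
  have "free Q = (free Q \<inter> S1) \<union> (free Q \<inter> S2)" "(free Q \<inter> S1) \<inter> (free Q \<inter> S2) = {}"
    using disjoint_sides free_subset[of Q] by auto
  then show ?thesis by (metis card_Un_disjoint finite_Int finite_free)
qed

lemma completion_mean_nonneg: "finite Q \<Longrightarrow> 0 \<le> completion_mean Q"
  unfolding completion_mean_def
  by (intro split_mean_nonneg \<Psi>_nonneg) (auto dest: marked_partitions_finite)

lemma completion_mean_le: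
  assumes Q_partial: "Q \<in> partial_partitions n"
  shows "completion_mean Q \<le> \<Psi> Q + card (free Q) / K" "completion_mean Q \<le> max_blocks"
proof -
  let ?F = "free Q \<inter> S1" and ?G = "free Q \<inter> S2"
  have "\<Psi> (P \<union> R \<union> Q) \<le> \<Psi> Q + card (free Q) / K"
    if P_partition: "P \<in> marked_partitions ?F" and R_partition: "R \<in> marked_partitions ?G" for P R
  proof -
    have "K * (card P + card R) = card (free Q)"
      using card_marked_partition[OF P_partition] card_marked_partition[OF R_partition]
        card_free_sides[of Q]
      by (simp add: distrib_left)
    then have "card P + card R = card (free Q) / K"
      using K_pos by (simp add: field_simps flip: of_nat_add of_nat_mult)
    moreover have "card (P \<union> R) \<le> card P + card R" by (rule card_Un_le)
    moreover have "P \<union> R \<subseteq> blocks (S1 \<union> S2)"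
      using marked_partitions_subset[OF P_partition] marked_partitions_subset[OF R_partition]
        blocks_mono[of ?F "S1 \<union> S2"] blocks_mono[of ?G "S1 \<union> S2"] by blast
    then have "\<bar>\<Psi> ((P \<union> R) \<union> Q) - \<Psi> Q\<bar> \<le> 1 * real (card (P \<union> R))"
      using marked_partitions_finite[OF P_partition] marked_partitions_finite[OF R_partition]
        partial_partitionsD[OF Q_partial]
      by (intro insert_lipschitz_Un_diff_le[OF \<Psi>_lipschitz]) auto
    ultimately show ?thesis by linarith
  qed
  moreover have "0 \<le> \<Psi> Q + card (free Q) / K" using \<Psi>_nonneg partial_partitionsD(1)[OF Q_partial] by simp
  ultimately show completion_le: "completion_mean Q \<le> \<Psi> Q + card (free Q) / K"
    unfolding completion_mean_def by (intro split_mean_le) auto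
  show "completion_mean Q \<le> max_blocks" using completion_le \<Psi>_le_max_blocks[OF Q_partial] by linarith
qed

lemma completion_mean_martingale:
  shows "card (free Q \<inter> S1) = K * Suc k
      \<Longrightarrow> average (blocks (free Q \<inter> S1)) (\<lambda>b. completion_mean (insert b Q)) = completion_mean Q"
    and "card (free Q \<inter> S2) = K * Suc k
      \<Longrightarrow> average (blocks (free Q \<inter> S2)) (\<lambda>b. completion_mean (insert b Q)) = completion_mean Q"
proof -
  have side: "average (blocks (free Q \<inter> S)) (\<lambda>b.
        split_mean (free (insert b Q) \<inter> S) (free (insert b Q) \<inter> S') (\<lambda>P. \<Psi> (P \<union> insert b Q)))
      = split_mean (free Q \<inter> S) (free Q \<inter> S') (\<lambda>P. \<Psi> (P \<union> Q))"
    if card_side: "card (free Q \<inter> S) = K * Suc k" and disjoint: "S \<inter> S' = {}" for S S'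
  proof -
    have "split_mean (free Q \<inter> S) (free Q \<inter> S') (\<lambda>P. \<Psi> (P \<union> Q))
        = average (blocks (free Q \<inter> S))
          (\<lambda>b. split_mean (free Q \<inter> S - fst b) (free Q \<inter> S') (\<lambda>P. \<Psi> (insert b P \<union> Q)))"
      using card_side by (intro split_mean_rec) auto
    also have "\<dots> = average (blocks (free Q \<inter> S))
        (\<lambda>b. split_mean (free (insert b Q) \<inter> S) (free (insert b Q) \<inter> S') (\<lambda>P. \<Psi> (P \<union> insert b Q)))"
    proof (rule average_cong)
      fix b assume "b \<in> blocks (free Q \<inter> S)"
      then have "free (insert b Q) \<inter> S = free Q \<inter> S - fst b" "free (insert b Q) \<inter> S' = free Q \<inter> S'"
        using blocksD(1)[of b "free Q \<inter> S"] disjoint by (auto simp: free_insert)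
      then show "split_mean (free Q \<inter> S - fst b) (free Q \<inter> S') (\<lambda>P. \<Psi> (insert b P \<union> Q))
          = split_mean (free (insert b Q) \<inter> S) (free (insert b Q) \<inter> S') (\<lambda>P. \<Psi> (P \<union> insert b Q))" by simp
    qed
    finally show ?thesis ..
  qed
  show "average (blocks (free Q \<inter> S1)) (\<lambda>b. completion_mean (insert b Q)) = completion_mean Q"
    if "card (free Q \<inter> S1) = K * Suc k"
    unfolding completion_mean_def using side[OF that] disjoint_sides by simp
  show "average (blocks (free Q \<inter> S2)) (\<lambda>b. completion_mean (insert b Q)) = completion_mean Q"
    if "card (free Q \<inter> S2) = K * Suc k"
    unfolding completion_mean_def split_mean_commute[of "free _ \<inter> S1"]
    using side[OF that] disjoint_sides by (simp add: Int_commute)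
qed

lemma completion_mean_le_split_step:
  assumes Q_partial: "Q \<in> partial_partitions n"
  shows "completion_mean Q \<le> split_step completion_mean Q + max_blocks * overflow 0 Q"
proof -
  have step_nonneg: "0 \<le> split_step completion_mean Q"
    unfolding split_step_average using p_pos q_pos partial_partitionsD(1)[OF Q_partial]
    by (intro add_nonneg_nonneg mult_nonneg_nonneg average_nonneg completion_mean_nonneg) auto
  have err_nonneg: "0 \<le> max_blocks * overflow 0 Q" using max_blocks_nonneg overflow_nonneg by simp
  consider (scarce) "\<not> (m \<le> card (free Q \<inter> S1) \<and> m \<le> card (free Q \<inter> S2))"
    | (no_partition) "marked_partitions (free Q \<inter> S1) = {} \<or> marked_partitions (free Q \<inter> S2) = {}"
    | (partitions) P R where "m \<le> card (free Q \<inter> S1)" "m \<le> card (free Q \<inter> S2)"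
      "P \<in> marked_partitions (free Q \<inter> S1)" "R \<in> marked_partitions (free Q \<inter> S2)"
    by blast
  then show ?thesis
  proof cases
    case scarce
    then have "max_blocks * 1 \<le> max_blocks * overflow 0 Q"
      using max_blocks_nonneg by (intro mult_left_mono overflow_ge_1)
    then show ?thesis using completion_mean_le(2)[OF Q_partial] step_nonneg by linarith
  next
    case no_partition
    then have "completion_mean Q = 0"
      by (auto simp: completion_mean_def split_mean_def partition_mean_def average_def)
    then show ?thesis using step_nonneg err_nonneg by simp
  next
    case (partitions P R)
    then have sides: "card (free Q \<inter> S1) = K * card P" "card (free Q \<inter> S2) = K * card R"
      by (auto intro: card_marked_partition)
    then have "card P \<noteq> 0" "card R \<noteq> 0"
      using partitions(1,2) K_le_m K_pos by (metis mult_0_right not_one_le_zero order_trans)+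
    then obtain k k' where "card P = Suc k" "card R = Suc k'" using not0_implies_Suc by blast
    then have "split_step completion_mean Q = (p + q) * completion_mean Q"
      unfolding split_step_average
      using completion_mean_martingale(1)[of Q k] completion_mean_martingale(2)[of Q k'] sides
      by (simp add: distrib_right)
    then show ?thesis using p_add_q err_nonneg by simp
  qed
qed

lemma completion_mean_le_split_pow:
  "Q \<in> partial_partitions n
    \<Longrightarrow> completion_mean Q \<le> (split_step ^^ T) completion_mean Q + T * (max_blocks * overflow T Q)"
proof (induction T arbitrary: n Q)
  case (Suc T)
  have "split_step completion_mean Q
      \<le> split_step (\<lambda>Q. 1 * (split_step ^^ T) completion_mean Q + (T * max_blocks) * overflow T Q) Q"
    using Suc.IH by (auto simp: mult.assoc intro!: step_mono[OF split_weight_nonneg Suc.prems])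
  also have "\<dots> = (split_step ^^ Suc T) completion_mean Q + (T * max_blocks) * split_step (overflow T) Q"
    unfolding step_linear by simp
  also have "\<dots> \<le> (split_step ^^ Suc T) completion_mean Q + (T * max_blocks) * overflow (Suc T) Q"
    using bounded_growth_split max_blocks_nonneg
    by (intro add_left_mono mult_left_mono step_overflow) auto
  finally have "split_step completion_mean Q \<le> (split_step ^^ Suc T) completion_mean Q
      + T * (max_blocks * overflow (Suc T) Q)"
    by (simp add: mult.assoc)
  moreover have "max_blocks * overflow 0 Q \<le> max_blocks * overflow (Suc T) Q"
    using max_blocks_nonneg lift_Suc_mono_le[of "\<lambda>T. overflow T Q" 0 "Suc T"] overflow_Suc_ge
    by (intro mult_left_mono) auto
  ultimately show ?case using completion_mean_le_split_step[OF Suc.prems] by (simp add: algebra_simps)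
qed simp

theorem split_mean_le_partition_mean:
  assumes card_sides: "card (S1 \<union> S2) = K * (T + d)"
  shows "split_mean S1 S2 \<Psi>
    \<le> partition_mean (S1 \<union> S2) \<Psi> + (1 + 3 * real K) * real d
    + T * ((real K)\<^sup>2 / m + 2 * max_blocks * overflow T {})"
proof -
  have finite_Un_sides: "finite (S1 \<union> S2)" using finite_sides by simp
  have "(S1 \<union> S2) \<inter> S1 = S1" "(S1 \<union> S2) \<inter> S2 = S2" by auto
  then have start: "completion_mean {} = split_mean S1 S2 \<Psi>" by (simp add: completion_mean_def)
  have "(split_step ^^ T) completion_mean {} \<le> (split_step ^^ T) (\<lambda>Q. 1 * \<Psi> Q + real d * 1) {}"
  proof (rule step_pow_mono[OF split_weight_nonneg partial_partitions_empty])
    fix Q assume Q_partial: "Q \<in> partial_partitions (0 + T)"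
    then have "card (free Q) = K * d"
      using partial_partitionsD(4)[OF Q_partial] card_sides by (simp add: algebra_simps)
    then show "completion_mean Q \<le> 1 * \<Psi> Q + real d * 1"
      using completion_mean_le(1)[OF Q_partial] K_pos by simp
  qed
  also have "\<dots> \<le> (split_step ^^ T) \<Psi> {} + real d * 1"
    unfolding step_pow_linear
    using step_pow_one_le[OF bounded_growth_split partial_partitions_empty, of T]
    by (intro add_mono mult_left_mono) auto
  finally have split_pow_completion_le: "(split_step ^^ T) completion_mean {}
      \<le> (split_step ^^ T) \<Psi> {} + d" by simp
  have "(global_step ^^ T) \<Psi> {} \<le> partition_mean (S1 \<union> S2) \<Psi> + 3 * (1::real) * K * d"
  proof (rule global_step_pow_le)
    show "0 \<le> partition_mean (S1 \<union> S2) \<Psi> + 3 * (1::real) * K * d"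
      unfolding partition_mean_def using marked_partitions_finite[OF _ finite_Un_sides]
      by (intro add_nonneg_nonneg average_nonneg \<Psi>_nonneg) auto
    fix U assume "U \<subseteq> free {}" "card U = K * T"
    then show "partition_mean U (\<lambda>P. \<Psi> (P \<union> {})) \<le> partition_mean (S1 \<union> S2) \<Psi> + 3 * (1::real) * K * d"
      using partition_mean_subset_le[OF finite_Un_sides _ _ card_sides \<Psi>_lipschitz] by simp
  qed
  then show ?thesis
    using completion_mean_le_split_pow[OF partial_partitions_empty, of T] split_pow_completion_le
      split_pow_le_global_pow[OF partial_partitions_empty, of T] unfolding start
    by (simp add: algebra_simps)
qed

lemma overflow_empty:
  "overflow T {} = z ^ m * (p * z ^ K + q) ^ T / z ^ card S1 + z ^ m * (p + q * z ^ K) ^ T / z ^ card S2"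
proof -
  have "(S1 \<union> S2) \<inter> S1 = S1" "(S1 \<union> S2) \<inter> S2 = S2" by auto
  then show ?thesis by (simp add: overflow_def scarcity_def tilt_def growth_def)
qed

end

section \<open>Spin models\<close>

lemma sum_le_of_threshold_sums_le:
  fixes \<alpha> w :: "'i \<Rightarrow> real"
  assumes finite_I: "finite I" and w_bounds: "\<And>i. i \<in> I \<Longrightarrow> 0 \<le> w i" "\<And>i. i \<in> I \<Longrightarrow> w i \<le> 1"
    and E_nonneg: "0 \<le> E"
    and threshold: "\<And>t. 0 \<le> t \<Longrightarrow> t < 1 \<Longrightarrow> (\<Sum>i\<in>I. \<alpha> i * of_bool (t < w i)) \<le> E"
  shows "(\<Sum>i\<in>I. \<alpha> i * w i) \<le> E"
proof (rule has_integral_le)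
  have "((\<lambda>t. of_bool (t < c) :: real) has_integral c) {0..1}" if "0 \<le> c" "c \<le> 1" for c :: real
  proof -
    have "((\<lambda>t. 1 :: real) has_integral c) {0..c}"
      using has_integral_const_real[of "1::real" 0 c] that by simp
    then have "((\<lambda>t. if t \<in> {0..c} then 1 else 0 :: real) has_integral c) {0..1}"
      using that by (subst has_integral_restrict) auto
    then show ?thesis
      by (rule has_integral_spike_finite[rotated 2, of _ _ _ "{c}"]) auto
  qed
  then show "((\<lambda>t. \<Sum>i\<in>I. \<alpha> i * of_bool (t < w i)) has_integral (\<Sum>i\<in>I. \<alpha> i * w i)) {0..1}"
    using w_bounds by (intro has_integral_sum finite_I has_integral_mult_right) auto
  show "((\<lambda>t. E) has_integral E) {0..1::real}"
    using has_integral_const_real[of E 0 1] by simp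
  fix t :: real assume t_bounds: "t \<in> {0..1}"
  show "(\<Sum>i\<in>I. \<alpha> i * of_bool (t < w i)) \<le> E"
  proof (cases "t < 1")
    case False
    then have "(\<Sum>i\<in>I. \<alpha> i * of_bool (t < w i)) = 0"
      using w_bounds(2) t_bounds by (intro sum.neutral ballI) (simp add: not_less order_antisym_conv)
    then show ?thesis using E_nonneg by simp
  qed (use threshold t_bounds in auto)
qed

lemma length_edge_nodes: "finite e \<Longrightarrow> length (edge_nodes r e) = card e"
  by (simp add: edge_nodes_def)

lemma set_edge_nodes: "finite e \<Longrightarrow> set (edge_nodes r e) = (\<lambda>p. p div r) ` e"
  by (simp add: edge_nodes_def)

lemma edge_nodes_shift:
  assumes "finite e" "1 \<le> r"
  shows "edge_nodes r ((+) (N * r) ` e) = map ((+) N) (edge_nodes r e)"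
proof -
  have "sorted_list_of_set ((+) c ` e) = map ((+) c) (sorted_list_of_set e)" for c
    using assms(1) by (intro sorted_distinct_set_unique) (auto simp: sorted_wrt_map distinct_map)
  then show ?thesis using assms(2) by (simp add: edge_nodes_def)
qed

abbreviation signs :: "nat \<Rightarrow> bool list set" where
  "signs K \<equiv> {a. length a = K}"

lemma finite_signs: "finite (signs K)" and card_signs: "card (signs K) = 2 ^ K"
  using finite_lists_length_eq[of "UNIV :: bool set" K] card_lists_length_eq[of "UNIV :: bool set" K]
  by auto

text \<open>This is what convexity is applied to: for every set X of assignments, the number of sign vectors for
  which the edge e is violated by all of X is, up to a constant, the indicator of e lying in one class of a
  partial equivalence relation.\<close>

definition violations_mutually_related :: "nat \<Rightarrow> nat \<Rightarrow> (bool list \<Rightarrow> nat list \<Rightarrow> bool) \<Rightarrow> bool" where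
  "violations_mutually_related K q bad \<longleftrightarrow> (\<forall>(V :: nat set) X. X \<noteq> {} \<longrightarrow> X \<subseteq> PiE V (\<lambda>_. {..<q}) \<longrightarrow>
    (\<exists>(k::nat) R. k \<le> 2 ^ K \<and> symp R \<and> transp R \<and> (\<forall>e. length e = K \<longrightarrow> set e \<subseteq> V \<longrightarrow>
      card {a \<in> signs K. \<forall>x\<in>X. bad a (map x e)} = k * of_bool (mutually_related R (set e)))))"

locale spin_model =
  fixes K q r :: nat and \<nu> :: "nat \<Rightarrow> real" and bad :: "bool list \<Rightarrow> nat list \<Rightarrow> bool"
  assumes K_ge_1: "1 \<le> K" and q_pos: "1 \<le> q" and r_pos: "1 \<le> r"
    and violations_mutually_related: "violations_mutually_related K q bad"

sublocale spin_model \<subseteq> marked_blocks K "signs K"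
proof
  show "signs K \<noteq> {}" using card_signs[of K] by (metis card.empty power_not_zero zero_neq_numeral)
qed (use K_ge_1 finite_signs in auto)

context spin_model
begin

definition assignments :: "nat set \<Rightarrow> (nat \<Rightarrow> nat) set" where
  "assignments V = PiE V (\<lambda>_. {..<q})"

definition satisfied :: "nat set \<times> bool list \<Rightarrow> (nat \<Rightarrow> nat) \<Rightarrow> real" where
  "satisfied b x = of_bool (\<not> bad (snd b) (map x (edge_nodes r (fst b))))"

definition energy :: "nat set \<Rightarrow> (nat set \<times> bool list) set \<Rightarrow> (nat \<Rightarrow> nat) \<Rightarrow> real" where
  "energy V Q x = (\<Sum>i\<in>V. \<nu> (x i)) + (\<Sum>b\<in>Q. satisfied b x)"

definition max_energy :: "nat set \<Rightarrow> (nat set \<times> bool list) set \<Rightarrow> real" where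
  "max_energy V Q = Max (energy V Q ` assignments V)"

definition energy_gain :: "nat set \<Rightarrow> (nat set \<times> bool list) set \<Rightarrow> real" where
  "energy_gain V Q = max_energy V Q - max_energy V {}"

lemma finite_assignments: "finite V \<Longrightarrow> finite (assignments V)"
  unfolding assignments_def by (rule finite_PiE) auto

lemma assignments_nonempty: "assignments V \<noteq> {}"
  unfolding assignments_def using q_pos by (auto simp: PiE_eq_empty_iff lessThan_empty_iff)

lemma energy_le_max_energy: "finite V \<Longrightarrow> x \<in> assignments V \<Longrightarrow> energy V Q x \<le> max_energy V Q"
  unfolding max_energy_def by (intro Max_ge) (auto simp: finite_assignments)

lemma max_energy_le: "finite V \<Longrightarrow> (\<And>x. x \<in> assignments V \<Longrightarrow> energy V Q x \<le> c) \<Longrightarrow> max_energy V Q \<le> c"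
  unfolding max_energy_def using assignments_nonempty[of V]
  by (intro Max.boundedI) (auto simp: finite_assignments)

lemma max_energy_attained:
  assumes "finite V"
  obtains x where "x \<in> assignments V" "energy V Q x = max_energy V Q"
proof -
  have "max_energy V Q \<in> energy V Q ` assignments V"
    unfolding max_energy_def using assignments_nonempty[of V]
    by (intro Max_in) (auto simp: finite_assignments assms)
  then show ?thesis using that by force
qed

lemma satisfied_bounds: "0 \<le> satisfied b x" "satisfied b x \<le> 1"
  by (auto simp: satisfied_def)

lemma energy_insert: "finite Q \<Longrightarrow> b \<notin> Q \<Longrightarrow> energy V (insert b Q) x = energy V Q x + satisfied b x"
  by (simp add: energy_def)

lemma max_energy_insert:
  assumes finite_V: "finite V" and finite_Q: "finite Q"
  shows "max_energy V Q \<le> max_energy V (insert b Q)" "max_energy V (insert b Q) \<le> max_energy V Q + 1"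
proof -
  have "energy V Q x \<le> energy V (insert b Q) x" "energy V (insert b Q) x \<le> energy V Q x + 1" for x
    using energy_insert[OF finite_Q, of b V x] satisfied_bounds[of b x]
    by (cases "b \<in> Q"; simp add: insert_absorb)+
  then show "max_energy V Q \<le> max_energy V (insert b Q)" "max_energy V (insert b Q) \<le> max_energy V Q + 1"
    using energy_le_max_energy[OF finite_V]
    by (intro max_energy_le[OF finite_V]; meson add_right_mono order_trans)+
qed

lemma energy_gain_lipschitz:
  assumes "finite V"
  shows "insert_lipschitz 1 X (energy_gain V)"
  unfolding insert_lipschitz_def energy_gain_def
proof (intro allI impI)
  fix Q b assume "finite (Q :: (nat set \<times> bool list) set)"
  from max_energy_insert[OF assms this, of b]
  show "\<bar>max_energy V (insert b Q) - max_energy V {} - (max_energy V Q - max_energy V {})\<bar> \<le> 1" by simp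
qed

lemma energy_gain_empty [simp]: "energy_gain V {} = 0"
  by (simp add: energy_gain_def)

lemma energy_gain_nonneg:
  assumes "finite V"
  shows "0 \<le> energy_gain V Q"
proof -
  have "energy V {} x \<le> energy V Q x" for x by (simp add: energy_def sum_nonneg satisfied_bounds)
  then show ?thesis
    using max_energy_le[OF assms, of "{}"] energy_le_max_energy[OF assms, of _ Q]
    unfolding energy_gain_def by (meson diff_ge_0_iff_ge order_trans)
qed

subsection \<open>The convexity step\<close>

definition insertion_loss :: "nat set \<Rightarrow> (nat set \<times> bool list) set \<Rightarrow> nat set \<times> bool list \<Rightarrow> real" where
  "insertion_loss V Q b = max_energy V Q + 1 - max_energy V (insert b Q)"

lemma insertion_loss_gt_iff:
  assumes finite_V: "finite V" and finite_Q: "finite Q" and b_new: "b \<notin> Q" and t_bounds: "0 \<le> t" "t < 1"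
  shows "t < insertion_loss V Q b \<longleftrightarrow>
    (\<forall>x\<in>{x \<in> assignments V. max_energy V Q - t \<le> energy V Q x}.
      bad (snd b) (map x (edge_nodes r (fst b))))"
proof -
  have "t < insertion_loss V Q b \<longleftrightarrow> max_energy V (insert b Q) < max_energy V Q + 1 - t"
    unfolding insertion_loss_def by linarith
  also have "\<dots> \<longleftrightarrow> (\<forall>x\<in>assignments V. energy V (insert b Q) x < max_energy V Q + 1 - t)"
    unfolding max_energy_def[of V "insert b Q"]
    using finite_assignments[OF finite_V] assignments_nonempty[of V] by (subst Max_less_iff) auto
  also have "\<dots> \<longleftrightarrow> (\<forall>x\<in>assignments V. max_energy V Q - t \<le> energy V Q x
        \<longrightarrow> bad (snd b) (map x (edge_nodes r (fst b))))"
  proof (intro ball_cong refl)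
    fix x assume "x \<in> assignments V"
    then have "energy V Q x \<le> max_energy V Q" by (rule energy_le_max_energy[OF finite_V])
    then show "(energy V (insert b Q) x < max_energy V Q + 1 - t)
        = (max_energy V Q - t \<le> energy V Q x \<longrightarrow> bad (snd b) (map x (edge_nodes r (fst b))))"
      using t_bounds unfolding energy_insert[OF finite_Q b_new] satisfied_def by auto
  qed
  finally show ?thesis by auto
qed

lemma card_signs_insertion_loss_gt:
  assumes finite_V: "finite V" and finite_Q: "finite Q" and t_bounds: "0 \<le> t" "t < 1"
    and points_of_F: "\<And>p. p \<in> F \<Longrightarrow> p div r \<in> V" "\<And>b. b \<in> blocks F \<Longrightarrow> b \<notin> Q"
  obtains k :: nat and R where "k \<le> 2 ^ K" "symp R" "transp R"
    "\<And>e. e \<in> [F]\<^bsup>K\<^esup> \<Longrightarrow> card {a \<in> signs K. t < insertion_loss V Q (e, a)}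
        = k * of_bool (mutually_related R e)"
proof -
  define X where "X = {x \<in> assignments V. max_energy V Q - t \<le> energy V Q x}"
  obtain x where "x \<in> assignments V" "energy V Q x = max_energy V Q"
    using max_energy_attained[OF finite_V] .
  then have "X \<noteq> {}" "X \<subseteq> PiE V (\<lambda>_. {..<q})" using t_bounds by (auto simp: X_def assignments_def)
  then obtain k R where k_le: "k \<le> 2 ^ K" and R_sym_trans: "symp R" "transp R"
    and card_violated: "\<And>e. length e = K \<Longrightarrow> set e \<subseteq> V \<Longrightarrow>
        card {a \<in> signs K. \<forall>x\<in>X. bad a (map x e)} = k * of_bool (mutually_related R (set e))"
    using violations_mutually_related[unfolded violations_mutually_related_def, rule_format, of X V]
    by blast
  show ?thesis
  proof (rule that[OF k_le])
    show "symp (\<lambda>p p'. R (p div r) (p' div r))" "transp (\<lambda>p p'. R (p div r) (p' div r))"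
      using R_sym_trans unfolding symp_def transp_def by blast+
    fix e assume "e \<in> [F]\<^bsup>K\<^esup>"
    then have e: "e \<subseteq> F" "finite e" "card e = K" by (auto simp: nsets_def)
    have losing: "{a \<in> signs K. t < insertion_loss V Q (e, a)}
        = {a \<in> signs K. \<forall>x\<in>X. bad a (map x (edge_nodes r e))}"
      using e points_of_F(2) insertion_loss_gt_iff[OF finite_V finite_Q _ t_bounds]
      by (auto simp: X_def blocks_def nsets_def)
    have "card {a \<in> signs K. t < insertion_loss V Q (e, a)}
        = k * of_bool (mutually_related R (set (edge_nodes r e)))"
      unfolding losing using e points_of_F(1)
      by (intro card_violated) (auto simp: length_edge_nodes set_edge_nodes)
    then show "card {a \<in> signs K. t < insertion_loss V Q (e, a)}
        = k * of_bool (mutually_related (\<lambda>p p'. R (p div r) (p' div r)) e)"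
      using e(2) by (simp add: set_edge_nodes mutually_related_def)
  qed
qed

end

locale spin_sides = spin_model K q r \<nu> bad + two_sides K "signs K" S1 S2 p p'
  for K q r :: nat and \<nu> :: "nat \<Rightarrow> real" and bad :: "bool list \<Rightarrow> nat list \<Rightarrow> bool"
    and S1 S2 :: "nat set" and p p' :: real +
  fixes V :: "nat set" and m :: nat and z :: real
  assumes finite_V: "finite V" and nodes_in_V: "x \<in> S1 \<union> S2 \<Longrightarrow> x div r \<in> V" and K_le_m: "K \<le> m"
    and z_ge_1: "1 \<le> z"
begin

lemma sum_insertion_loss_gt_le:
  assumes Q_partial: "Q \<in> partial_partitions n"
    and m_bounds: "m \<le> card (free Q \<inter> S1)" "m \<le> card (free Q \<inter> S2)"
    and t_bounds: "0 \<le> t" "t < 1"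
  shows "(\<Sum>e\<in>[free Q]\<^bsup>K\<^esup>. draw_weight (free Q) e * (1 - split_weight e) *
    average (signs K) (\<lambda>a. of_bool (t < insertion_loss V Q (e, a)))) \<le> (real K)\<^sup>2 / m"
proof -
  define \<beta> where "\<beta> e = draw_weight (free Q) e * (1 - split_weight e)" for e
  obtain k :: nat and R where k_le: "k \<le> 2 ^ K" and R_sym_trans: "symp R" "transp R"
    and card_eq: "\<And>e. e \<in> [free Q]\<^bsup>K\<^esup> \<Longrightarrow>
        card {a \<in> signs K. t < insertion_loss V Q (e, a)} = k * of_bool (mutually_related R e)"
    using card_signs_insertion_loss_gt[OF finite_V partial_partitionsD(1)[OF Q_partial] t_bounds,
        of "free Q"]
      nodes_in_V free_subset partial_partitions_insert(2)[OF Q_partial]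
    by blast
  have "(\<Sum>e\<in>[free Q]\<^bsup>K\<^esup>. \<beta> e * average (signs K) (\<lambda>a. of_bool (t < insertion_loss V Q (e, a))))
      = (\<Sum>e\<in>[free Q]\<^bsup>K\<^esup>. \<beta> e * (real k / 2 ^ K * of_bool (mutually_related R e)))"
  proof (intro sum.cong refl arg_cong2[where f = "(*)"])
    fix e assume e_nset: "e \<in> [free Q]\<^bsup>K\<^esup>"
    have "average (signs K) (\<lambda>a. of_bool (t < insertion_loss V Q (e, a)))
        = real (card {a \<in> signs K. t < insertion_loss V Q (e, a)}) / 2 ^ K"
      using finite_signs[of K]
      by (simp add: average_def card_signs sum.inter_filter[symmetric] of_bool_def)
    then show "average (signs K) (\<lambda>a. of_bool (t < insertion_loss V Q (e, a)))
        = real k / 2 ^ K * of_bool (mutually_related R e)"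
      unfolding card_eq[OF e_nset] by simp
  qed
  also have "\<dots> = real k / 2 ^ K * (\<Sum>e\<in>{e \<in> [free Q]\<^bsup>K\<^esup>. mutually_related R e}. \<beta> e)"
    by (simp add: sum.inter_filter finite_imp_finite_nsets sum_distrib_left if_distrib of_bool_def
        mult.commute cong: if_cong)
  also have "\<dots> \<le> real k / 2 ^ K * ((real K)\<^sup>2 / m)"
    unfolding \<beta>_def
    by (intro mult_left_mono
        global_minus_split_mutually_related_le[OF free_subset K_le_m m_bounds R_sym_trans]) simp
  also have "\<dots> \<le> 1 * ((real K)\<^sup>2 / m)"
    using of_nat_mono[OF k_le, where 'a = real] by (intro mult_right_mono) auto
  finally show ?thesis by (simp add: \<beta>_def)
qed

lemma sum_insertion_loss_le:
  assumes Q_partial: "Q \<in> partial_partitions n"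
    and "m \<le> card (free Q \<inter> S1)" "m \<le> card (free Q \<inter> S2)"
  shows "(\<Sum>e\<in>[free Q]\<^bsup>K\<^esup>. draw_weight (free Q) e * (1 - split_weight e) *
    average (signs K) (\<lambda>a. insertion_loss V Q (e, a))) \<le> (real K)\<^sup>2 / m"
proof -
  define \<beta> where "\<beta> e = draw_weight (free Q) e * (1 - split_weight e)" for e
  have average_signs: "(\<Sum>e\<in>[free Q]\<^bsup>K\<^esup>. \<beta> e * average (signs K) (\<lambda>a. f (e, a)))
      = (\<Sum>b\<in>blocks (free Q). \<beta> (fst b) / 2 ^ K * f b)" for f
    unfolding blocks_def average_def card_signs
    by (simp add: sum_distrib_left sum_divide_distrib sum.cartesian_product case_prod_unfold)
  have "(\<Sum>b\<in>blocks (free Q). \<beta> (fst b) / 2 ^ K * insertion_loss V Q b) \<le> (real K)\<^sup>2 / m"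
  proof (rule sum_le_of_threshold_sums_le)
    show "0 \<le> insertion_loss V Q b" "insertion_loss V Q b \<le> 1" for b
      using max_energy_insert[OF finite_V partial_partitionsD(1)[OF Q_partial], of b]
      by (simp_all add: insertion_loss_def)
    show "(\<Sum>b\<in>blocks (free Q). \<beta> (fst b) / 2 ^ K * of_bool (t < insertion_loss V Q b)) \<le> (real K)\<^sup>2 / m"
      if "0 \<le> t" "t < 1" for t
      using sum_insertion_loss_gt_le[OF assms that]
        average_signs[of "\<lambda>b. of_bool (t < insertion_loss V Q b)"]
      by (simp add: \<beta>_def)
  qed auto
  then show ?thesis unfolding average_signs[symmetric] by (simp add: \<beta>_def)
qed

lemma split_le_global_energy_gain:
  assumes "Q \<in> partial_partitions n"
    and m_bounds: "m \<le> card (free Q \<inter> S1)" "m \<le> card (free Q \<inter> S2)"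
  shows "split_step (energy_gain V) Q \<le> global_step (energy_gain V) Q + (real K)\<^sup>2 / m"
proof -
  define \<beta> where "\<beta> e = draw_weight (free Q) e * (1 - split_weight e)" for e
  let ?L = "\<lambda>e. average (signs K) (\<lambda>a. insertion_loss V Q (e, a))"
  have gain: "average (signs K) (\<lambda>a. energy_gain V (insert (e, a) Q)) = energy_gain V Q + 1 - ?L e" for e
    using finite_A A_nonempty
    by (simp add: energy_gain_def insertion_loss_def average_diff average_add average_const)
  have "global_step (energy_gain V) Q - split_step (energy_gain V) Q
      = (\<Sum>e\<in>[free Q]\<^bsup>K\<^esup>. \<beta> e * (energy_gain V Q + 1 - ?L e))"
    unfolding step_def gain by (simp add: \<beta>_def sum_subtractf[symmetric] algebra_simps)
  also have "\<dots> = (\<Sum>e\<in>[free Q]\<^bsup>K\<^esup>. \<beta> e) * (energy_gain V Q + 1) - (\<Sum>e\<in>[free Q]\<^bsup>K\<^esup>. \<beta> e * ?L e)"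
    by (simp add: right_diff_distrib sum_subtractf sum_distrib_right)
  also have "(\<Sum>e\<in>[free Q]\<^bsup>K\<^esup>. \<beta> e) = 0"
    unfolding \<beta>_def using m_bounds K_le_m by (intro sum_global_minus_split_eq_0 free_subset) auto
  finally show ?thesis using sum_insertion_loss_le[OF assms] by (simp add: \<beta>_def)
qed

sublocale interpolation K "signs K" S1 S2 p p' "energy_gain V" m z
  using energy_gain_nonneg[OF finite_V] energy_gain_lipschitz[OF finite_V] K_le_m z_ge_1
    split_le_global_energy_gain
  by unfold_locales auto

end

section \<open>Convergence of the mean\<close>

context spin_model
begin

definition on_nodes :: "nat set \<Rightarrow> (nat set \<times> bool list) set \<Rightarrow> bool" where
  "on_nodes V Q \<longleftrightarrow> (\<forall>b\<in>Q. set (edge_nodes r (fst b)) \<subseteq> V)"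

definition mean_gain :: "nat \<Rightarrow> real" where
  "mean_gain N = partition_mean {..<N * r} (energy_gain {..<N})"

lemma on_nodes_empty [simp]: "on_nodes V {}"
  by (simp add: on_nodes_def)

lemma on_nodes_blocks:
  assumes "Q \<subseteq> blocks F" "\<And>p. p \<in> F \<Longrightarrow> p div r \<in> V"
  shows "on_nodes V Q"
  unfolding on_nodes_def
proof
  fix b assume "b \<in> Q"
  then have "b \<in> blocks F" using assms(1) by blast
  from blocksD[OF this] show "set (edge_nodes r (fst b)) \<subseteq> V"
    using assms(2) by (auto simp: set_edge_nodes)
qed

lemma on_nodes_marked_partitions: "Q \<in> marked_partitions {..<N * r} \<Longrightarrow> on_nodes {..<N} Q"
  by (rule on_nodes_blocks[OF marked_partitions_subset]) (auto intro: less_mult_imp_div_less)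

lemma energy_cong:
  assumes "\<And>i. i \<in> V \<Longrightarrow> x i = y i" "on_nodes V Q"
  shows "energy V Q x = energy V Q y"
proof -
  have "map x (edge_nodes r (fst b)) = map y (edge_nodes r (fst b))" if "b \<in> Q" for b
    using assms that by (auto simp: on_nodes_def)
  then have "satisfied b x = satisfied b y" if "b \<in> Q" for b
    using that unfolding satisfied_def by presburger
  then show ?thesis using assms(1) by (simp add: energy_def)
qed

lemma max_energy_disjoint_union:
  assumes nodes: "finite V1" "finite V2" "V1 \<inter> V2 = {}"
    and edges: "finite Q1" "finite Q2" "Q1 \<inter> Q2 = {}" "on_nodes V1 Q1" "on_nodes V2 Q2"
  shows "max_energy (V1 \<union> V2) (Q1 \<union> Q2) = max_energy V1 Q1 + max_energy V2 Q2"
proof (rule antisym)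
  have finite_nodes: "finite (V1 \<union> V2)" using nodes by simp
  have split: "energy (V1 \<union> V2) (Q1 \<union> Q2) x = energy V1 Q1 x + energy V2 Q2 x" for x
    using nodes edges by (simp add: energy_def sum.union_disjoint)
  show "max_energy (V1 \<union> V2) (Q1 \<union> Q2) \<le> max_energy V1 Q1 + max_energy V2 Q2"
  proof (rule max_energy_le[OF finite_nodes])
    fix x assume x_assignment: "x \<in> assignments (V1 \<union> V2)"
    have "energy V1 Q1 x = energy V1 Q1 (restrict x V1)" "energy V2 Q2 x = energy V2 Q2 (restrict x V2)"
      using edges by (auto intro!: energy_cong)
    moreover have "restrict x V1 \<in> assignments V1" "restrict x V2 \<in> assignments V2"
      using x_assignment by (auto simp: assignments_def)
    ultimately show "energy (V1 \<union> V2) (Q1 \<union> Q2) x \<le> max_energy V1 Q1 + max_energy V2 Q2"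
      unfolding split using energy_le_max_energy[OF nodes(1)] energy_le_max_energy[OF nodes(2)]
      by (simp add: add_mono)
  qed
  obtain x1 where x1: "x1 \<in> assignments V1" "energy V1 Q1 x1 = max_energy V1 Q1"
    using max_energy_attained[OF nodes(1)] .
  obtain x2 where x2: "x2 \<in> assignments V2" "energy V2 Q2 x2 = max_energy V2 Q2"
    using max_energy_attained[OF nodes(2)] .
  define x where "x i = (if i \<in> V1 then x1 i else x2 i)" for i
  have "x \<in> assignments (V1 \<union> V2)"
    using x1 x2 unfolding assignments_def PiE_def extensional_def Pi_def x_def by auto
  then have "energy (V1 \<union> V2) (Q1 \<union> Q2) x \<le> max_energy (V1 \<union> V2) (Q1 \<union> Q2)"
    by (rule energy_le_max_energy[OF finite_nodes])
  moreover have "energy V1 Q1 x = energy V1 Q1 x1" using edges by (intro energy_cong) (auto simp: x_def)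
  moreover have "energy V2 Q2 x = energy V2 Q2 x2"
    using edges nodes by (intro energy_cong) (auto simp: x_def)
  ultimately show "max_energy V1 Q1 + max_energy V2 Q2 \<le> max_energy (V1 \<union> V2) (Q1 \<union> Q2)"
    using split x1 x2 by simp
qed

lemma energy_gain_disjoint_union:
  assumes "finite V1" "finite V2" "V1 \<inter> V2 = {}"
    and "finite Q1" "finite Q2" "Q1 \<inter> Q2 = {}" "on_nodes V1 Q1" "on_nodes V2 Q2"
  shows "energy_gain (V1 \<union> V2) (Q1 \<union> Q2) = energy_gain V1 Q1 + energy_gain V2 Q2"
  using max_energy_disjoint_union[OF assms] max_energy_disjoint_union[OF assms(1-3), of "{}" "{}"]
  by (simp add: energy_gain_def)

lemma energy_shift:
  assumes finite_edges: "\<And>b. b \<in> Q \<Longrightarrow> finite (fst b)"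
  shows "energy {M..<M + N} (relabel ((+) (M * r)) Q) x = energy {..<N} Q (\<lambda>i. x (M + i))"
proof -
  have inj: "inj_on (map_prod (image ((+) (M * r))) id) Q"
    by (auto simp: inj_on_def inj_image_eq_iff)
  have "(\<Sum>i\<in>{M..<M + N}. \<nu> (x i)) = (\<Sum>i\<in>{..<N}. \<nu> (x (M + i)))"
    by (rule sum.reindex_bij_witness[of _ "\<lambda>i. M + i" "\<lambda>i. i - M"]) auto
  moreover have "(\<Sum>b\<in>relabel ((+) (M * r)) Q. satisfied b x) = (\<Sum>b\<in>Q. satisfied b (\<lambda>i. x (M + i)))"
    unfolding relabel_def sum.reindex[OF inj]
    using finite_edges r_pos by (intro sum.cong refl) (auto simp: satisfied_def edge_nodes_shift o_def)
  ultimately show ?thesis by (simp add: energy_def)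
qed

lemma max_energy_shift:
  assumes edges: "\<And>b. b \<in> Q \<Longrightarrow> finite (fst b)" "on_nodes {..<N} Q"
  shows "max_energy {M..<M + N} (relabel ((+) (M * r)) Q) = max_energy {..<N} Q"
proof (rule antisym)
  let ?V = "{M..<M + N}" and ?R = "relabel ((+) (M * r)) Q"
  have shift: "energy ?V ?R x = energy {..<N} Q (\<lambda>i. x (M + i))" for x
    using edges(1) by (rule energy_shift)
  show "max_energy ?V ?R \<le> max_energy {..<N} Q"
  proof (rule max_energy_le)
    fix x assume x_assignment: "x \<in> assignments ?V"
    have "energy ?V ?R x = energy {..<N} Q (restrict (\<lambda>i. x (M + i)) {..<N})"
      unfolding shift using edges(2) by (intro energy_cong) auto
    moreover have "restrict (\<lambda>i. x (M + i)) {..<N} \<in> assignments {..<N}"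
      using x_assignment by (auto simp: assignments_def)
    ultimately show "energy ?V ?R x \<le> max_energy {..<N} Q" using energy_le_max_energy[of "{..<N}"] by simp
  qed simp
  show "max_energy {..<N} Q \<le> max_energy ?V ?R"
  proof (rule max_energy_le)
    fix y assume y_assignment: "y \<in> assignments {..<N}"
    have "energy ?V ?R (restrict (\<lambda>i. y (i - M)) ?V) = energy {..<N} Q y"
      unfolding shift using edges(2) by (intro energy_cong) auto
    moreover have "restrict (\<lambda>i. y (i - M)) ?V \<in> assignments ?V"
      unfolding assignments_def restrict_PiE_iff
    proof
      fix i assume "i \<in> ?V"
      then have "i - M \<in> {..<N}" by auto
      then show "y (i - M) \<in> {..<q}"
        using y_assignment unfolding assignments_def by (rule PiE_mem[rotated])
    qed
    then have "energy ?V ?R (restrict (\<lambda>i. y (i - M)) ?V) \<le> max_energy ?V ?R"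
      by (intro energy_le_max_energy) auto
    ultimately show "energy {..<N} Q y \<le> max_energy ?V ?R" by simp
  qed simp
qed

lemma max_energy_empty_linear: "max_energy {..<N} {} = real N * max_energy {..<1} {}"
proof (induction N)
  case 0
  obtain x where "energy {} {} x = max_energy {} {}" using max_energy_attained[of "{}" "{}"] by auto
  then show ?case by (simp add: energy_def)
next
  case (Suc N)
  have "{..<Suc N} = {..<N} \<union> {N..<N + 1}" by auto
  then have "max_energy {..<Suc N} {} = max_energy {..<N} {} + max_energy {N..<N + 1} {}"
    using max_energy_disjoint_union[of "{..<N}" "{N..<N + 1}" "{}" "{}"] by simp
  moreover have "max_energy {N..<N + 1} {} = max_energy {..<1} {}"
    using max_energy_shift[of "{}" 1 N] by (simp add: relabel_def)
  ultimately show ?case using Suc by (simp add: algebra_simps)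
qed

lemma partition_mean_energy_gain_shift:
  "partition_mean {M * r..<(M + N) * r} (energy_gain {M..<M + N}) = mean_gain N"
proof -
  let ?V = "{M..<M + N}" and ?shift = "relabel ((+) (M * r))"
  have points: "{M * r..<(M + N) * r} = (+) (M * r) ` {..<N * r}"
    by (simp add: lessThan_atLeast0 image_add_atLeastLessThan algebra_simps)
  have "partition_mean {M * r..<(M + N) * r} (energy_gain ?V)
      = partition_mean {..<N * r} (\<lambda>Q. energy_gain ?V (?shift Q))"
    unfolding points by (rule partition_mean_relabel) simp
  also have "\<dots> = mean_gain N"
    unfolding mean_gain_def partition_mean_def
  proof (rule average_cong)
    fix Q :: "(nat set \<times> bool list) set" assume Q_partition: "Q \<in> marked_partitions {..<N * r}"
    have "finite (fst b)" if "b \<in> Q" for b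
      using that marked_partitions_subset[OF Q_partition] blocksD(2) by blast
    then have "max_energy ?V (?shift Q) = max_energy {..<N} Q"
      using on_nodes_marked_partitions[OF Q_partition] by (rule max_energy_shift)
    then show "energy_gain ?V (?shift Q) = energy_gain {..<N} Q"
      using max_energy_shift[of "{}" N M] by (simp add: energy_gain_def relabel_def)
  qed
  finally show ?thesis .
qed

lemma energy_gain_Un_sides:
  assumes P_partition: "P \<in> marked_partitions {..<M * r}"
    and R_partition: "R \<in> marked_partitions {M * r..<(M + N) * r}"
  shows "energy_gain {..<M + N} (P \<union> R) = energy_gain {..<M} P + energy_gain {M..<M + N} R"
proof -
  have "{..<M * r} \<inter> {M * r..<(M + N) * r} = {}" by auto
  then have "P \<inter> R = {}"
    using blocks_disjoint marked_partitions_subset[OF P_partition]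
      marked_partitions_subset[OF R_partition]
    by blast
  moreover have "on_nodes {M..<M + N} R"
    using r_pos less_mult_imp_div_less[of _ "M + N" r]
    by (intro on_nodes_blocks[OF marked_partitions_subset[OF R_partition]])
      (auto simp: less_eq_div_iff_mult_less_eq)
  moreover have "{..<M + N} = {..<M} \<union> {M..<M + N}" "{..<M} \<inter> {M..<M + N} = {}" by auto
  ultimately show ?thesis
    using marked_partitions_finite[OF P_partition] marked_partitions_finite[OF R_partition]
      on_nodes_marked_partitions[OF P_partition]
    by (simp add: energy_gain_disjoint_union)
qed

lemma split_mean_energy_gain:
  assumes "K dvd N1 * r" "K dvd N2 * r"
  shows "split_mean {..<N1 * r} {N1 * r..<(N1 + N2) * r} (energy_gain {..<N1 + N2})
      = mean_gain N1 + mean_gain N2"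
proof -
  let ?S1 = "{..<N1 * r}" and ?S2 = "{N1 * r..<(N1 + N2) * r}"
  obtain k1 where card_S1: "card ?S1 = K * k1" using assms(1) by (auto elim: dvdE)
  have "card ?S2 = N2 * r" by (simp add: algebra_simps)
  then obtain k2 where card_S2: "card ?S2 = K * k2" using assms(2) by (auto elim: dvdE)
  have "split_mean ?S1 ?S2 (energy_gain {..<N1 + N2})
      = partition_mean ?S1 (\<lambda>P. partition_mean ?S2
        (\<lambda>R. energy_gain {..<N1} P + energy_gain {N1..<N1 + N2} R))"
    unfolding split_mean_def partition_mean_def by (intro average_cong energy_gain_Un_sides)
  also have "\<dots> = mean_gain N1 + mean_gain N2"
    using partition_mean_const[OF _ card_S1] partition_mean_const[OF _ card_S2]
      partition_mean_energy_gain_shift[of N1 N2]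
    unfolding partition_mean_def average_add mean_gain_def by simp
  finally show ?thesis .
qed

lemma mean_gain_lipschitz:
  assumes "K dvd N * r" "K dvd N' * r" "N \<le> N'"
  shows "\<bar>mean_gain N' - mean_gain N\<bar> \<le> 3 * real r * real (N' - N)"
proof -
  let ?S = "{..<N' * r}" and ?U = "{..<N * r}"
  obtain k k' where points_eq: "N * r = K * k" "N' * r = K * k'" using assms(1,2) by (auto elim!: dvdE)
  have "K * k \<le> K * k'" using assms(3) by (simp flip: points_eq)
  then have "k \<le> k'" using K_pos by simp
  have "mean_gain N = partition_mean ?U (energy_gain {..<N'})"
    unfolding mean_gain_def partition_mean_def
  proof (rule average_cong)
    fix P :: "(nat set \<times> bool list) set" assume P_partition: "P \<in> marked_partitions ?U"
    have "{..<N'} = {..<N} \<union> {N..<N'}" "{..<N} \<inter> {N..<N'} = {}" using assms(3) by auto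
    then show "energy_gain {..<N} P = energy_gain {..<N'} P"
      using energy_gain_disjoint_union[of "{..<N}" "{N..<N'}" P "{}"]
        on_nodes_marked_partitions[OF P_partition] marked_partitions_finite[OF P_partition] by simp
  qed
  moreover have "\<bar>partition_mean ?U (energy_gain {..<N'}) - partition_mean ?S (energy_gain {..<N'})\<bar>
      \<le> 3 * 1 * real K * real (k' - k)"
    using assms(3) points_eq \<open>k \<le> k'\<close> energy_gain_lipschitz[of "{..<N'}"]
    by (intro partition_mean_subset[of ?S ?U k]) auto
  moreover have "real K * real (k' - k) = real r * real (N' - N)"
    unfolding of_nat_mult[symmetric] diff_mult_distrib2 points_eq[symmetric] by (simp add: mult.commute)
  ultimately show ?thesis by (simp add: mean_gain_def abs_minus_commute)
qed

end

lemma chernoff_overflow_le: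
  fixes \<eta> p1 p2 :: real and K m s T :: nat
  assumes weights: "0 \<le> p1" "p1 + p2 = 1" and \<eta>: "0 \<le> \<eta>" "\<eta> * K \<le> 1"
    and T_bound: "real T * K * p1 + 2 * real m \<le> real s"
  shows "exp \<eta> ^ m * (p1 * exp \<eta> ^ K + p2) ^ T / exp \<eta> ^ s \<le> exp (K * \<eta>\<^sup>2 * s - \<eta> * m)"
proof -
  have exp_pow: "exp \<eta> ^ j = exp (\<eta> * real j)" for j
    by (simp add: exp_of_nat_mult[symmetric] mult.commute)
  define y where "y = \<eta> * K + (\<eta> * K)\<^sup>2"
  have "exp (\<eta> * K) \<le> 1 + y" using exp_bound[of "\<eta> * K"] \<eta> by (simp add: y_def)
  then have "p1 * exp (\<eta> * K) \<le> p1 * (1 + y)" using weights by (intro mult_left_mono)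
  then have "p1 * exp \<eta> ^ K + p2 \<le> 1 + p1 * y" using weights by (simp add: exp_pow algebra_simps)
  also have "\<dots> \<le> exp (p1 * y)" by (rule exp_ge_add_one_self)
  finally have "p1 * exp \<eta> ^ K + p2 \<le> exp (p1 * y)" .
  moreover have "p1 * 1 \<le> p1 * exp (\<eta> * K)" using weights \<eta>(1) by (intro mult_left_mono) auto
  then have "0 \<le> p1 * exp \<eta> ^ K + p2" using weights by (simp add: exp_pow)
  ultimately have "(p1 * exp \<eta> ^ K + p2) ^ T \<le> exp (p1 * y) ^ T" by (rule power_mono)
  also have "\<dots> = exp (T * (p1 * y))" by (simp add: exp_of_nat_mult[symmetric])
  finally have "exp \<eta> ^ m * (p1 * exp \<eta> ^ K + p2) ^ T / exp \<eta> ^ s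
      \<le> exp (\<eta> * m) * exp (T * (p1 * y)) / exp (\<eta> * s)"
    unfolding exp_pow[of m] exp_pow[of s] by (intro divide_right_mono mult_left_mono) auto
  also have "\<dots> = exp (\<eta> * m + T * (p1 * y) - \<eta> * s)" by (simp add: exp_add exp_diff)
  also have "\<dots> \<le> exp (K * \<eta>\<^sup>2 * s - \<eta> * m)"
  proof -
    have "\<eta> * (real T * K * p1) \<le> \<eta> * (real s - 2 * real m)"
      using T_bound \<eta>(1) by (intro mult_left_mono) auto
    moreover have "K * \<eta>\<^sup>2 * (real T * K * p1) \<le> K * \<eta>\<^sup>2 * s" using T_bound by (intro mult_left_mono) auto
    moreover have "T * (p1 * y) = \<eta> * (real T * K * p1) + K * \<eta>\<^sup>2 * (real T * K * p1)"
      by (simp add: y_def power2_eq_square algebra_simps)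
    ultimately show ?thesis by (simp add: algebra_simps)
  qed
  finally show ?thesis .
qed

lemma third_side_overflow_le:
  fixes \<eta> w w' :: real
  assumes weights: "w = real n / real N" "1 / 3 \<le> w" "w + w' = 1" and n_le_N: "n \<le> N"
    and T_eq: "N * r = K * (T + 6 * m)"
    and \<eta>: "0 \<le> \<eta>" "\<eta> * K \<le> 1" and K_ge_1: "1 \<le> K"
  shows "exp \<eta> ^ m * (w * exp \<eta> ^ K + w') ^ T / exp \<eta> ^ (n * r) \<le> exp (K * \<eta>\<^sup>2 * real (N * r) - \<eta> * m)"
proof -
  have "real K * (real T + 6 * real m) = real N * real r" using arg_cong[OF T_eq, of real] by simp
  then have T_real: "real K * real T = real N * real r - 6 * real K * real m" by (simp add: algebra_simps)
  have "w * real N = real n" using weights(1) n_le_N by (cases "N = 0") auto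
  then have "real T * real K * w = real n * real r - w * (real K * (6 * real m))"
    using arg_cong[OF T_real, of "\<lambda>u. w * u"] by (simp add: right_diff_distrib mult_ac)
  moreover have "1 / 3 * (6 * real m) \<le> w * (real K * (6 * real m))"
    using weights(2) K_ge_1 mult_right_mono[of 1 "real K" "6 * real m"]
    by (intro mult_mono[of "1 / 3"]) auto
  ultimately have "real T * real K * w + 2 * real m \<le> real (n * r)" by simp
  then have "exp \<eta> ^ m * (w * exp \<eta> ^ K + w') ^ T / exp \<eta> ^ (n * r)
      \<le> exp (K * \<eta>\<^sup>2 * real (n * r) - \<eta> * m)"
    using weights \<eta> by (intro chernoff_overflow_le) auto
  also have "\<dots> \<le> exp (K * \<eta>\<^sup>2 * real (N * r) - \<eta> * m)"
    using n_le_N by (auto intro!: diff_right_mono mult_left_mono of_nat_mono mult_right_mono)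
  finally show ?thesis .
qed

definition superadditivity_error :: "nat \<Rightarrow> nat \<Rightarrow> nat \<Rightarrow> real" where
  "superadditivity_error K r N = (1 + 3 * real K) * (6 * (real N powr (3 / 4) + 1)) + real (N * r) / K *
    ((real K)\<^sup>2 / real N powr (3 / 4) + 4 * (real (N * r) / K) * exp (real K * r - real N powr (1 / 4)))"

lemma superadditivity_error_bigo:
  assumes "1 \<le> K" "1 \<le> r"
  shows "superadditivity_error K r \<in> O(\<lambda>N. real N powr (3 / 4))"
proof -
  define c \<rho> where "c = real K" and "\<rho> = real r / K"
  have pos: "0 < c" "0 < \<rho>" using assms by (auto simp: c_def \<rho>_def)
  have "superadditivity_error K r = (\<lambda>N. (1 + 3 * c) * (6 * (real N powr (3 / 4) + 1)) + \<rho> * real N *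
      (c\<^sup>2 / real N powr (3 / 4) + 4 * (\<rho> * real N) * exp (c * r - real N powr (1 / 4))))"
    by (simp add: superadditivity_error_def fun_eq_iff c_def \<rho>_def)
  also have "\<dots> \<in> O(\<lambda>N. real N powr (3 / 4))" using pos by real_asymp
  finally show ?thesis .
qed

context spin_model
begin

lemma mean_gain_add_le_overflow:
  fixes z :: real
  assumes N_pos: "1 \<le> N1" "1 \<le> N2" and dvd: "K dvd N1 * r" "K dvd N2 * r"
    and T_eq: "(N1 + N2) * r = K * (T + d)"
    and K_le_m: "K \<le> m" and z_ge_1: "1 \<le> z"
  defines "p1 \<equiv> real N1 / real (N1 + N2)" and "p2 \<equiv> real N2 / real (N1 + N2)"
  shows "mean_gain N1 + mean_gain N2 \<le> mean_gain (N1 + N2) + (1 + 3 * real K) * real d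
    + T * ((real K)\<^sup>2 / m + 2 * real (T + d) *
      (z ^ m * (p1 * z ^ K + p2) ^ T / z ^ (N1 * r) + z ^ m * (p1 + p2 * z ^ K) ^ T / z ^ (N2 * r)))"
proof -
  let ?S1 = "{..<N1 * r}" and ?S2 = "{N1 * r..<(N1 + N2) * r}"
  have sides_Un: "?S1 \<union> ?S2 = {..<(N1 + N2) * r}" by (auto simp: algebra_simps)
  interpret spin_sides K q r \<nu> bad ?S1 ?S2 p1 p2 "{..<N1 + N2}" m z
  proof unfold_locales
    show "0 < p1" "0 < p2" using N_pos by (auto simp: p1_def p2_def)
    show "p1 + p2 = 1" using N_pos by (simp add: p1_def p2_def add_divide_distrib[symmetric])
    show "x div r \<in> {..<N1 + N2}" if "x \<in> ?S1 \<union> ?S2" for x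
      using that unfolding sides_Un by (auto intro: less_mult_imp_div_less)
  qed (use K_le_m z_ge_1 in auto)
  have card_sides: "card (?S1 \<union> ?S2) = K * (T + d)" "card ?S2 = N2 * r"
    unfolding sides_Un using T_eq by (auto simp: algebra_simps)
  have "max_blocks = real (T + d)" unfolding max_blocks_def card_sides using K_pos by simp
  then show ?thesis
    using split_mean_le_partition_mean[OF card_sides(1)] split_mean_energy_gain[OF dvd]
    unfolding sides_Un overflow_empty card_sides(2) mean_gain_def[of "N1 + N2"] by simp
qed

lemma mean_gain_superadditive:
  fixes \<eta> :: real
  assumes sizes: "1 \<le> N1" "1 \<le> N2" "N1 \<le> 2 * N2" "N2 \<le> 2 * N1" and dvd: "K dvd N1 * r" "K dvd N2 * r"
    and m_bounds: "K \<le> m" "K * (6 * m) \<le> (N1 + N2) * r" and \<eta>: "0 \<le> \<eta>" "\<eta> * K \<le> 1"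
  defines "B \<equiv> real ((N1 + N2) * r) / K"
  shows "mean_gain N1 + mean_gain N2 \<le> mean_gain (N1 + N2) + (1 + 3 * real K) * real (6 * m)
    + B * ((real K)\<^sup>2 / m + 4 * B * exp (K * \<eta>\<^sup>2 * real ((N1 + N2) * r) - \<eta> * m))"
proof -
  define p1 p2 where "p1 = real N1 / real (N1 + N2)" and "p2 = real N2 / real (N1 + N2)"
  define T where "T = (N1 + N2) * r div K - 6 * m"
  define E where "E = exp (K * \<eta>\<^sup>2 * real ((N1 + N2) * r) - \<eta> * m)"
  define E1 where "E1 = exp \<eta> ^ m * (p1 * exp \<eta> ^ K + p2) ^ T / exp \<eta> ^ (N1 * r)"
  define E2 where "E2 = exp \<eta> ^ m * (p1 + p2 * exp \<eta> ^ K) ^ T / exp \<eta> ^ (N2 * r)"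
  have "K dvd (N1 + N2) * r" using dvd by (simp add: distrib_right)
  moreover have "6 * m \<le> (N1 + N2) * r div K"
    using m_bounds(2) K_pos by (simp add: less_eq_div_iff_mult_less_eq mult.commute)
  ultimately have T_eq: "(N1 + N2) * r = K * (T + 6 * m)" by (simp add: T_def)
  then have B_eq: "B = real (T + 6 * m)" using K_pos by (simp add: B_def)
  have weights: "1 / 3 \<le> p1" "1 / 3 \<le> p2" "p1 + p2 = 1"
    using sizes by (auto simp: p1_def p2_def pos_le_divide_eq add_divide_distrib[symmetric])
  have "E1 \<le> E"
    unfolding E1_def E_def using weights p1_def
    by (intro third_side_overflow_le[OF _ _ _ _ T_eq \<eta> K_pos]) auto
  moreover have "E2 \<le> E"
    unfolding E2_def E_def add.commute[of p1] using weights p2_def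
    by (intro third_side_overflow_le[OF _ _ _ _ T_eq \<eta> K_pos]) auto
  ultimately have "2 * B * (E1 + E2) \<le> 2 * B * (E + E)" using B_eq by (intro mult_left_mono) auto
  then have "2 * B * (E1 + E2) \<le> 4 * B * E" by (simp add: algebra_simps)
  moreover have "0 \<le> E1" "0 \<le> E2" using weights by (auto simp: E1_def E2_def)
  ultimately have "T * ((real K)\<^sup>2 / m + 2 * B * (E1 + E2)) \<le> B * ((real K)\<^sup>2 / m + 4 * B * E)"
    using B_eq by (intro mult_mono[OF _ add_left_mono]) auto
  moreover have "1 \<le> exp \<eta>" using \<eta>(1) by simp
  ultimately show ?thesis
    using mean_gain_add_le_overflow[OF sizes(1,2) dvd T_eq m_bounds(1) \<open>1 \<le> exp \<eta>\<close>]
    unfolding E_def E1_def E2_def p1_def p2_def B_eq by linarith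
qed

lemma mean_gain_le_superadditivity_error:
  fixes N1 N2 :: nat
  defines "N \<equiv> N1 + N2"
  assumes sizes: "1 \<le> N1" "N1 \<le> N2" "N2 \<le> 2 * N1" and dvd: "K dvd N1 * r" "K dvd N2 * r"
    and large: "K \<le> real N powr (1 / 2)" "K * (6 * (real N powr (3 / 4) + 1)) \<le> real N"
  shows "mean_gain N1 + mean_gain N2 \<le> mean_gain N + superadditivity_error K r N"
proof -
  define B where "B = real (N * r) / K"
  define m where "m = nat \<lceil>real N powr (3 / 4)\<rceil>"
  define \<eta> where "\<eta> = real N powr (- 1 / 2)"
  have N_ge_1: "1 \<le> real N" using sizes(1) by (simp add: N_def)
  have m_bounds: "real N powr (3 / 4) \<le> real m" "real m \<le> real N powr (3 / 4) + 1"
    unfolding m_def by (simp_all add: real_nat_ceiling_ge of_nat_ceiling)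
  have "real N powr (1 / 2) \<le> real N powr (3 / 4)" using N_ge_1 by (intro powr_mono) auto
  then have K_le_m: "K \<le> m" using large(1) m_bounds(1) by linarith
  have "real K * (6 * real m) \<le> K * (6 * (real N powr (3 / 4) + 1))"
    using m_bounds(2) by (intro mult_left_mono) auto
  then have "real (K * (6 * m)) \<le> real N" using large(2) by simp
  also have "\<dots> \<le> real (N * r)" using r_pos by (intro of_nat_mono) simp
  finally have m_small: "K * (6 * m) \<le> N * r" by (simp only: of_nat_le_iff)
  have "\<eta> * K \<le> \<eta> * real N powr (1 / 2)" using large(1) by (intro mult_left_mono) (auto simp: \<eta>_def)
  also have "\<dots> = 1" using N_ge_1 by (simp add: \<eta>_def powr_add[symmetric])
  finally have \<eta>: "\<eta> * K \<le> 1" .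
  have "mean_gain N1 + mean_gain N2 \<le> mean_gain N + (1 + 3 * real K) * real (6 * m)
      + B * ((real K)\<^sup>2 / m + 4 * B * exp (K * \<eta>\<^sup>2 * real (N * r) - \<eta> * m))"
    using sizes dvd K_le_m m_small \<eta> mean_gain_superadditive[of N1 N2 m \<eta>]
    by (simp add: N_def B_def \<eta>_def)
  also have "\<dots> \<le> mean_gain N + superadditivity_error K r N"
  proof -
    have "\<eta>\<^sup>2 = real N powr (- 1)" using N_ge_1 by (simp add: \<eta>_def power2_eq_square powr_add[symmetric])
    then have "\<eta>\<^sup>2 * real N = 1" using N_ge_1 by (simp add: powr_minus)
    then have "K * \<eta>\<^sup>2 * real (N * r) = real K * r" by simp
    moreover have "real N powr (1 / 4) = \<eta> * real N powr (3 / 4)"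
      using N_ge_1 by (simp add: \<eta>_def powr_add[symmetric])
    then have "real N powr (1 / 4) \<le> \<eta> * m" using m_bounds(1) by (simp add: \<eta>_def mult_left_mono)
    ultimately have "exp (K * \<eta>\<^sup>2 * real (N * r) - \<eta> * m) \<le> exp (real K * r - real N powr (1 / 4))"
      unfolding exp_le_cancel_iff by linarith
    moreover have "(real K)\<^sup>2 / m \<le> (real K)\<^sup>2 / real N powr (3 / 4)"
      using m_bounds(1) N_ge_1 K_le_m K_pos by (intro divide_left_mono) auto
    moreover have "0 \<le> B" by (simp add: B_def)
    ultimately show ?thesis
      unfolding superadditivity_error_def B_def[symmetric] add.assoc using m_bounds(2)
      by (intro add_left_mono add_mono mult_left_mono) auto
  qed
  finally show ?thesis .
qed

lemma mean_gain_almost_superadditive: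
  obtains C n0 where "0 \<le> C" "\<And>N1 N2. n0 \<le> N1 \<Longrightarrow> N1 \<le> N2 \<Longrightarrow> N2 \<le> 2 * N1 \<Longrightarrow> K dvd N1 * r \<Longrightarrow> K dvd N2 * r
    \<Longrightarrow> mean_gain N1 + mean_gain N2 \<le> mean_gain (N1 + N2) + C * real (N1 + N2) powr (3 / 4)"
proof -
  have "superadditivity_error K r \<in> O(\<lambda>N. real N powr (3 / 4))"
    using K_pos r_pos by (intro superadditivity_error_bigo)
  then obtain C where C_pos: "0 < C" and
    bound: "\<forall>\<^sub>F N in sequentially. norm (superadditivity_error K r N) \<le> C * norm (real N powr (3 / 4))"
    by (elim landau_o.bigE)
  have "\<forall>\<^sub>F N in sequentially. K \<le> real N powr (1 / 2)"
    "\<forall>\<^sub>F N in sequentially. K * (6 * (real N powr (3 / 4) + 1)) \<le> real N"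
    by real_asymp+
  with bound have "\<forall>\<^sub>F N in sequentially.
      norm (superadditivity_error K r N) \<le> C * norm (real N powr (3 / 4)) \<and>
      K \<le> real N powr (1 / 2) \<and> K * (6 * (real N powr (3 / 4) + 1)) \<le> real N"
    by eventually_elim blast
  then obtain n0 where large: "\<And>N. n0 \<le> N \<Longrightarrow>
      norm (superadditivity_error K r N) \<le> C * norm (real N powr (3 / 4)) \<and>
      K \<le> real N powr (1 / 2) \<and> K * (6 * (real N powr (3 / 4) + 1)) \<le> real N"
    by (auto simp: eventually_sequentially)
  show ?thesis
  proof (rule that[of C "max 1 n0"])
    fix N1 N2 assume sizes: "max 1 n0 \<le> N1" "N1 \<le> N2" "N2 \<le> 2 * N1" "K dvd N1 * r" "K dvd N2 * r"
    then have "mean_gain N1 + mean_gain N2 \<le> mean_gain (N1 + N2) + superadditivity_error K r (N1 + N2)"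
      using large[of "N1 + N2"] by (intro mean_gain_le_superadditivity_error) auto
    also have "\<dots> \<le> mean_gain (N1 + N2) + C * real (N1 + N2) powr (3 / 4)"
      using large[of "N1 + N2"] sizes(1) by (simp add: abs_le_iff)
    finally show "mean_gain N1 + mean_gain N2 \<le> mean_gain (N1 + N2) + C * real (N1 + N2) powr (3 / 4)" .
  qed (use C_pos in simp)
qed

end

definition admissible_sizes :: "nat \<Rightarrow> nat \<Rightarrow> nat filter" where
  "admissible_sizes K r = inf sequentially (principal {N. K dvd N * r})"

lemma eventually_admissible_sizes:
  "eventually P (admissible_sizes K r) \<longleftrightarrow> (\<exists>N0. \<forall>N\<ge>N0. K dvd N * r \<longrightarrow> P N)"
  by (simp add: admissible_sizes_def eventually_inf_principal eventually_sequentially)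

lemma admissible_sizes_le_multiples:
  assumes s_pos: "0 < s" and s_dvd: "\<And>N. K dvd N * r \<longleftrightarrow> s dvd N"
  shows "admissible_sizes K r \<le> filtermap ((*) s) sequentially"
proof (rule filter_leI)
  fix P assume "eventually P (filtermap ((*) s) sequentially)"
  then obtain n1 where P_multiples: "\<And>n. n1 \<le> n \<Longrightarrow> P (s * n)"
    by (auto simp: eventually_filtermap eventually_sequentially)
  have "P N" if "s * n1 \<le> N" "K dvd N * r" for N
    using that P_multiples s_pos s_dvd by (auto elim!: dvdE)
  then show "eventually P (admissible_sizes K r)" unfolding eventually_admissible_sizes by blast
qed

lemma dvd_mult_iff_dvd_multiple:
  fixes K r :: nat
  assumes "0 < K"
  obtains s where "0 < s" "\<And>N. K dvd N * r \<longleftrightarrow> s dvd N"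
proof
  define g where "g = gcd K r"
  have gcd_eqs: "K = K div g * g" "r = r div g * g" "0 < g" using assms by (simp_all add: g_def)
  show "0 < K div g" using gcd_eqs assms by (metis gr0I mult_0)
  have "coprime (K div g) (r div g)" unfolding g_def using assms by (intro div_gcd_coprime) simp
  then show "K dvd N * r \<longleftrightarrow> K div g dvd N" for N
    using gcd_eqs by (metis coprime_dvd_mult_left_iff dvd_times_right_cancel_iff mult.assoc neq0_conv)
qed

context spin_model
begin

lemma mean_gain_limit:
  obtains l where "((\<lambda>N. mean_gain N / N) \<longlongrightarrow> l) (admissible_sizes K r)"
proof -
  obtain s where s_dvd: "0 < s" "\<And>N. K dvd N * r \<longleftrightarrow> s dvd N"
    using dvd_mult_iff_dvd_multiple[of K r] K_pos by auto
  obtain C n0 where C_nonneg: "0 \<le> C" and super: "\<And>N1 N2. n0 \<le> N1 \<Longrightarrow> N1 \<le> N2 \<Longrightarrow> N2 \<le> 2 * N1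
      \<Longrightarrow> K dvd N1 * r \<Longrightarrow> K dvd N2 * r
      \<Longrightarrow> mean_gain N1 + mean_gain N2 \<le> mean_gain (N1 + N2) + C * real (N1 + N2) powr (3 / 4)"
    using mean_gain_almost_superadditive by blast
  have "convergent (\<lambda>n. mean_gain (s * n) / real n)"
  proof (rule almost_superadditive_convergent[where n_min = n0 and \<gamma> = "3 / 4"
        and c = "3 * real r * real s" and C = "C * real s powr (3 / 4)"])
    fix m n :: nat assume "m \<le> n"
    then have "\<bar>mean_gain (s * n) - mean_gain (s * m)\<bar> \<le> 3 * real r * real (s * n - s * m)"
      by (intro mean_gain_lipschitz) (simp_all add: s_dvd(2))
    then show "\<bar>mean_gain (s * n) - mean_gain (s * m)\<bar> \<le> 3 * real r * real s * real (n - m)"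
      by (simp add: diff_mult_distrib2[symmetric] mult.assoc)
  next
    fix m n assume balanced: "n0 \<le> m" "m \<le> n" "n \<le> 2 * m"
    have "n0 \<le> s * m"
      using balanced(1) s_dvd(1) by (metis le_trans mult_le_mono1 nat_mult_1 Suc_leI One_nat_def)
    then have "mean_gain (s * m) + mean_gain (s * n)
        \<le> mean_gain (s * m + s * n) + C * real (s * m + s * n) powr (3 / 4)"
      using balanced by (intro super) (simp_all add: s_dvd(2))
    then show "mean_gain (s * m) + mean_gain (s * n)
        \<le> mean_gain (s * (m + n)) + C * real s powr (3 / 4) * real (m + n) powr (3 / 4)"
      by (simp only: distrib_left[symmetric] of_nat_mult powr_mult mult.assoc)
  qed (use C_nonneg in \<open>auto simp: mean_gain_def\<close>)
  then obtain l where "(\<lambda>n. mean_gain (s * n) / real n) \<longlonglongrightarrow> l" by (auto simp: convergent_def)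
  then have "(\<lambda>n. mean_gain (s * n) / real n / s) \<longlonglongrightarrow> l / s" using s_dvd(1) by (intro tendsto_intros) auto
  then have "filterlim (\<lambda>N. mean_gain N / N) (nhds (l / s)) (filtermap ((*) s) sequentially)"
    by (simp add: filterlim_filtermap mult.commute)
  moreover have "admissible_sizes K r \<le> filtermap ((*) s) sequentially"
    using s_dvd by (rule admissible_sizes_le_multiples)
  ultimately show ?thesis using that tendsto_mono by blast
qed

section \<open>Concentration\<close>

lemma prob_energy_gain_deviation_le:
  assumes dvd: "K dvd N * r" and t_pos: "0 < t"
  shows "measure_pmf.prob (pmf_of_set (marked_partitions {..<N * r}))
      {Q. t \<le> \<bar>energy_gain {..<N} Q - mean_gain N\<bar>}
    \<le> real (N * r) * (2 * (real K + 1))\<^sup>2 / t\<^sup>2"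
proof -
  let ?S = "{..<N * r}"
  obtain n where card_S: "card ?S = K * n" using dvd by (auto elim: dvdE)
  have "average (marked_partitions ?S) (\<lambda>Q. (energy_gain {..<N} Q - mean_gain N)\<^sup>2)
      \<le> n * (2 * 1 * (real K + 1))\<^sup>2"
    using partition_variance_le[OF _ card_S energy_gain_lipschitz[of "{..<N}"]]
    by (simp add: mean_gain_def partition_mean_def add.commute)
  also have "\<dots> \<le> real (N * r) * (2 * (real K + 1))\<^sup>2"
  proof -
    have "n \<le> N * r" using card_S K_pos by simp
    then show ?thesis by (simp only: mult_1_right) (intro mult_right_mono of_nat_mono; simp)
  qed
  finally have "average (marked_partitions ?S) (\<lambda>Q. (energy_gain {..<N} Q - mean_gain N)\<^sup>2) / t\<^sup>2
      \<le> real (N * r) * (2 * (real K + 1))\<^sup>2 / t\<^sup>2"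
    by (rule divide_right_mono) simp
  then show ?thesis
    using average_Chebyshev[OF _ marked_partitions_nonempty[OF _ card_S] t_pos,
        of "energy_gain {..<N}" "mean_gain N"] by simp
qed

lemma prob_max_energy_deviation_le:
  assumes dvd: "K dvd N * r" and N_ge_1: "1 \<le> N" and \<epsilon>_pos: "0 < \<epsilon>"
    and mean: "\<bar>mean_gain N / N - l\<bar> < \<epsilon> / 2"
  shows "measure_pmf.prob (pmf_of_set (marked_partitions {..<N * r}))
      {Q. \<epsilon> * N < \<bar>max_energy {..<N} Q - N * (l + max_energy {..<1} {})\<bar>}
    \<le> real r * (2 * (real K + 1))\<^sup>2 / (\<epsilon> / 2)\<^sup>2 * (1 / N)"
proof -
  let ?prob = "measure_pmf.prob (pmf_of_set (marked_partitions {..<N * r}))"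
  have "mean_gain N - N * l = N * (mean_gain N / N - l)" using N_ge_1 by (simp add: right_diff_distrib)
  then have "\<bar>mean_gain N - N * l\<bar> = N * \<bar>mean_gain N / N - l\<bar>" by (simp add: abs_mult)
  also have "\<dots> \<le> N * (\<epsilon> / 2)" using mean by (intro mult_left_mono) auto
  finally have mean_deviation: "\<bar>mean_gain N - N * l\<bar> \<le> \<epsilon> / 2 * N" by (simp add: mult.commute)
  have "\<epsilon> / 2 * N \<le> \<bar>energy_gain {..<N} Q - mean_gain N\<bar>"
    if "\<epsilon> * N < \<bar>max_energy {..<N} Q - N * (l + max_energy {..<1} {})\<bar>" for Q
  proof -
    have "max_energy {..<N} Q - N * (l + max_energy {..<1} {})
        = (energy_gain {..<N} Q - mean_gain N) + (mean_gain N - N * l)"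
      by (simp add: energy_gain_def max_energy_empty_linear[of N] distrib_left)
    with that mean_deviation show ?thesis
      using abs_triangle_ineq[of "energy_gain {..<N} Q - mean_gain N" "mean_gain N - N * l"] by linarith
  qed
  then have "?prob {Q. \<epsilon> * N < \<bar>max_energy {..<N} Q - N * (l + max_energy {..<1} {})\<bar>}
      \<le> ?prob {Q. \<epsilon> / 2 * N \<le> \<bar>energy_gain {..<N} Q - mean_gain N\<bar>}"
    by (intro measure_pmf.finite_measure_mono) auto
  also have "\<dots> \<le> real (N * r) * (2 * (real K + 1))\<^sup>2 / (\<epsilon> / 2 * N)\<^sup>2"
    using N_ge_1 \<epsilon>_pos by (intro prob_energy_gain_deviation_le dvd) auto
  also have "\<dots> = real r * (2 * (real K + 1))\<^sup>2 / (\<epsilon> / 2)\<^sup>2 * (1 / N)"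
    using N_ge_1 \<epsilon>_pos by (simp add: power2_eq_square field_simps)
  finally show ?thesis .
qed

theorem max_energy_density_converges:
  "\<exists>h :: real. \<forall>\<epsilon>>0. ((\<lambda>N. measure_pmf.prob (pmf_of_set (marked_partitions {..<N * r}))
    {Q. \<epsilon> * real N < \<bar>max_energy {..<N} Q - real N * h\<bar>}) \<longlongrightarrow> 0) (admissible_sizes K r)"
proof -
  obtain l where mean_limit: "((\<lambda>N. mean_gain N / N) \<longlongrightarrow> l) (admissible_sizes K r)" using mean_gain_limit .
  show ?thesis
  proof (intro exI[of _ "l + max_energy {..<1} {}"] allI impI)
    fix \<epsilon> :: real assume \<epsilon>_pos: "0 < \<epsilon>"
    define D where "D = real r * (2 * (real K + 1))\<^sup>2 / (\<epsilon> / 2)\<^sup>2"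
    have "\<forall>\<^sub>F N in admissible_sizes K r. \<bar>mean_gain N / N - l\<bar> < \<epsilon> / 2"
      using tendstoD[OF mean_limit, of "\<epsilon> / 2"] \<epsilon>_pos by (simp add: dist_real_def)
    moreover have "\<forall>\<^sub>F N in admissible_sizes K r. 1 \<le> N \<and> K dvd N * r"
      unfolding eventually_admissible_sizes by blast
    ultimately have upper: "\<forall>\<^sub>F N in admissible_sizes K r.
        measure_pmf.prob (pmf_of_set (marked_partitions {..<N * r}))
        {Q. \<epsilon> * N < \<bar>max_energy {..<N} Q - N * (l + max_energy {..<1} {})\<bar>} \<le> D * (1 / N)"
      unfolding D_def by eventually_elim (use \<epsilon>_pos in \<open>blast intro: prob_max_energy_deviation_le\<close>)
    have D_limit: "((\<lambda>N. D * (1 / real N)) \<longlongrightarrow> 0) (admissible_sizes K r)"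
      unfolding admissible_sizes_def by (rule tendsto_mono[OF inf_le1]) real_asymp
    show "((\<lambda>N. measure_pmf.prob (pmf_of_set (marked_partitions {..<N * r}))
        {Q. \<epsilon> * N < \<bar>max_energy {..<N} Q - N * (l + max_energy {..<1} {})\<bar>}) \<longlongrightarrow> 0) (admissible_sizes K r)"
      by (rule tendsto_sandwich[OF _ upper tendsto_const D_limit]) simp
  qed
qed

end

section \<open>The configuration model\<close>

definition signed_hypergraph :: "nat set set \<Rightarrow> (nat set \<Rightarrow> bool list) \<Rightarrow> (nat set \<times> bool list) set" where
  "signed_hypergraph P a = (\<lambda>B. (B, a B)) ` P"

definition energy_density_converges :: "model \<Rightarrow> nat \<Rightarrow> bool" where
  "energy_density_converges M r \<longleftrightarrow> (\<exists>h :: real. \<forall>\<epsilon>>0.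
    ((\<lambda>N. measure_pmf.prob (random_hypergraph (mK M) N r)
      {G. \<not> (ereal (real N * (h - \<epsilon>)) \<le> H_graph M N r G \<and> H_graph M N r G \<le> ereal (real N * (h + \<epsilon>)))})
    \<longlongrightarrow> 0) (admissible_sizes (mK M) r))"

lemma fst_image_signed_hypergraph [simp]: "fst ` signed_hypergraph P a = P"
  by (simp add: signed_hypergraph_def image_image)

lemma inj_on_signed_hypergraph: "inj_on (signed_hypergraph P) (PiE P X)"
proof (rule inj_onI)
  fix a b assume same_hypergraph: "a \<in> PiE P X" "b \<in> PiE P X"
      "signed_hypergraph P a = signed_hypergraph P b"
  show "a = b"
  proof (rule PiE_ext[OF same_hypergraph(1,2)])
    fix B assume "B \<in> P"
    then have "(B, a B) \<in> signed_hypergraph P b" unfolding same_hypergraph(3)[symmetric]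
      by (simp add: signed_hypergraph_def)
    then show "a B = b B" by (auto simp: signed_hypergraph_def)
  qed
qed

lemma disjoint_signed_hypergraphs: "disjoint_family_on (\<lambda>P. signed_hypergraph P ` X P) C"
  unfolding disjoint_family_on_def
proof (intro ballI impI equals0I)
  fix P P' Q assume "P \<noteq> P'" "Q \<in> signed_hypergraph P ` X P \<inter> signed_hypergraph P' ` X P'"
  then obtain a a' where Q_eqs: "Q = signed_hypergraph P a" "Q = signed_hypergraph P' a'" by blast
  have "P = P'" using fst_image_signed_hypergraph[of P a] fst_image_signed_hypergraph[of P' a']
    by (simp flip: Q_eqs)
  then show False using \<open>P \<noteq> P'\<close> by simp
qed

lemma finite_config_partitions: "finite (config_partitions N r K)"
  by (rule finite_subset[of _ "Pow (Pow {..<N * r})"]) (auto simp: config_partitions_def)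

lemma config_partitions_finite: "P \<in> config_partitions N r K \<Longrightarrow> finite P"
  by (rule finite_subset[of _ "Pow {..<N * r}"]) (auto simp: config_partitions_def)

lemma config_partition_edge_nodes:
  assumes "P \<in> config_partitions N r K" "B \<in> P"
  shows "length (edge_nodes r B) = K" "set (edge_nodes r B) \<subseteq> {..<N}"
proof -
  have "B \<subseteq> {..<N * r}" "finite B" "card B = K"
    using assms by (auto simp: config_partitions_def intro: finite_subset)
  then show "length (edge_nodes r B) = K" "set (edge_nodes r B) \<subseteq> {..<N}"
    by (auto simp: length_edge_nodes set_edge_nodes intro: less_mult_imp_div_less)
qed

context spin_model
begin

lemma sign_choices: "finite P \<Longrightarrow> finite (PiE P (\<lambda>_. signs K))" "PiE P (\<lambda>_. signs K) \<noteq> {}"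
  using A_nonempty by (simp_all add: finite_PiE finite_signs PiE_eq_empty_iff)

lemma signed_hypergraph_in_marked_partitions:
  assumes P_config: "P \<in> config_partitions N r K" and a_signs: "a \<in> PiE P (\<lambda>_. signs K)"
  shows "signed_hypergraph P a \<in> marked_partitions {..<N * r}"
proof -
  have "(B, a B) \<in> blocks {..<N * r}" if "B \<in> P" for B
    using P_config that PiE_mem[OF a_signs that] finite_subset[of B "{..<N * r}"]
    by (auto simp: blocks_def nsets_def config_partitions_def)
  then have "signed_hypergraph P a \<subseteq> blocks {..<N * r}" by (auto simp: signed_hypergraph_def)
  moreover have "\<exists>!b. b \<in> signed_hypergraph P a \<and> p \<in> fst b" if "p < N * r" for p
  proof -
    have "\<exists>!B. B \<in> P \<and> p \<in> B" using P_config that by (simp add: config_partitions_def)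
    then obtain B where B: "B \<in> P" "p \<in> B" "\<And>B'. B' \<in> P \<Longrightarrow> p \<in> B' \<Longrightarrow> B' = B" by blast
    show ?thesis
    proof (rule ex1I[of _ "(B, a B)"])
      show "(B, a B) \<in> signed_hypergraph P a \<and> p \<in> fst (B, a B)"
        using B(1,2) by (simp add: signed_hypergraph_def)
      fix b assume "b \<in> signed_hypergraph P a \<and> p \<in> fst b"
      then obtain B' where "B' \<in> P" "b = (B', a B')" "p \<in> B'" by (auto simp: signed_hypergraph_def)
      then show "b = (B, a B)" using B(3)[of B'] by simp
    qed
  qed
  ultimately show ?thesis by (simp add: marked_partitions_def)
qed

lemma fst_image_marked_partition:
  assumes Q_partition: "Q \<in> marked_partitions {..<N * r}"
  shows "fst ` Q \<in> config_partitions N r K"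
proof -
  have "fst b \<subseteq> {..<N * r} \<and> card (fst b) = K" if "b \<in> Q" for b
    using blocksD[OF subsetD[OF marked_partitions_subset[OF Q_partition] that]] by simp
  moreover have "\<exists>!B. B \<in> fst ` Q \<and> p \<in> B" if "p < N * r" for p
  proof -
    obtain b where b: "b \<in> Q" "p \<in> fst b" "\<And>b'. b' \<in> Q \<Longrightarrow> p \<in> fst b' \<Longrightarrow> b' = b"
      using marked_partitions_ex1[OF Q_partition, of p] \<open>p < N * r\<close> by blast
    show ?thesis
    proof (rule ex1I[of _ "fst b"])
      show "fst b \<in> fst ` Q \<and> p \<in> fst b" using b(1,2) by simp
      show "B = fst b" if "B \<in> fst ` Q \<and> p \<in> B" for B using that b(3) by blast
    qed
  qed
  ultimately show ?thesis by (simp add: config_partitions_def)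
qed

lemma marked_partition_as_signed_hypergraph:
  assumes Q_partition: "Q \<in> marked_partitions {..<N * r}"
  obtains a where "a \<in> PiE (fst ` Q) (\<lambda>_. signs K)" "Q = signed_hypergraph (fst ` Q) a"
proof -
  have "\<forall>B\<in>fst ` Q. \<exists>s. (B, s) \<in> Q" by auto
  then obtain a where a: "\<And>B. B \<in> fst ` Q \<Longrightarrow> (B, a B) \<in> Q" using bchoice[of "fst ` Q"] by metis
  note in_blocks = subsetD[OF marked_partitions_subset[OF Q_partition]]
  have "snd b = a (fst b)" if b_in_Q: "b \<in> Q" for b
  proof (rule ccontr)
    assume "snd b \<noteq> a (fst b)"
    then have "fst b = {}" using marked_partitions_disjoint[OF Q_partition b_in_Q a[OF imageI[OF b_in_Q]]]
      by (auto simp: prod_eq_iff)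
    then show False using blocksD(4)[OF in_blocks[OF b_in_Q]] by simp
  qed
  then have "Q = signed_hypergraph (fst ` Q) (restrict a (fst ` Q))"
    using a by (force simp: signed_hypergraph_def)
  moreover have "restrict a (fst ` Q) \<in> PiE (fst ` Q) (\<lambda>_. signs K)"
    using blocksD(5)[OF in_blocks[OF a]] by (simp add: restrict_PiE_iff)
  ultimately show ?thesis using that by blast
qed

lemma marked_partitions_eq_UN:
  "marked_partitions {..<N * r} = (\<Union>P\<in>config_partitions N r K. signed_hypergraph P ` PiE P (\<lambda>_. signs K))"
proof (intro equalityI subsetI)
  fix Q :: "(nat set \<times> bool list) set" assume Q_partition: "Q \<in> marked_partitions {..<N * r}"
  obtain a where "a \<in> PiE (fst ` Q) (\<lambda>_. signs K)" "Q = signed_hypergraph (fst ` Q) a"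
    using marked_partition_as_signed_hypergraph[OF Q_partition] .
  then show "Q \<in> (\<Union>P\<in>config_partitions N r K. signed_hypergraph P ` PiE P (\<lambda>_. signs K))"
    using fst_image_marked_partition[OF Q_partition] by (intro UN_I[of "fst ` Q"] image_eqI[of _ _ a])
qed (use signed_hypergraph_in_marked_partitions in blast)

lemma card_config_partition:
  assumes P_config: "P \<in> config_partitions N r K"
  shows "N * r = K * card P"
proof -
  obtain a where a_signs: "a \<in> PiE P (\<lambda>_. signs K)" using sign_choices(2)[of P] by blast
  have "card (signed_hypergraph P a) = card P"
    unfolding signed_hypergraph_def by (intro card_image) (simp add: inj_on_def)
  then show ?thesis
    using card_marked_partition[OF signed_hypergraph_in_marked_partitions[OF P_config a_signs]] by simp
qed

lemma config_partitions_nonempty: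
  assumes "K dvd N * r"
  shows "config_partitions N r K \<noteq> {}"
proof -
  obtain n where "card {..<N * r} = K * n" using assms by (auto elim: dvdE)
  then have "(marked_partitions {..<N * r} :: (nat set \<times> bool list) set set) \<noteq> {}"
    by (intro marked_partitions_nonempty) auto
  then show ?thesis using fst_image_marked_partition by blast
qed

lemma card_signed_hypergraphs:
  assumes "P \<in> config_partitions N r K"
  shows "card (signed_hypergraph P ` PiE P (\<lambda>_. signs K)) = (2 ^ K) ^ (N * r div K)"
proof -
  have "card P = N * r div K" using card_config_partition[OF assms] K_pos by simp
  then show ?thesis
    using config_partitions_finite[OF assms]
    by (simp add: card_image[OF inj_on_signed_hypergraph] card_PiE card_signs)
qed

lemma map_random_hypergraph:
  assumes dvd: "K dvd N * r"
  shows "map_pmf (\<lambda>G. signed_hypergraph (fst G) (snd G)) (random_hypergraph K N r)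
      = pmf_of_set (marked_partitions {..<N * r})"
proof -
  let ?C = "config_partitions N r K"
  let ?f = "\<lambda>P. signed_hypergraph P ` PiE P (\<lambda>_. signs K)"
  have "pmf_of_set (\<Union>(?f ` ?C)) = bind_pmf (pmf_of_set ?C) (\<lambda>P. pmf_of_set (?f P))"
  proof (rule pmf_of_set_UN)
    show "finite (\<Union>(?f ` ?C))" unfolding marked_partitions_eq_UN[symmetric] by simp
    show "?C \<noteq> {}" by (rule config_partitions_nonempty[OF dvd])
    show "?f P \<noteq> {}" for P using sign_choices(2) by simp
    show "card (?f P) = (2 ^ K) ^ (N * r div K)" if "P \<in> ?C" for P
      using that by (rule card_signed_hypergraphs)
    show "disjoint_family_on ?f ?C" by (rule disjoint_signed_hypergraphs)
  qed
  also have "\<dots> = bind_pmf (pmf_of_set ?C) (\<lambda>P.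
        map_pmf (signed_hypergraph P) (pmf_of_set (PiE P (\<lambda>_. signs K))))"
  proof (rule bind_pmf_cong[OF refl])
    fix P assume "P \<in> set_pmf (pmf_of_set ?C)"
    then have "finite P"
      using finite_config_partitions config_partitions_nonempty[OF dvd] config_partitions_finite by simp
    then show "pmf_of_set (?f P) = map_pmf (signed_hypergraph P) (pmf_of_set (PiE P (\<lambda>_. signs K)))"
      by (intro map_pmf_of_set_inj[symmetric] inj_on_signed_hypergraph sign_choices)
  qed
  finally show ?thesis
    unfolding marked_partitions_eq_UN random_hypergraph_def
    by (simp add: map_bind_pmf map_pmf_def bind_assoc_pmf bind_return_pmf)
qed

lemma set_random_hypergraph:
  assumes "K dvd N * r" and G_support: "G \<in> set_pmf (random_hypergraph K N r)"
  obtains P a where "G = (P, a)" "P \<in> config_partitions N r K" "a \<in> PiE P (\<lambda>_. signs K)"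
proof -
  obtain P a where components: "G = (P, a)" "P \<in> set_pmf (pmf_of_set (config_partitions N r K))"
      "a \<in> set_pmf (pmf_of_set (PiE P (\<lambda>_. signs K)))"
    using G_support by (auto simp: random_hypergraph_def)
  then have P_config: "P \<in> config_partitions N r K"
    using finite_config_partitions config_partitions_nonempty[OF assms(1)] by simp
  have "set_pmf (pmf_of_set (PiE P (\<lambda>_. signs K))) = PiE P (\<lambda>_. signs K)"
    using sign_choices config_partitions_finite[OF P_config] by (intro set_pmf_of_set)
  then show ?thesis using that components(1,3) P_config by simp
qed

lemma prob_random_hypergraph_le:
  assumes dvd: "K dvd N * r" and subset: "\<And>P a. P \<in> config_partitions N r K \<Longrightarrow> a \<in> PiE P (\<lambda>_. signs K)
    \<Longrightarrow> (P, a) \<in> E \<Longrightarrow> signed_hypergraph P a \<in> D"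
  shows "measure_pmf.prob (random_hypergraph K N r) E
      \<le> measure_pmf.prob (pmf_of_set (marked_partitions {..<N * r})) D"
proof -
  let ?G = "random_hypergraph K N r" and ?g = "\<lambda>G. signed_hypergraph (fst G) (snd G)"
  have "measure_pmf.prob ?G E = measure_pmf.prob ?G (E \<inter> set_pmf ?G)"
    by (rule measure_Int_set_pmf[symmetric])
  also have "\<dots> \<le> measure_pmf.prob ?G (?g -` D)"
    using subset by (intro measure_pmf.finite_measure_mono) (auto elim!: set_random_hypergraph[OF dvd])
  also have "\<dots> = measure_pmf.prob (pmf_of_set (marked_partitions {..<N * r})) D"
    unfolding map_random_hypergraph[OF dvd, symmetric] by simp
  finally show ?thesis .
qed

lemma energy_density_convergesI:
  fixes c base :: real
  assumes c_pos: "0 < c" and arity: "mK M = K"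
    and H_graph_eq: "\<And>N P a. P \<in> config_partitions N r K \<Longrightarrow> a \<in> PiE P (\<lambda>_. signs K) \<Longrightarrow>
      H_graph M N r (P, a) = ereal (c * max_energy {..<N} (signed_hypergraph P a) + base * real (card P))"
  shows "energy_density_converges M r"
proof -
  let ?U = "\<lambda>N. pmf_of_set (marked_partitions {..<N * r})"
  obtain h :: real where deviation_limit: "\<And>\<epsilon> :: real. 0 < \<epsilon> \<Longrightarrow>
      ((\<lambda>N. measure_pmf.prob (?U N) {Q. \<epsilon> * N < \<bar>max_energy {..<N} Q - N * h\<bar>}) \<longlongrightarrow> 0)
      (admissible_sizes K r)"
    using max_energy_density_converges by blast
  define h' where "h' = c * h + base * real r / real K"
  define E where "E \<epsilon> N = {G. \<not> (ereal (real N * (h' - \<epsilon>)) \<le> H_graph M N r G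
          \<and> H_graph M N r G \<le> ereal (real N * (h' + \<epsilon>)))}" for \<epsilon> N
  have deviates: "\<epsilon> / c * N < \<bar>max_energy {..<N} (signed_hypergraph P a) - N * h\<bar>"
    if P_config: "P \<in> config_partitions N r K" and a_signs: "a \<in> PiE P (\<lambda>_. signs K)"
      and in_E: "(P, a) \<in> E \<epsilon> N" for P a N and \<epsilon> :: real
  proof -
    have "real (card P) = N * r / K"
      using card_config_partition[OF P_config] K_pos by (simp add: field_simps flip: of_nat_mult)
    then have "H_graph M N r (P, a) = ereal (c * (max_energy {..<N} (signed_hypergraph P a) - N * h)
          + N * h')"
      using H_graph_eq[OF P_config a_signs] by (simp add: h'_def algebra_simps)
    then have "\<epsilon> * N < \<bar>c * (max_energy {..<N} (signed_hypergraph P a) - N * h)\<bar>"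
      using in_E by (auto simp: E_def algebra_simps)
    then have "\<epsilon> * N < c * \<bar>max_energy {..<N} (signed_hypergraph P a) - N * h\<bar>"
      using c_pos by (simp add: abs_mult)
    then show ?thesis using c_pos by (simp add: pos_divide_less_eq mult.commute)
  qed
  have "((\<lambda>N. measure_pmf.prob (random_hypergraph K N r) (E \<epsilon> N)) \<longlongrightarrow> 0) (admissible_sizes K r)"
    if \<epsilon>_pos: "0 < \<epsilon>" for \<epsilon>
  proof (rule tendsto_sandwich[OF _ _ tendsto_const deviation_limit])
    show "\<forall>\<^sub>F N in admissible_sizes K r. measure_pmf.prob (random_hypergraph K N r) (E \<epsilon> N)
        \<le> measure_pmf.prob (?U N) {Q. \<epsilon> / c * N < \<bar>max_energy {..<N} Q - N * h\<bar>}"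
      unfolding eventually_admissible_sizes
      by (intro exI[of _ 0] allI impI prob_random_hypergraph_le) (assumption | rule CollectI deviates)+
  qed (use \<epsilon>_pos c_pos in auto)
  then show ?thesis unfolding energy_density_converges_def arity E_def by blast
qed

lemma energy_signed_hypergraph:
  "energy V (signed_hypergraph P a) x = (\<Sum>i\<in>V. \<nu> (x i))
      + (\<Sum>B\<in>P. of_bool (\<not> bad (a B) (map x (edge_nodes r B))))"
proof -
  have "inj_on (\<lambda>B. (B, a B)) P" by (simp add: inj_on_def)
  then show ?thesis by (simp add: energy_def signed_hypergraph_def sum.reindex satisfied_def)
qed

lemma H_graph_eqI:
  fixes c base :: real
  assumes alphabet: "mq M = q" and c_pos: "0 < c"
    and upper: "\<And>x. x \<in> assignments {..<N} \<Longrightarrow> H_config M N r P a x \<le> ereal (c * energy {..<N} Q x + base)"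
    and attained: "\<And>x. x \<in> assignments {..<N} \<Longrightarrow> \<exists>y\<in>assignments {..<N}.
      energy {..<N} Q x \<le> energy {..<N} Q y \<and> H_config M N r P a y = ereal (c * energy {..<N} Q y + base)"
  shows "H_graph M N r (P, a) = ereal (c * max_energy {..<N} Q + base)"
proof -
  obtain x where x: "x \<in> assignments {..<N}" "energy {..<N} Q x = max_energy {..<N} Q"
    using max_energy_attained[of "{..<N}"] by blast
  obtain y where y: "y \<in> assignments {..<N}" "energy {..<N} Q x \<le> energy {..<N} Q y"
      "H_config M N r P a y = ereal (c * energy {..<N} Q y + base)"
    using attained[OF x(1)] by blast
  then have y_max: "energy {..<N} Q y = max_energy {..<N} Q"
    using x energy_le_max_energy[of "{..<N}" y Q] by simp
  have "PiE {..<N} (\<lambda>_. {..<mq M}) = assignments {..<N}" by (simp add: assignments_def alphabet)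
  then show ?thesis
    unfolding H_graph_def fst_conv snd_conv
  proof (simp only:, intro Max_eqI)
    show "ereal (c * max_energy {..<N} Q + base) \<in> H_config M N r P a ` assignments {..<N}"
      using y y_max by (metis image_eqI)
    fix v assume "v \<in> H_config M N r P a ` assignments {..<N}"
    then obtain x' where x': "x' \<in> assignments {..<N}" "v = H_config M N r P a x'" by blast
    have "c * energy {..<N} Q x' + base \<le> c * max_energy {..<N} Q + base"
      using c_pos x' by (intro add_right_mono mult_left_mono energy_le_max_energy) auto
    then show "v \<le> ereal (c * max_energy {..<N} Q + base)"
      unfolding x'(2) by (intro order_trans[OF upper[OF x'(1)]]) simp
  qed (simp add: finite_assignments)
qed

lemma energy_density_converges_finite_potentials:
  fixes c base :: real
  assumes c_pos: "0 < c" and shape: "mK M = K" "mq M = q"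
    and node: "\<And>s. s < q \<Longrightarrow> node_pot M s = ereal (c * \<nu> s)"
    and edge: "\<And>a xs. length a = K \<Longrightarrow> length xs = K
        \<Longrightarrow> edge_pot M a xs = ereal (base + c * of_bool (\<not> bad a xs))"
  shows "energy_density_converges M r"
proof (rule energy_density_convergesI[OF c_pos shape(1)])
  fix N P a assume P_config: "P \<in> config_partitions N r K" and a_signs: "a \<in> PiE P (\<lambda>_. signs K)"
  have "H_config M N r P a x = ereal (c * energy {..<N} (signed_hypergraph P a) x + base * real (card P))"
    if x_assignment: "x \<in> assignments {..<N}" for x
  proof -
    have "(\<Sum>i<N. node_pot M (x i)) = (\<Sum>i<N. ereal (c * \<nu> (x i)))"
      using PiE_mem[OF x_assignment[unfolded assignments_def]] by (intro sum.cong refl node) auto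
    moreover have "(\<Sum>B\<in>P. edge_pot M (a B) (map x (edge_nodes r B)))
      = (\<Sum>B\<in>P. ereal (base + c * of_bool (\<not> bad (a B) (map x (edge_nodes r B)))))"
      using PiE_mem[OF a_signs] config_partition_edge_nodes(1)[OF P_config]
      by (intro sum.cong refl edge) auto
    ultimately show ?thesis
      unfolding H_config_def energy_signed_hypergraph
      by (simp add: sum.distrib sum_distrib_left algebra_simps)
  qed
  then show "H_graph M N r (P, a) = ereal (c * max_energy {..<N} (signed_hypergraph P a)
        + base * real (card P))"
    by (intro H_graph_eqI shape c_pos) auto
qed

end

section \<open>The six models\<close>

lemma violations_mutually_related_pair:
  assumes B_sym_trans: "symp B" "transp B"
  shows "violations_mutually_related 2 q (\<lambda>a xs. B (xs ! 0) (xs ! 1))"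
  unfolding violations_mutually_related_def
proof (intro allI impI)
  fix V :: "nat set" and X :: "(nat \<Rightarrow> nat) set"
  define R where "R i j \<longleftrightarrow> (\<forall>x\<in>X. B (x i) (x j))" for i j
  have R_sym_trans: "symp R" "transp R" using B_sym_trans unfolding R_def symp_def transp_def by blast+
  have "card {a \<in> signs 2. \<forall>x\<in>X. B (map x e ! 0) (map x e ! 1)}
      = 2 ^ 2 * of_bool (mutually_related R (set e))"
    if "length e = 2" for e
  proof -
    have "\<exists>i j. e = [i, j]" using that by (auto simp: numeral_2_eq_2 length_Suc_conv)
    then obtain i j where e_eq: "e = [i, j]" by blast
    have "R i i \<and> R j j \<and> R j i" if "R i j"
      using that sympD[OF R_sym_trans(1) that] transpD[OF R_sym_trans(2)] by blast
    then have "mutually_related R (set e) \<longleftrightarrow> R i j" by (auto simp: e_eq mutually_related_def)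
    moreover have "{a \<in> signs 2. \<forall>x\<in>X. B (map x e ! 0) (map x e ! 1)} = (if R i j then signs 2 else {})"
      by (auto simp: e_eq R_def)
    ultimately show ?thesis using card_signs[of 2] by simp
  qed
  with R_sym_trans show "\<exists>k R. k \<le> 2 ^ 2 \<and> symp R \<and> transp R \<and> (\<forall>e. length e = 2 \<longrightarrow> set e \<subseteq> V \<longrightarrow>
      card {a \<in> signs 2. \<forall>x\<in>X. B (map x e ! 0) (map x e ! 1)} = k * of_bool (mutually_related R (set e)))"
    by (intro exI[of _ "2 ^ 2"] exI[of _ R]) simp
qed

lemma violations_mutually_relatedI_equal_or_disjoint:
  fixes K q :: nat and bad :: "bool list \<Rightarrow> nat list \<Rightarrow> bool" and R :: "(nat \<Rightarrow> nat) set \<Rightarrow> nat \<Rightarrow> nat \<Rightarrow> bool"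
  defines "S \<equiv> \<lambda>x e. {a \<in> signs K. bad a (map x e)}"
  assumes k_le: "k \<le> 2 ^ K" and R_sym_trans: "\<And>X. symp (R X)" "\<And>X. transp (R X)"
    and card_violated: "\<And>x e. length e = K \<Longrightarrow> \<forall>i\<in>set e. x i < q \<Longrightarrow> card (S x e) = k"
    and equal: "\<And>x y e. length e = K \<Longrightarrow> \<forall>i\<in>set e. x i < q \<and> y i < q \<Longrightarrow>
      S x e = S y e \<or> S x e \<inter> S y e = {}"
    and related: "\<And>X e. length e = K \<Longrightarrow> \<forall>x\<in>X. \<forall>i\<in>set e. x i < q \<Longrightarrow>
      mutually_related (R X) (set e) \<longleftrightarrow> (\<forall>x\<in>X. \<forall>y\<in>X. S x e = S y e)"
  shows "violations_mutually_related K q bad"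
  unfolding violations_mutually_related_def
proof (intro allI impI)
  fix V :: "nat set" and X :: "(nat \<Rightarrow> nat) set"
  assume X_assignments: "X \<noteq> {}" "X \<subseteq> PiE V (\<lambda>_. {..<q})"
  obtain x where x_in_X: "x \<in> X" using X_assignments(1) by blast
  have "card {a \<in> signs K. \<forall>x\<in>X. bad a (map x e)} = k * of_bool (mutually_related (R X) (set e))"
    if e_nodes: "length e = K" "set e \<subseteq> V" for e
  proof -
    have bound: "\<forall>x\<in>X. \<forall>i\<in>set e. x i < q" using X_assignments(2) e_nodes(2) by blast
    have common: "{a \<in> signs K. \<forall>x\<in>X. bad a (map x e)} = (\<Inter>x\<in>X. S x e)" using x_in_X by (auto simp: S_def)
    show ?thesis
    proof (cases "\<forall>x\<in>X. \<forall>y\<in>X. S x e = S y e")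
      case True
      then have "(\<Inter>x\<in>X. S x e) = S x e" using x_in_X by blast
      moreover have "card (S x e) = k" using card_violated[OF e_nodes(1)] bound x_in_X by blast
      moreover have "mutually_related (R X) (set e)" using related[OF e_nodes(1) bound] True by blast
      ultimately show ?thesis unfolding common by simp
    next
      case False
      then obtain y z where different: "y \<in> X" "z \<in> X" "S y e \<noteq> S z e" by blast
      then have "S y e \<inter> S z e = {}" using equal[OF e_nodes(1), of y z] bound by blast
      then have "(\<Inter>x\<in>X. S x e) = {}" using different(1,2) by blast
      moreover have "\<not> mutually_related (R X) (set e)" using related[OF e_nodes(1) bound] False by blast
      ultimately show ?thesis unfolding common by simp
    qed
  qed
  with k_le R_sym_trans show "\<exists>k R. k \<le> 2 ^ K \<and> symp R \<and> transp R \<and> (\<forall>e. length e = K \<longrightarrow> set e \<subseteq> V \<longrightarrow>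
      card {a \<in> signs K. \<forall>x\<in>X. bad a (map x e)} = k * of_bool (mutually_related R (set e)))"
    by (intro exI[of _ k] exI[of _ "R X"]) simp
qed

lemma map_eq_map_bit_iff:
  "length a = length e \<Longrightarrow> \<forall>i\<in>set e. x i < 2 \<Longrightarrow> map x e = map bit a \<longleftrightarrow> a = map (\<lambda>i. x i = 1) e"
  by (induction a e rule: list_induct2) (auto simp: bit_def less_2_cases_iff)

lemma map_eq_map_flipped_bit_iff:
  "length a = length e \<Longrightarrow> \<forall>i\<in>set e. x i < 2 \<Longrightarrow> map x e = map (\<lambda>b. 1 - bit b) a \<longleftrightarrow> a = map (\<lambda>i. x i \<noteq> 1) e"
  by (induction a e rule: list_induct2) (auto simp: bit_def less_2_cases_iff)

lemma violated_signs_ksat: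
  assumes "length e = K" "\<forall>i\<in>set e. x i < 2"
  shows "{a \<in> signs K. map x e = map bit a} = {map (\<lambda>i. x i = 1) e}"
proof (rule set_eqI)
  show "a \<in> {a \<in> signs K. map x e = map bit a} \<longleftrightarrow> a \<in> {map (\<lambda>i. x i = 1) e}" for a
    using assms map_eq_map_bit_iff[of a e x] by (cases "length a = K") auto
qed

lemma violations_mutually_related_ksat: "violations_mutually_related K 2 (\<lambda>a xs. xs = map bit a)"
proof -
  define frozen where "frozen X i \<longleftrightarrow> (\<forall>x\<in>X. \<forall>y\<in>X. (x i = 1) = (y i = 1))" for X :: "(nat \<Rightarrow> nat) set" and i
  let ?S = "\<lambda>x e. {a \<in> signs K. map x e = map bit a}"
  have eq_iff: "?S x e = ?S y e \<longleftrightarrow> (\<forall>i\<in>set e. (x i = 1) = (y i = 1))"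
    if "length e = K" "\<forall>i\<in>set e. x i < 2" "\<forall>i\<in>set e. y i < 2" for x y e
    unfolding violated_signs_ksat[OF that(1,2)] violated_signs_ksat[OF that(1,3)] by simp
  show ?thesis
  proof (rule violations_mutually_relatedI_equal_or_disjoint[where k = 1 and R = "\<lambda>X i j. frozen X i
          \<and> frozen X j"])
    show "card (?S x e) = 1" if "length e = K" "\<forall>i\<in>set e. x i < 2" for x e
      unfolding violated_signs_ksat[OF that] by simp
    show "?S x e = ?S y e \<or> ?S x e \<inter> ?S y e = {}" if "length e = K" "\<forall>i\<in>set e. x i < 2 \<and> y i < 2"
      for x y e
      using that violated_signs_ksat[of e K x] violated_signs_ksat[of e K y] by auto
    show "mutually_related (\<lambda>i j. frozen X i \<and> frozen X j) (set e) \<longleftrightarrow> (\<forall>x\<in>X. \<forall>y\<in>X. ?S x e = ?S y e)"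
      if "length e = K" "\<forall>x\<in>X. \<forall>i\<in>set e. x i < 2" for X e
    proof -
      have "(\<forall>x\<in>X. \<forall>y\<in>X. ?S x e = ?S y e) \<longleftrightarrow> (\<forall>x\<in>X. \<forall>y\<in>X. \<forall>i\<in>set e. (x i = 1) = (y i = 1))"
        using that by (intro ball_cong refl eq_iff) auto
      also have "\<dots> \<longleftrightarrow> (\<forall>i\<in>set e. frozen X i)" unfolding frozen_def by blast
      finally show ?thesis unfolding mutually_related_def by blast
    qed
  qed (auto intro: sympI transpI)
qed

lemma map_opposite_pair_eq_iff:
  fixes f g :: "'a \<Rightarrow> bool"
  shows "{map f e, map (\<lambda>i. \<not> f i) e} = {map g e, map (\<lambda>i. \<not> g i) e}
    \<longleftrightarrow> (\<forall>i\<in>set e. \<forall>j\<in>set e. (f i = f j) = (g i = g j))"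
proof -
  have "{map f e, map (\<lambda>i. \<not> f i) e} = {map g e, map (\<lambda>i. \<not> g i) e}
      \<longleftrightarrow> (\<forall>i\<in>set e. f i = g i) \<or> (\<forall>i\<in>set e. f i \<noteq> g i)"
    unfolding doubleton_eq_iff map_eq_conv by blast
  then show ?thesis by blast
qed

lemma violated_signs_naeksat:
  assumes "length e = K" "\<forall>i\<in>set e. x i < 2"
  shows "{a \<in> signs K. map x e = map bit a \<or> map x e = map (\<lambda>b. 1 - bit b) a}
    = {map (\<lambda>i. x i = 1) e, map (\<lambda>i. \<not> x i = 1) e}"
proof (rule set_eqI)
  show "a \<in> {a \<in> signs K. map x e = map bit a \<or> map x e = map (\<lambda>b. 1 - bit b) a}
      \<longleftrightarrow> a \<in> {map (\<lambda>i. x i = 1) e, map (\<lambda>i. \<not> x i = 1) e}" for a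
    using assms map_eq_map_bit_iff[of a e x] map_eq_map_flipped_bit_iff[of a e x]
    by (cases "length a = K") auto
qed

lemma map_opposite_pairs_equal_or_disjoint:
  fixes f g :: "'a \<Rightarrow> bool"
  shows "{map f e, map (\<lambda>i. \<not> f i) e} = {map g e, map (\<lambda>i. \<not> g i) e}
    \<or> {map f e, map (\<lambda>i. \<not> f i) e} \<inter> {map g e, map (\<lambda>i. \<not> g i) e} = {}"
proof -
  have pairs: "{a, a'} = {b, b'} \<or> {a, a'} \<inter> {b, b'} = {}" if "a = b \<longleftrightarrow> a' = b'" "a = b' \<longleftrightarrow> a' = b"
    for a a' b b' :: "bool list"
    using that by auto
  show ?thesis by (intro pairs) (unfold map_eq_conv, blast+)
qed

lemma violations_mutually_related_naeksat:
  assumes K_pos: "1 \<le> K"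
  shows "violations_mutually_related K 2 (\<lambda>a xs. xs = map bit a \<or> xs = map (\<lambda>b. 1 - bit b) a)"
proof -
  define aligned where "aligned X i j \<longleftrightarrow> (\<exists>c. \<forall>x\<in>X. ((x i = 1) = (x j = 1)) = c)"
    for X :: "(nat \<Rightarrow> nat) set" and i j
  have const_iff: "(\<exists>c. \<forall>x\<in>X. P x = c) \<longleftrightarrow> (\<forall>x\<in>X. \<forall>y\<in>X. P x = P y)" for X and P :: "(nat \<Rightarrow> nat) \<Rightarrow> bool"
    by metis
  let ?S = "\<lambda>x e. {a \<in> signs K. map x e = map bit a \<or> map x e = map (\<lambda>b. 1 - bit b) a}"
  have eq_iff: "?S x e = ?S y e \<longleftrightarrow> (\<forall>i\<in>set e. \<forall>j\<in>set e. ((x i = 1) = (x j = 1)) = ((y i = 1) = (y j = 1)))"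
    if "length e = K" "\<forall>i\<in>set e. x i < 2" "\<forall>i\<in>set e. y i < 2" for x y e
    unfolding violated_signs_naeksat[OF that(1,2)] violated_signs_naeksat[OF that(1,3)]
    by (rule map_opposite_pair_eq_iff)
  show ?thesis
  proof (rule violations_mutually_relatedI_equal_or_disjoint[where k = 2 and R = aligned])
    show "(2::nat) \<le> 2 ^ K" using K_pos self_le_power[of "2::nat" K] by simp
    show "symp (aligned X)" for X unfolding aligned_def by (rule sympI) metis
    show "transp (aligned X)" for X unfolding aligned_def by (rule transpI) metis
    show "card (?S x e) = 2" if "length e = K" "\<forall>i\<in>set e. x i < 2" for x e
    proof -
      have "e \<noteq> []" using that(1) K_pos by auto
      then show ?thesis unfolding violated_signs_naeksat[OF that] by (cases e) auto
    qed
    show "?S x e = ?S y e \<or> ?S x e \<inter> ?S y e = {}" if "length e = K" "\<forall>i\<in>set e. x i < 2 \<and> y i < 2"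
      for x y e
    proof -
      have spins: "\<forall>i\<in>set e. x i < 2" "\<forall>i\<in>set e. y i < 2" using that(2) by auto
      show ?thesis
        unfolding violated_signs_naeksat[OF that(1) spins(1)] violated_signs_naeksat[OF that(1) spins(2)]
        by (rule map_opposite_pairs_equal_or_disjoint)
    qed
    show "mutually_related (aligned X) (set e) \<longleftrightarrow> (\<forall>x\<in>X. \<forall>y\<in>X. ?S x e = ?S y e)"
      if "length e = K" "\<forall>x\<in>X. \<forall>i\<in>set e. x i < 2" for X e
    proof -
      have "(\<forall>x\<in>X. \<forall>y\<in>X. ?S x e = ?S y e)
          \<longleftrightarrow> (\<forall>x\<in>X. \<forall>y\<in>X. \<forall>i\<in>set e. \<forall>j\<in>set e. ((x i = 1) = (x j = 1)) = ((y i = 1) = (y j = 1)))"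
        using that by (intro ball_cong refl eq_iff) auto
      also have "\<dots> \<longleftrightarrow> (\<forall>i\<in>set e. \<forall>j\<in>set e. aligned X i j)" unfolding aligned_def const_iff by blast
      finally show ?thesis unfolding mutually_related_def by blast
    qed
  qed
qed

locale indep_set = spin_model 2 2 r "\<lambda>s. if s = 1 then 1 else 0" "\<lambda>a xs. xs ! 0 = 1 \<and> xs ! 1 = 1"
  for r :: nat
begin

definition violated :: "(nat \<Rightarrow> nat) \<Rightarrow> nat set \<Rightarrow> bool" where
  "violated x B \<longleftrightarrow> map x (edge_nodes r B) ! 0 = 1 \<and> map x (edge_nodes r B) ! 1 = 1"

lemma energy_eq_minus_violations:
  assumes "finite P"
  shows "energy V (signed_hypergraph P a) x
    = (\<Sum>i\<in>V. if x i = 1 then 1 else 0) + real (card P) - real (card {B \<in> P. violated x B})"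
proof -
  have "(\<Sum>B\<in>P. of_bool (\<not> violated x B)) = (\<Sum>B\<in>P. 1 - of_bool (violated x B) :: real)"
    by (intro sum.cong) auto
  also have "\<dots> = real (card P) - real (card {B \<in> P. violated x B})"
    using assms by (simp add: sum_subtractf Int_def)
  finally show ?thesis unfolding energy_signed_hypergraph violated_def[symmetric] by simp
qed

lemma H_config_indep_set:
  assumes "finite P"
  shows "H_config indep_set_model N r P a x = (if \<exists>B\<in>P. violated x B then -\<infinity>
    else ereal (energy {..<N} (signed_hypergraph P a) x - real (card P)))"
proof -
  have node: "(\<Sum>i<N. node_pot indep_set_model (x i)) = ereal (\<Sum>i<N. if x i = 1 then 1 else 0)"
    unfolding sum_ereal[symmetric] by (intro sum.cong refl) (simp add: indep_set_model_def)
  have edge: "edge_pot indep_set_model (a B) (map x (edge_nodes r B)) = (if violated x B then -\<infinity> else 0)"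
    for B
    by (simp add: indep_set_model_def violated_def)
  show ?thesis
  proof (cases "\<exists>B\<in>P. violated x B")
    case True
    then obtain B where B: "B \<in> P" "violated x B" by blast
    have "(\<Sum>B\<in>P - {B}. if violated x B then -\<infinity> else 0 :: ereal) \<le> 0" by (intro sum_nonpos) auto
    then have "(\<Sum>B\<in>P. if violated x B then -\<infinity> else 0 :: ereal) = -\<infinity>"
      using B assms by (subst sum.remove[of _ B]) auto
    then show ?thesis using True unfolding H_config_def node edge by simp
  next
    case False
    then have none: "(\<Sum>B\<in>P. if violated x B then -\<infinity> else 0 :: ereal) = 0" "{B \<in> P. violated x B} = {}"
      by (auto intro: sum.neutral)
    show ?thesis using False unfolding H_config_def node edge energy_eq_minus_violations[OF assms] none by simp
  qed
qed

text \<open>Giving an endpoint of a violated edge the spin 0 costs 1 and repairs at least one violated edge, so a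
  penalty of 1 per violated edge is as good as a hard constraint.\<close>

lemma repair_violations:
  assumes P_config: "P \<in> config_partitions N r 2"
  shows "x \<in> assignments {..<N} \<Longrightarrow> \<exists>y\<in>assignments {..<N}. \<not> (\<exists>B\<in>P. violated y B)
    \<and> energy {..<N} (signed_hypergraph P a) x \<le> energy {..<N} (signed_hypergraph P a) y"
proof (induction "card {B \<in> P. violated x B}" arbitrary: x rule: less_induct)
  case less
  have finite_P: "finite P" by (rule config_partitions_finite[OF P_config])
  show ?case
  proof (cases "\<exists>B\<in>P. violated x B")
    case True
    then obtain B where B: "B \<in> P" "violated x B" by blast
    define i where "i = edge_nodes r B ! 0"
    note nodes = config_partition_edge_nodes[OF P_config]
    have "i \<in> set (edge_nodes r B)" by (simp add: i_def nodes(1)[OF B(1)])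
    then have "i < N" using nodes(2)[OF B(1)] by auto
    moreover have "x i = 1" using B(2) nodes(1)[OF B(1)] by (simp add: i_def violated_def)
    ultimately have i: "i < N" "x i = 1" .
    define y where "y = x(i := 0)"
    have y_assignment: "y \<in> assignments {..<N}"
      using less.prems i unfolding assignments_def y_def PiE_def extensional_def by auto
    have "violated x B'" if "B' \<in> P" "violated y B'" for B'
      using that(2) nodes(1)[OF that(1)] by (auto simp: violated_def y_def split: if_splits)
    moreover have "\<not> violated y B" using nodes(1)[OF B(1)] by (simp add: violated_def y_def i_def)
    ultimately have "{B \<in> P. violated y B} \<subset> {B \<in> P. violated x B}" using B by blast
    then have fewer: "card {B \<in> P. violated y B} < card {B \<in> P. violated x B}"
      using finite_P by (intro psubset_card_mono) auto
    have "(\<Sum>j<N. if x j = 1 then 1 else 0 :: real) = 1 + (\<Sum>j\<in>{..<N} - {i}. if x j = 1 then 1 else 0)"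
      using i by (subst sum.remove[of _ i]) auto
    moreover have "(\<Sum>j<N. if y j = 1 then 1 else 0 :: real)
        = 0 + (\<Sum>j\<in>{..<N} - {i}. if x j = 1 then 1 else 0)"
      using i by (subst sum.remove[of _ i]) (auto simp: y_def intro!: sum.cong)
    ultimately have "energy {..<N} (signed_hypergraph P a) x \<le> energy {..<N} (signed_hypergraph P a) y"
      unfolding energy_eq_minus_violations[OF finite_P] using fewer by simp
    then show ?thesis using less.hyps[OF fewer y_assignment] by (meson order_trans)
  qed (use less.prems in auto)
qed

end

lemma energy_density_converges_indep_set:
  assumes "1 \<le> r"
  shows "energy_density_converges indep_set_model r"
proof -
  have "symp (\<lambda>s t :: nat. s = 1 \<and> t = 1)" "transp (\<lambda>s t :: nat. s = 1 \<and> t = 1)"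
    by (auto simp: symp_def transp_def)
  then have "violations_mutually_related 2 2 (\<lambda>a xs. xs ! 0 = 1 \<and> xs ! 1 = 1)"
    by (rule violations_mutually_related_pair)
  then interpret indep_set r by unfold_locales (use assms in auto)
  show ?thesis
  proof (rule energy_density_convergesI[where c = 1 and base = "- 1"])
    fix N P a assume P_config: "P \<in> config_partitions N r 2"
    note H_config_eq = H_config_indep_set[OF config_partitions_finite[OF P_config]]
    show "H_graph indep_set_model N r (P, a)
        = ereal (1 * max_energy {..<N} (signed_hypergraph P a) + - 1 * real (card P))"
    proof (rule H_graph_eqI)
      fix x assume x_assignment: "x \<in> assignments {..<N}"
      show "H_config indep_set_model N r P a x
          \<le> ereal (1 * energy {..<N} (signed_hypergraph P a) x + - 1 * real (card P))"
        by (simp add: H_config_eq)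
      show "\<exists>y\<in>assignments {..<N}. energy {..<N} (signed_hypergraph P a) x
          \<le> energy {..<N} (signed_hypergraph P a) y
          \<and> H_config indep_set_model N r P a y
          = ereal (1 * energy {..<N} (signed_hypergraph P a) y + - 1 * real (card P))"
        using repair_violations[OF P_config x_assignment, of a] unfolding H_config_eq by force
    qed (simp_all add: indep_set_model_def)
  qed (simp_all add: indep_set_model_def)
qed

lemma spin_model_equal_pair: "1 \<le> q \<Longrightarrow> 1 \<le> r \<Longrightarrow> spin_model 2 q r (\<lambda>a xs. xs ! 0 = xs ! 1)"
  using violations_mutually_related_pair[of "(=)" q] by unfold_locales (auto simp: symp_def transp_def)

lemma energy_density_converges_ising:
  assumes "1 \<le> r" "0 < \<beta>"
  shows "energy_density_converges (ising_model \<beta> B) r"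
proof -
  interpret spin_model 2 2 r "\<lambda>s. (if s = 0 then - B else B) / (2 * \<beta>)" "\<lambda>a xs. xs ! 0 = xs ! 1"
    by (rule spin_model_equal_pair) (use assms in auto)
  show ?thesis
    by (rule energy_density_converges_finite_potentials[where c = "2 * \<beta>" and base = "- \<beta>"])
      (use assms in \<open>auto simp: ising_model_def\<close>)
qed

lemma energy_density_converges_coloring:
  assumes "1 \<le> r" "1 \<le> q"
  shows "energy_density_converges (coloring_model q) r"
proof -
  interpret spin_model 2 q r "\<lambda>_. 0" "\<lambda>a xs. xs ! 0 = xs ! 1"
    by (rule spin_model_equal_pair) (use assms in auto)
  show ?thesis
    by (rule energy_density_converges_finite_potentials[where c = 1 and base = 0])
      (auto simp: coloring_model_def)
qed

lemma maxcut_eq_coloring: "maxcut_model = coloring_model 2"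
  by (simp add: maxcut_model_def coloring_model_def)

lemma energy_density_converges_ksat:
  assumes "1 \<le> r" "1 \<le> K"
  shows "energy_density_converges (ksat_model K) r"
proof -
  interpret spin_model K 2 r "\<lambda>_. 0" "\<lambda>a xs. xs = map bit a"
    by unfold_locales (use assms violations_mutually_related_ksat in auto)
  show ?thesis
    by (rule energy_density_converges_finite_potentials[where c = 1 and base = 0])
      (auto simp: ksat_model_def)
qed

lemma energy_density_converges_naeksat:
  assumes "1 \<le> r" "1 \<le> K"
  shows "energy_density_converges (naeksat_model K) r"
proof -
  interpret spin_model K 2 r "\<lambda>_. 0" "\<lambda>a xs. xs = map bit a \<or> xs = map (\<lambda>b. 1 - bit b) a"
    by unfold_locales (use assms violations_mutually_related_naeksat in auto)
  show ?thesis
    by (rule energy_density_converges_finite_potentials[where c = 1 and base = 0])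
      (auto simp: naeksat_model_def)
qed

theorem theorem3:
  fixes r :: nat and M :: model
  assumes "r \<ge> 1" and "paper_model M"
  shows "\<exists>h :: real. \<forall>\<epsilon>>0. \<forall>\<delta>>0. \<exists>N0. \<forall>N\<ge>N0. mK M dvd N * r \<longrightarrow>
           measure_pmf.prob (random_hypergraph (mK M) N r)
             {G. \<not> (ereal (real N * (h - \<epsilon>)) \<le> H_graph M N r G
                    \<and> H_graph M N r G \<le> ereal (real N * (h + \<epsilon>)))} < \<delta>"
proof -
  have "energy_density_converges M r"
    using assms energy_density_converges_indep_set energy_density_converges_ising
      energy_density_converges_coloring
      energy_density_converges_ksat energy_density_converges_naeksat
    unfolding paper_model_def maxcut_eq_coloring by (elim disjE exE conjE) auto
  then obtain h :: real where h: "\<forall>\<epsilon>>0. ((\<lambda>N. measure_pmf.prob (random_hypergraph (mK M) N r)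
      {G. \<not> (ereal (real N * (h - \<epsilon>)) \<le> H_graph M N r G \<and> H_graph M N r G \<le> ereal (real N * (h + \<epsilon>)))})
    \<longlongrightarrow> 0) (admissible_sizes (mK M) r)"
    unfolding energy_density_converges_def by blast
  show ?thesis
    using order_tendstoD(2)[OF h[rule_format]] unfolding eventually_admissible_sizes by blast
qed

end
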